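(* Let $R$ be essentially of finite type over an $F$-finite field of characteristic $p>0$, let $(M,\kappa)$ be a Cartier module over $R$, let $f\in R$ be an $M$-regular element such that $M_f$ is $F$-regular, and let $\lambda$ be a positive rational number. If the denominator of $\lambda$ is divisible by $p$, then $\sigma(M,f^\lambda)=\tau(M,f^{\lambda+\varepsilon})$ for all $0<\varepsilon\ll1$.
   Context: All rings are commutative Noetherian of prime characteristic $p$; $F$ is the Frobenius, and $F^e_*M$ is $M$ with $R$ acting through $p^e$-th powers. $R$ is $F$-finite if $F_*R$ is a finitely generated $R$-module. A Cartier module $(M,\kappa)$ is a finitely generated $R$-module $M$ with an $R$-linear map $\kappa\colon F_*M\to M$; $\kappa^e\colon F^e_*M\to M$ is its iterate, and for $g\in R$, $\kappa^e g$ denotes $m\mapsto\kappa^e(gm)$. $f\in R$ is $M$-regular if it is a non-zero-divisor on $M$. A Cartier algebra is an $\mathbb N$-graded ring $\mathcal C=\bigoplus_{e\ge0}\mathcal C_e$ with $\mathcal C_0=R$ and $r\varphi=\varphi r^{p^e}$ for $\varphi\in\mathcal C_e$, $r\in R$; $\mathcal C_+=\bigoplus_{e\ge1}\mathcal C_e$. A $\mathcal C$-module is a left $\mathcal C$-module finitely generated over $R$; it is nilpotent if $\mathcal C_+^aM=0$ for some $a$; a morphism is a nil-isomorphism if its kernel and cokernel are nilpotent. Test modules: for $f\in R$ and rational $\lambda\ge0$ let $\mathcal C$ be the Cartier algebra with $\mathcal C_0=R$, $\mathcal C_e=\kappa^ef^{\lceil\lambda p^e\rceil}R$ ($e\ge1$),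 acting on $M$. $\tau(M,f^\lambda)$ is the smallest $\mathcal C$-submodule $N\subseteq M$ such that $H^0_\eta(N)_\eta\subseteq H^0_\eta(M)_\eta$ is a nil-isomorphism for every associated prime $\eta$ of the $R$-module $M$ ($H^0_\eta$ = elements killed by a power of $\eta$; the outer subscript is localization). If $R$ is essentially of finite type over an $F$-finite field, $\tau(M,f^\lambda)$ exists for all $\lambda$ and is a non-increasing, right-continuous, discrete filtration. $(M,\kappa)$ is $F$-regular if $\tau(M,f^0)=M$; $M_f$ is a Cartier module over $R_f$ via $\kappa(m/f^{n})=\kappa(f^{n(p-1)}m)/f^{n}$. Non-$F$-pure modules: for rational $\lambda\ge0$ let $\mathcal C=\bigoplus_{e\ge0}\kappa^ef^{\lceil\lambda(p^e-1)\rceil}R$ (note the exponent $p^e-1$). Then $\sigma(M,f^\lambda)$ is the stable value $\mathcal C_+^hM$, $h\gg0$, of the descending chain $\mathcal C_+M\supseteq\mathcal C_+^2M\supseteq\cdots$ (which stabilizes for any $F$-finite $R$). Denominators are taken in lowest terms. *)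

theory Defs
  imports "HOL-Algebra.Module" "HOL-Algebra.Ring_Divisibility" "HOL-Algebra.Ideal_Product"
    "HOL-Algebra.Generated_Rings" "HOL-Algebra.Generated_Groups" "HOL-Computational_Algebra.Primes"
begin

section \<open>Modules\<close>

definition self_module :: "('a, 'r) ring_scheme \<Rightarrow> ('a, 'a) module" where
  "self_module R = \<lparr>carrier = carrier R, monoid.mult = monoid.mult R, one = \<one>\<^bsub>R\<^esub>,
     ring.zero = \<zero>\<^bsub>R\<^esub>, add = add R, smult = monoid.mult R\<rparr>"

definition fin_gen_module :: "('a, 'r) ring_scheme \<Rightarrow> ('a, 'm, 'z) module_scheme \<Rightarrow> bool" where
  "fin_gen_module R M \<longleftrightarrow> (\<exists>X. finite X \<and> X \<subseteq> carrier M \<and>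
     (\<forall>m \<in> carrier M. \<exists>c \<in> X \<rightarrow> carrier R. m = (\<Oplus>\<^bsub>M\<^esub>x\<in>X. c x \<odot>\<^bsub>M\<^esub> x)))"

definition linear_map ::
  "('a, 'r) ring_scheme \<Rightarrow> ('a, 'm, 'y) module_scheme \<Rightarrow> ('a, 'n, 'z) module_scheme \<Rightarrow> ('m \<Rightarrow> 'n) \<Rightarrow> bool" where
  "linear_map R M N h \<longleftrightarrow> h \<in> carrier M \<rightarrow> carrier N \<and>
     (\<forall>x \<in> carrier M. \<forall>y \<in> carrier M. h (x \<oplus>\<^bsub>M\<^esub> y) = h x \<oplus>\<^bsub>N\<^esub> h y) \<and>
     (\<forall>r \<in> carrier R. \<forall>x \<in> carrier M. h (r \<odot>\<^bsub>M\<^esub> x) = r \<odot>\<^bsub>N\<^esub> h x)"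

definition regular_on :: "('a, 'm, 'z) module_scheme \<Rightarrow> 'a \<Rightarrow> bool" where
  "regular_on M f \<longleftrightarrow> (\<forall>m \<in> carrier M. f \<odot>\<^bsub>M\<^esub> m = \<zero>\<^bsub>M\<^esub> \<longrightarrow> m = \<zero>\<^bsub>M\<^esub>)"

definition annihilator :: "('a, 'r) ring_scheme \<Rightarrow> ('a, 'm, 'z) module_scheme \<Rightarrow> 'm \<Rightarrow> 'a set" where
  "annihilator R M m = {r \<in> carrier R. r \<odot>\<^bsub>M\<^esub> m = \<zero>\<^bsub>M\<^esub>}"

definition associated_primes :: "('a, 'r) ring_scheme \<Rightarrow> ('a, 'm, 'z) module_scheme \<Rightarrow> 'a set set" where
  "associated_primes R M = {\<eta>. primeideal \<eta> R \<and> (\<exists>m \<in> carrier M. \<eta> = annihilator R M m)}"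

definition ideal_power :: "('a, 'r) ring_scheme \<Rightarrow> 'a set \<Rightarrow> nat \<Rightarrow> 'a set" where
  "ideal_power R I k = (ideal_prod R I ^^ k) (carrier R)"

text \<open>For a submodule \<open>N\<close> of \<open>M\<close>, \<open>H0 R M \<eta> N\<close> is $H^0_\eta(N)$.\<close>

definition H0 :: "('a, 'r) ring_scheme \<Rightarrow> ('a, 'm, 'z) module_scheme \<Rightarrow> 'a set \<Rightarrow> 'm set \<Rightarrow> 'm set" where
  "H0 R M \<eta> N = {x \<in> N. \<exists>k. \<forall>a \<in> ideal_power R \<eta> k. a \<odot>\<^bsub>M\<^esub> x = \<zero>\<^bsub>M\<^esub>}"


section \<open>Localization\<close>

text \<open>\<open>loc_frac R S M m s\<close> is the fraction \<open>m/s\<close>, i.e. the class of all pairs \<open>(m', s')\<close> with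
  \<open>t s' m = t s m'\<close> for some \<open>t \<in> S\<close>. Operations on fractions are defined as the union of the
  results over all representatives; these results coincide when \<open>S\<close> is multiplicatively closed.\<close>

definition loc_frac ::
  "('a, 'r) ring_scheme \<Rightarrow> 'a set \<Rightarrow> ('a, 'm, 'z) module_scheme \<Rightarrow> 'm \<Rightarrow> 'a \<Rightarrow> ('m \<times> 'a) set" where
  "loc_frac R S M m s = {(m', s'). m' \<in> carrier M \<and> s' \<in> S \<and>
     (\<exists>t \<in> S. (t \<otimes>\<^bsub>R\<^esub> s') \<odot>\<^bsub>M\<^esub> m = (t \<otimes>\<^bsub>R\<^esub> s) \<odot>\<^bsub>M\<^esub> m')}"

definition loc_subset ::
  "('a, 'r) ring_scheme \<Rightarrow> 'a set \<Rightarrow> ('a, 'm, 'z) module_scheme \<Rightarrow> 'm set \<Rightarrow> ('m \<times> 'a) set set" where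
  "loc_subset R S M N = {loc_frac R S M m s | m s. m \<in> N \<and> s \<in> S}"

definition loc_add :: "('a, 'r) ring_scheme \<Rightarrow> 'a set \<Rightarrow> ('a, 'm, 'z) module_scheme \<Rightarrow>
    ('m \<times> 'a) set \<Rightarrow> ('m \<times> 'a) set \<Rightarrow> ('m \<times> 'a) set" where
  "loc_add R S M X Y = (\<Union>(m, s) \<in> X. \<Union>(n, t) \<in> Y.
     loc_frac R S M (t \<odot>\<^bsub>M\<^esub> m \<oplus>\<^bsub>M\<^esub> s \<odot>\<^bsub>M\<^esub> n) (s \<otimes>\<^bsub>R\<^esub> t))"

definition loc_smult :: "('a, 'r) ring_scheme \<Rightarrow> 'a set \<Rightarrow> ('a, 'm, 'z) module_scheme \<Rightarrow>
    ('a \<times> 'a) set \<Rightarrow> ('m \<times> 'a) set \<Rightarrow> ('m \<times> 'a) set" where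
  "loc_smult R S M A X = (\<Union>(a, s) \<in> A. \<Union>(m, t) \<in> X. loc_frac R S M (a \<odot>\<^bsub>M\<^esub> m) (s \<otimes>\<^bsub>R\<^esub> t))"

definition loc_ring :: "('a, 'r) ring_scheme \<Rightarrow> 'a set \<Rightarrow> ('a \<times> 'a) set ring" where
  "loc_ring R S = \<lparr>
     carrier = loc_subset R S (self_module R) (carrier R),
     monoid.mult = loc_smult R S (self_module R),
     one = loc_frac R S (self_module R) \<one>\<^bsub>R\<^esub> \<one>\<^bsub>R\<^esub>,
     ring.zero = loc_frac R S (self_module R) \<zero>\<^bsub>R\<^esub> \<one>\<^bsub>R\<^esub>,
     add = loc_add R S (self_module R)\<rparr>"

text \<open>The fields \<open>mult\<close> and \<open>one\<close> of a module record have no meaning for modules.\<close>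

definition loc_module ::
  "('a, 'r) ring_scheme \<Rightarrow> 'a set \<Rightarrow> ('a, 'm, 'z) module_scheme \<Rightarrow> (('a \<times> 'a) set, ('m \<times> 'a) set) module" where
  "loc_module R S M = \<lparr>
     carrier = loc_subset R S M (carrier M),
     monoid.mult = undefined,
     one = undefined,
     ring.zero = loc_frac R S M \<zero>\<^bsub>M\<^esub> \<one>\<^bsub>R\<^esub>,
     add = loc_add R S M,
     smult = loc_smult R S M\<rparr>"

text \<open>The structure map of the localized Cartier module: \<open>m/s \<mapsto> \<kappa>(s\<^sup>p\<^sup>-\<^sup>1 m)/s\<close>.\<close>

definition loc_kappa :: "nat \<Rightarrow> ('a, 'r) ring_scheme \<Rightarrow> 'a set \<Rightarrow> ('a, 'm, 'z) module_scheme \<Rightarrow>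
    ('m \<Rightarrow> 'm) \<Rightarrow> ('m \<times> 'a) set \<Rightarrow> ('m \<times> 'a) set" where
  "loc_kappa p R S M \<kappa> X =
     (\<Union>(m, s) \<in> X. loc_frac R S M (\<kappa> ((s [^]\<^bsub>R\<^esub> (p - 1)) \<odot>\<^bsub>M\<^esub> m)) s)"

definition powers_of :: "('a, 'r) ring_scheme \<Rightarrow> 'a \<Rightarrow> 'a set" where
  "powers_of R f = range (\<lambda>n::nat. f [^]\<^bsub>R\<^esub> n)"


section \<open>Rings of prime characteristic\<close>

definition prime_char :: "nat \<Rightarrow> ('a, 'r) ring_scheme \<Rightarrow> bool" where
  "prime_char p R \<longleftrightarrow> Factorial_Ring.prime p \<and> add_pow R p \<one>\<^bsub>R\<^esub> = \<zero>\<^bsub>R\<^esub>"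

definition frob_push ::
  "nat \<Rightarrow> nat \<Rightarrow> ('a, 'r) ring_scheme \<Rightarrow> ('a, 'm, 'z) module_scheme \<Rightarrow> ('a, 'm, 'z) module_scheme" where
  "frob_push p e R M = M\<lparr>smult := \<lambda>r m. (r [^]\<^bsub>R\<^esub> (p ^ e)) \<odot>\<^bsub>M\<^esub> m\<rparr>"

definition F_finite :: "nat \<Rightarrow> ('a, 'r) ring_scheme \<Rightarrow> bool" where
  "F_finite p R \<longleftrightarrow> fin_gen_module R (frob_push p 1 R (self_module R))"

text \<open>\<open>R\<close> is isomorphic to a localization \<open>S\<inverse>A\<close> of a finitely generated \<open>K\<close>-algebra \<open>A\<close>. Taking
  the elements of \<open>A\<close> in the type of the elements of \<open>R\<close> is no restriction, as \<open>A\<close> may be replaced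
  by its image in \<open>R\<close>.\<close>

definition ess_finite_type :: "('k, 'l) ring_scheme \<Rightarrow> 'a ring \<Rightarrow> bool" where
  "ess_finite_type K R \<longleftrightarrow> (\<exists>(A :: 'a ring) \<phi> X S.
     cring A \<and> \<phi> \<in> ring_hom K A \<and>
     finite X \<and> X \<subseteq> carrier A \<and> generate_ring A (\<phi> ` carrier K \<union> X) = carrier A \<and>
     submonoid S A \<and> loc_ring A S \<simeq> R)"

definition cartier_module ::
  "nat \<Rightarrow> ('a, 'r) ring_scheme \<Rightarrow> ('a, 'm, 'z) module_scheme \<Rightarrow> ('m \<Rightarrow> 'm) \<Rightarrow> bool" where
  "cartier_module p R M \<kappa> \<longleftrightarrow>
     module R M \<and> fin_gen_module R M \<and> linear_map R (frob_push p 1 R M) M \<kappa>"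


section \<open>Cartier algebras and their modules\<close>

text \<open>All Cartier algebras considered here are graded subrings, with degree zero part \<open>R\<close>, of the
  graded ring $\bigoplus_e \kappa^e R$ with multiplication
  $\kappa^d b \cdot \kappa^e c = \kappa^{d+e} b^{p^e} c$, in which in particular
  $r \cdot \kappa^e c = \kappa^e c \cdot r^{p^e}$. Such an algebra is given by its homogeneous
  components \<open>C e\<close>, where \<open>c \<in> C e\<close> stands for $\kappa^e c$.\<close>

definition cartier_algebra :: "nat \<Rightarrow> ('a, 'r) ring_scheme \<Rightarrow> (nat \<Rightarrow> 'a set) \<Rightarrow> bool" where
  "cartier_algebra p R C \<longleftrightarrow> C 0 = carrier R \<and>
     (\<forall>e. additive_subgroup (C e) R) \<and>
     (\<forall>d e. \<forall>b \<in> C d. \<forall>c \<in> C e. (b [^]\<^bsub>R\<^esub> (p ^ e)) \<otimes>\<^bsub>R\<^esub> c \<in> C (d + e))"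

text \<open>An \<open>R\<close>-module \<open>M\<close> together with an action of the homogeneous elements:
  \<open>cact M e c x\<close> is the result of applying \<open>c \<in> C e\<close> to \<open>x\<close>.\<close>

record ('a, 'm) cmodule = "('a, 'm) module" +
  cact :: "nat \<Rightarrow> 'a \<Rightarrow> 'm \<Rightarrow> 'm"

definition cmodule_of :: "('a, 'm) module \<Rightarrow> ('m \<Rightarrow> 'm) \<Rightarrow> ('a, 'm) cmodule" where
  "cmodule_of M \<kappa> = module.extend M \<lparr>cact = \<lambda>e c x. (\<kappa> ^^ e) (c \<odot>\<^bsub>M\<^esub> x)\<rparr>"

definition csubmodule ::
  "('a, 'r) ring_scheme \<Rightarrow> (nat \<Rightarrow> 'a set) \<Rightarrow> ('a, 'm) cmodule \<Rightarrow> 'm set \<Rightarrow> bool" where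
  "csubmodule R C M N \<longleftrightarrow> submodule N R M \<and> (\<forall>e. \<forall>c \<in> C e. \<forall>x \<in> N. cact M e c x \<in> N)"

definition cmodule_hom ::
  "('a, 'r) ring_scheme \<Rightarrow> (nat \<Rightarrow> 'a set) \<Rightarrow> ('a, 'm) cmodule \<Rightarrow> ('a, 'n) cmodule \<Rightarrow> ('m \<Rightarrow> 'n) \<Rightarrow> bool" where
  "cmodule_hom R C M N h \<longleftrightarrow> linear_map R M N h \<and>
     (\<forall>e. \<forall>c \<in> C e. \<forall>x \<in> carrier M. h (cact M e c x) = cact N e c (h x))"

definition quot_cmodule :: "('a, 'm) cmodule \<Rightarrow> 'm set \<Rightarrow> ('a, 'm set) cmodule" where
  "quot_cmodule M N = \<lparr>
     carrier = a_rcosets\<^bsub>M\<^esub> N,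
     monoid.mult = undefined,
     one = undefined,
     ring.zero = N,
     add = set_add M,
     smult = (\<lambda>r X. \<Union>x \<in> X. N +>\<^bsub>M\<^esub> (r \<odot>\<^bsub>M\<^esub> x)),
     cact = (\<lambda>e c X. \<Union>x \<in> X. N +>\<^bsub>M\<^esub> cact M e c x)\<rparr>"

text \<open>$\mathcal C_+ N$ and $\mathcal C_+^h M$; sums of products of homogeneous elements
  with elements of the module.\<close>

definition cplus_mult :: "(nat \<Rightarrow> 'a set) \<Rightarrow> ('a, 'm) cmodule \<Rightarrow> 'm set \<Rightarrow> 'm set" where
  "cplus_mult C M N = generate (add_monoid M) {cact M e c x | e c x. 1 \<le> e \<and> c \<in> C e \<and> x \<in> N}"

definition cplus_power :: "(nat \<Rightarrow> 'a set) \<Rightarrow> ('a, 'm) cmodule \<Rightarrow> nat \<Rightarrow> 'm set" where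
  "cplus_power C M h = (cplus_mult C M ^^ h) (carrier M)"

definition nilpotent_cmodule :: "(nat \<Rightarrow> 'a set) \<Rightarrow> ('a, 'm) cmodule \<Rightarrow> bool" where
  "nilpotent_cmodule C M \<longleftrightarrow> (\<exists>a. cplus_power C M a = {\<zero>\<^bsub>M\<^esub>})"

definition nil_isomorphism ::
  "('a, 'r) ring_scheme \<Rightarrow> (nat \<Rightarrow> 'a set) \<Rightarrow> ('a, 'm) cmodule \<Rightarrow> ('a, 'n) cmodule \<Rightarrow> ('m \<Rightarrow> 'n) \<Rightarrow> bool" where
  "nil_isomorphism R C M N h \<longleftrightarrow> cmodule_hom R C M N h \<and>
     nilpotent_cmodule C (M\<lparr>carrier := a_kernel M N h\<rparr>) \<and>
     nilpotent_cmodule C (quot_cmodule N (h ` carrier M))"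


section \<open>Test modules\<close>

definition tau_algebra :: "nat \<Rightarrow> ('a, 'r) ring_scheme \<Rightarrow> 'a \<Rightarrow> rat \<Rightarrow> nat \<Rightarrow> 'a set" where
  "tau_algebra p R f l e = (if e = 0 then carrier R
     else PIdl\<^bsub>R\<^esub> (f [^]\<^bsub>R\<^esub> nat \<lceil>l * of_nat (p ^ e)\<rceil>))"

text \<open>Both modules in the condition at \<open>\<eta>\<close> are realized inside the Cartier module \<open>M\<^sub>\<eta>\<close> over
  \<open>R\<^sub>\<eta>\<close>, with the action of the localized algebra
  $\mathcal C_\eta = R_\eta \oplus \bigoplus_{e \ge 1} \kappa^e f^{\lceil \lambda p^e\rceil} R_\eta$.\<close>

definition test_condition ::
  "nat \<Rightarrow> 'a ring \<Rightarrow> ('a, 'm) module \<Rightarrow> ('m \<Rightarrow> 'm) \<Rightarrow> 'a \<Rightarrow> rat \<Rightarrow> 'm set \<Rightarrow> bool" where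
  "test_condition p R M \<kappa> f l N \<longleftrightarrow>
     (\<forall>\<eta> \<in> associated_primes R M.
        let S = carrier R - \<eta>;
            R' = loc_ring R S;
            f' = loc_frac R S (self_module R) f \<one>\<^bsub>R\<^esub>;
            M' = cmodule_of (loc_module R S M) (loc_kappa p R S M \<kappa>)
        in nil_isomorphism R' (tau_algebra p R' f' l)
             (M'\<lparr>carrier := loc_subset R S M (H0 R M \<eta> N)\<rparr>)
             (M'\<lparr>carrier := loc_subset R S M (H0 R M \<eta> (carrier M))\<rparr>)
             (\<lambda>x. x))"

text \<open>\<open>is_tau p R M \<kappa> f l N\<close> says that $\tau(M, f^l)$ exists and equals \<open>N\<close>, and
  \<open>is_sigma p R M \<kappa> f l N\<close> that $\sigma(M, f^l)$ exists and equals \<open>N\<close>. Both determine \<open>N\<close>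
  uniquely.\<close>

definition is_tau ::
  "nat \<Rightarrow> 'a ring \<Rightarrow> ('a, 'm) module \<Rightarrow> ('m \<Rightarrow> 'm) \<Rightarrow> 'a \<Rightarrow> rat \<Rightarrow> 'm set \<Rightarrow> bool" where
  "is_tau p R M \<kappa> f l N \<longleftrightarrow>
     csubmodule R (tau_algebra p R f l) (cmodule_of M \<kappa>) N \<and> test_condition p R M \<kappa> f l N \<and>
     (\<forall>N'. csubmodule R (tau_algebra p R f l) (cmodule_of M \<kappa>) N' \<and> test_condition p R M \<kappa> f l N'
        \<longrightarrow> N \<subseteq> N')"

text \<open>For \<open>l = 0\<close> the module $\tau(M, f^0)$ does not depend on \<open>f\<close>.\<close>

definition F_regular :: "nat \<Rightarrow> 'a ring \<Rightarrow> ('a, 'm) module \<Rightarrow> ('m \<Rightarrow> 'm) \<Rightarrow> bool" where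
  "F_regular p R M \<kappa> \<longleftrightarrow> is_tau p R M \<kappa> \<one>\<^bsub>R\<^esub> 0 (carrier M)"


section \<open>Non-F-pure modules\<close>

definition sigma_algebra :: "nat \<Rightarrow> ('a, 'r) ring_scheme \<Rightarrow> 'a \<Rightarrow> rat \<Rightarrow> nat \<Rightarrow> 'a set" where
  "sigma_algebra p R f l e = PIdl\<^bsub>R\<^esub> (f [^]\<^bsub>R\<^esub> nat \<lceil>l * (of_nat (p ^ e) - 1)\<rceil>)"

definition is_sigma ::
  "nat \<Rightarrow> 'a ring \<Rightarrow> ('a, 'm) module \<Rightarrow> ('m \<Rightarrow> 'm) \<Rightarrow> 'a \<Rightarrow> rat \<Rightarrow> 'm set \<Rightarrow> bool" where
  "is_sigma p R M \<kappa> f l N \<longleftrightarrow>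
     (\<exists>h\<^sub>0. \<forall>h \<ge> h\<^sub>0. cplus_power (sigma_algebra p R f l) (cmodule_of M \<kappa>) h = N)"


section \<open>Consistency of the encoding\<close>

lemma nat_ceiling_superadd:
  fixes x y z :: rat
  assumes "0 \<le> x" "0 \<le> y" "z \<le> x * of_nat q + y"
  shows "nat \<lceil>z\<rceil> \<le> nat \<lceil>x\<rceil> * q + nat \<lceil>y\<rceil>"
proof -
  have "x \<le> of_nat (nat \<lceil>x\<rceil>)" "y \<le> of_nat (nat \<lceil>y\<rceil>)"
    using assms by (simp_all add: of_nat_ceiling)
  then have "x * of_nat q + y \<le> of_nat (nat \<lceil>x\<rceil>) * of_nat q + of_nat (nat \<lceil>y\<rceil>)"
    by (intro add_mono mult_right_mono) auto
  then have "z \<le> of_nat (nat \<lceil>x\<rceil> * q + nat \<lceil>y\<rceil>)"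
    using assms by simp
  then show ?thesis
    by (metis ceiling_mono ceiling_of_nat nat_int nat_mono)
qed

context cring begin

lemma PIdl_pow_mult:
  assumes f: "f \<in> carrier R" and b: "b \<in> PIdl (f [^] (i::nat))" and c: "c \<in> PIdl (f [^] (j::nat))"
    and k: "(k::nat) \<le> i * q + j"
  shows "(b [^] (q::nat)) \<otimes> c \<in> PIdl (f [^] k)"
proof -
  obtain r where r: "r \<in> carrier R" "b = r \<otimes> f [^] i"
    using b by (auto simp: cgenideal_def)
  obtain s where s: "s \<in> carrier R" "c = s \<otimes> f [^] j"
    using c by (auto simp: cgenideal_def)
  have "(b [^] q) \<otimes> c = ((r [^] q) \<otimes> f [^] (i * q)) \<otimes> (s \<otimes> f [^] j)"
    using r s f by (simp add: nat_pow_distrib nat_pow_pow)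
  also have "\<dots> = ((r [^] q) \<otimes> s) \<otimes> f [^] (i * q + j)"
    using r s f by (simp add: m_ac flip: nat_pow_mult)
  also have "f [^] (i * q + j) = f [^] (i * q + j - k) \<otimes> f [^] k"
    using f k by (simp add: nat_pow_mult)
  finally have "(b [^] q) \<otimes> c = (((r [^] q) \<otimes> s) \<otimes> f [^] (i * q + j - k)) \<otimes> f [^] k"
    using r s f by (simp add: m_assoc)
  then show ?thesis
    using r s f by (auto simp: cgenideal_def)
qed

lemma PIdl_pow_zero:
  assumes "f \<in> carrier R" shows "PIdl (f [^] (0::nat)) = carrier R"
  using assms by (force simp: cgenideal_def)

lemma cartier_algebra_sigma:
  assumes f: "f \<in> carrier R" and l: "0 \<le> l" and p: "0 < p"
  shows "cartier_algebra p R (sigma_algebra p R f l)"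
proof -
  have "additive_subgroup (sigma_algebra p R f l e) R" for e
    using f cgenideal_ideal ideal_def unfolding sigma_algebra_def by blast
  moreover have "(b [^] (p ^ e)) \<otimes> c \<in> sigma_algebra p R f l (d + e)"
    if "b \<in> sigma_algebra p R f l d" "c \<in> sigma_algebra p R f l e" for b c d e
    using f that unfolding sigma_algebra_def
  proof (rule PIdl_pow_mult)
    have ge: "l \<le> l * of_nat p ^ n" for n
      using mult_left_mono[of 1 "of_nat p ^ n" l] l p by (simp add: one_le_power)
    show "nat \<lceil>l * (of_nat (p ^ (d + e)) - 1)\<rceil>
      \<le> nat \<lceil>l * (of_nat (p ^ d) - 1)\<rceil> * p ^ e + nat \<lceil>l * (of_nat (p ^ e) - 1)\<rceil>"
      using l ge by (intro nat_ceiling_superadd) (auto simp: algebra_simps power_add)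
  qed
  ultimately show ?thesis
    using PIdl_pow_zero[OF f] by (simp add: cartier_algebra_def sigma_algebra_def)
qed

lemma cartier_algebra_tau:
  assumes f: "f \<in> carrier R" and l: "0 \<le> l" and p: "0 < p"
  shows "cartier_algebra p R (tau_algebra p R f l)"
proof -
  define i where "i e = (if e = 0 then 0 else nat \<lceil>l * of_nat (p ^ e)\<rceil>)" for e
  have tau: "tau_algebra p R f l e = PIdl (f [^] i e)" for e
    using PIdl_pow_zero[OF f] by (simp add: tau_algebra_def i_def)
  have "additive_subgroup (tau_algebra p R f l e) R" for e
    using f cgenideal_ideal ideal_def unfolding tau by blast
  moreover have "(b [^] (p ^ e)) \<otimes> c \<in> tau_algebra p R f l (d + e)"
    if "b \<in> tau_algebra p R f l d" "c \<in> tau_algebra p R f l e" for b c d e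
    using f that unfolding tau
  proof (rule PIdl_pow_mult)
    have "nat \<lceil>l * of_nat (p ^ (d + e))\<rceil> \<le> nat \<lceil>l * of_nat (p ^ d)\<rceil> * p ^ e + nat \<lceil>0 :: rat\<rceil>"
      using l by (intro nat_ceiling_superadd) (auto simp: power_add)
    then show "i (d + e) \<le> i d * p ^ e + i e"
      by (auto simp: i_def)
  qed
  ultimately show ?thesis
    by (simp add: cartier_algebra_def tau_algebra_def)
qed

end

text \<open>The action of the homogeneous elements is compatible with their multiplication.\<close>

lemma cact_cmodule_of_mult:
  assumes M: "cartier_module p R M \<kappa>" and b: "b \<in> carrier R" and c: "c \<in> carrier R"
    and x: "x \<in> carrier M"
  shows "cact (cmodule_of M \<kappa>) d b (cact (cmodule_of M \<kappa>) e c x) =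
    cact (cmodule_of M \<kappa>) (d + e) ((b [^]\<^bsub>R\<^esub> (p ^ e)) \<otimes>\<^bsub>R\<^esub> c) x"
proof -
  interpret module R M
    using M by (simp add: cartier_module_def)
  have \<kappa>: "\<kappa> y \<in> carrier M" "\<kappa> ((r [^]\<^bsub>R\<^esub> p) \<odot>\<^bsub>M\<^esub> y) = r \<odot>\<^bsub>M\<^esub> \<kappa> y"
    if "r \<in> carrier R" "y \<in> carrier M" for r y
    using M that by (auto simp: cartier_module_def linear_map_def frob_push_def)
  have iter: "(\<kappa> ^^ e) y \<in> carrier M \<and>
      (\<kappa> ^^ e) ((r [^]\<^bsub>R\<^esub> (p ^ e)) \<odot>\<^bsub>M\<^esub> y) = r \<odot>\<^bsub>M\<^esub> (\<kappa> ^^ e) y"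
    if "r \<in> carrier R" "y \<in> carrier M" for r y
    using that
  proof (induction e arbitrary: r)
    case (Suc e)
    then have "(r [^]\<^bsub>R\<^esub> (p ^ Suc e)) = (r [^]\<^bsub>R\<^esub> p) [^]\<^bsub>R\<^esub> (p ^ e)"
      by (simp add: R.nat_pow_pow)
    then show ?case
      using Suc \<kappa> by simp
  qed simp
  show ?thesis
    using iter[of b "c \<odot>\<^bsub>M\<^esub> x"] b c x
    by (simp add: cmodule_of_def module.defs smult_assoc1 funpow_add)
qed

end

theory Submission
  imports Defs
begin

text \<open>
  Write $F_{e,k} = \kappa^e(f^k M)$ and $k_e = \lceil \lambda p^e\rceil$. The theorem follows from an explicit
  description of the test module: there is a constant \<open>c\<close> such that, for all $\lambda \ge 0$,
  \[ \tau(M, f^\lambda) = \bigcup_e F_{e,\,k_e + c}, \]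
  where the union is increasing.

  To find \<open>c\<close>, one rewrites the nil-isomorphism condition at the associated primes of \<open>M\<close> in terms of elements
  (\<open>test_condition_iff\<close>). In this form it passes to $M_f$, and F-regularity of $M_f$ shows that
  every submodule which satisfies it, and which is stable under $\kappa f^j$ for some \<open>j\<close>, contains
  $f^a M$ for some \<open>a\<close> (\<open>generic_submodule_contains_power\<close>). Applied to \<open>\<kappa> M\<close> this yields
  $f^b M \subseteq \kappa M$, and then $f^c M \subseteq \kappa^i(f^{c+i} M)$ for \<open>c = 2 b + 1\<close> and all \<open>i\<close>
  (\<open>ex_test_exponent\<close>). Consequently $F_{e,k_e+c} \subseteq F_{e+n,k_{e+n}+c+n}$ (\<open>tpart_step\<close>): by
  going up in \<open>e\<close> one may insert arbitrarily many additional factors \<open>f\<close>. This makes the union increasing and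
  minimal (\<open>is_tau_test_module\<close>). It also gives right-continuity, since by the ascending chain condition
  the union is a single $F_{e,k_e+c}$, and one additional factor \<open>f\<close> absorbs a small increase of
  $\lambda$ (\<open>test_module_right_constant\<close>).

  It remains to show $\sigma(M, f^\lambda) = \tau(M, f^\lambda)$. The module on the right lies in every
  $\mathcal C_+^h M$ because one additional factor \<open>f\<close> makes up for the difference between
  the exponents $\lceil\lambda p^e\rceil$ and $\lceil\lambda(p^e-1)\rceil$ (\<open>test_module_subset_cplus_power\<close>).
  Conversely, if \<open>p\<close> divides the denominator \<open>D\<close> of $\lambda$, then $\lambda(p^e-1)$ is not an integer for
  $e \ge 1$, so that rounding up gains at least \<open>1/D\<close> (\<open>sigma_exponent_gain\<close>). A product of \<open>h\<close> factors gains at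
  least \<open>h/D\<close>; for large \<open>h\<close> this exceeds $\lambda + c + 1$, and
  $\mathcal C_+^h M$ is contained in $\tau(M, f^\lambda)$ (\<open>cplus_power_subset_test_module\<close>).
\<close>

section \<open>Localization of modules\<close>

lemma UN_pairs_const:
  assumes "X \<noteq> {}" "Y \<noteq> {}"
    and "\<And>m s n t. (m, s) \<in> X \<Longrightarrow> (n, t) \<in> Y \<Longrightarrow> F m s n t = c"
  shows "(\<Union>(m, s)\<in>X. \<Union>(n, t)\<in>Y. F m s n t) = c"
proof (rule SUP_eq_const[OF assms(1)])
  fix x assume "x \<in> X"
  then show "(case x of (m, s) \<Rightarrow> \<Union>(n, t)\<in>Y. F m s n t) = c"
    by (cases x) (auto intro!: SUP_eq_const[OF assms(2)] assms(3))
qed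

lemma abelian_group_cong:
  assumes "abelian_group G" "carrier H = carrier G" "add H = add G" "\<zero>\<^bsub>H\<^esub> = \<zero>\<^bsub>G\<^esub>"
  shows "abelian_group H"
proof -
  interpret G: abelian_group G by fact
  show ?thesis
  proof (rule abelian_groupI)
    fix x assume "x \<in> carrier H"
    then show "\<exists>y\<in>carrier H. y \<oplus>\<^bsub>H\<^esub> x = \<zero>\<^bsub>H\<^esub>"
      using assms by (auto intro!: bexI[of _ "\<ominus>\<^bsub>G\<^esub> x"] simp: G.l_neg)
  qed (use assms in \<open>auto simp: G.a_ac\<close>)
qed

locale localization = module R M
  for R :: "('a, 'r) ring_scheme" (structure) and M :: "('a, 'm, 'z) module_scheme" (structure) +
  fixes S :: "'a set"
  assumes submonoid_S: "submonoid S R"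
begin

abbreviation frac :: "'m \<Rightarrow> 'a \<Rightarrow> ('m \<times> 'a) set" where
  "frac \<equiv> loc_frac R S M"

lemma S_carrier: "s \<in> S \<Longrightarrow> s \<in> carrier R"
  using submonoid.subset[OF submonoid_S] by auto

lemma S_one [simp]: "\<one> \<in> S"
  using submonoid.one_closed[OF submonoid_S] .

lemma S_mult: "s \<in> S \<Longrightarrow> t \<in> S \<Longrightarrow> s \<otimes> t \<in> S"
  using submonoid.m_closed[OF submonoid_S] .

lemma S_pow: "s \<in> S \<Longrightarrow> s [^] (n::nat) \<in> S"
  by (induction n) (auto intro: S_mult)

text \<open>The localized ring carries the operations of the localization of \<open>R\<close> as a module over itself, so
  that facts on fractions of ring elements are instances of facts on fractions of module elements.\<close>

lemma module_self: "module R (self_module R)"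
proof (rule moduleI)
  show "abelian_group (self_module R)"
    by (rule abelian_group_cong[OF R.abelian_group_axioms]) (simp_all add: self_module_def)
qed (auto simp: self_module_def R.l_distr R.r_distr R.m_assoc R.is_cring)

lemma localization_self: "localization R (self_module R) S"
  using module_self submonoid_S by (simp add: localization_def localization_axioms_def)

lemma frac_eq_iff:
  assumes "m \<in> carrier M" "s \<in> S" "n \<in> carrier M" "t \<in> S"
  shows "frac m s = frac n t \<longleftrightarrow> (\<exists>u\<in>S. (u \<otimes> t) \<odot>\<^bsub>M\<^esub> m = (u \<otimes> s) \<odot>\<^bsub>M\<^esub> n)"
proof
  assume "frac m s = frac n t"
  moreover have "(n, t) \<in> frac n t"
    using assms by (auto simp: loc_frac_def)
  ultimately have "(n, t) \<in> frac m s"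
    by simp
  then show "\<exists>u\<in>S. (u \<otimes> t) \<odot>\<^bsub>M\<^esub> m = (u \<otimes> s) \<odot>\<^bsub>M\<^esub> n"
    by (auto simp: loc_frac_def)
next
  have trans: "\<exists>u\<in>S. (u \<otimes> s3) \<odot>\<^bsub>M\<^esub> m1 = (u \<otimes> s1) \<odot>\<^bsub>M\<^esub> m3"
    if rel: "\<exists>u\<in>S. (u \<otimes> s2) \<odot>\<^bsub>M\<^esub> m1 = (u \<otimes> s1) \<odot>\<^bsub>M\<^esub> m2" "\<exists>u\<in>S. (u \<otimes> s3) \<odot>\<^bsub>M\<^esub> m2 = (u \<otimes> s2) \<odot>\<^bsub>M\<^esub> m3"
       and c: "m1 \<in> carrier M" "m2 \<in> carrier M" "m3 \<in> carrier M" "s1 \<in> S" "s2 \<in> S" "s3 \<in> S"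
     for m1 m2 m3 s1 s2 s3
  proof -
    obtain u v where u: "u \<in> S" "(u \<otimes> s2) \<odot>\<^bsub>M\<^esub> m1 = (u \<otimes> s1) \<odot>\<^bsub>M\<^esub> m2"
      and v: "v \<in> S" "(v \<otimes> s3) \<odot>\<^bsub>M\<^esub> m2 = (v \<otimes> s2) \<odot>\<^bsub>M\<^esub> m3"
      using rel by blast
    note [simp] = c u(1) v(1) S_carrier
    have "((u \<otimes> v \<otimes> s2) \<otimes> s3) \<odot>\<^bsub>M\<^esub> m1 = (v \<otimes> s3) \<odot>\<^bsub>M\<^esub> ((u \<otimes> s2) \<odot>\<^bsub>M\<^esub> m1)"
      by (simp add: R.m_ac flip: smult_assoc1)
    also have "\<dots> = (u \<otimes> s1) \<odot>\<^bsub>M\<^esub> ((v \<otimes> s3) \<odot>\<^bsub>M\<^esub> m2)"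
      unfolding u(2) by (simp add: R.m_ac flip: smult_assoc1)
    also have "\<dots> = ((u \<otimes> v \<otimes> s2) \<otimes> s1) \<odot>\<^bsub>M\<^esub> m3"
      unfolding v(2) by (simp add: R.m_ac flip: smult_assoc1)
    finally show ?thesis
      by (intro bexI[of _ "u \<otimes> v \<otimes> s2"]) (simp_all add: S_mult)
  qed
  have sym: "(\<exists>u\<in>S. (u \<otimes> t) \<odot>\<^bsub>M\<^esub> m = (u \<otimes> s) \<odot>\<^bsub>M\<^esub> n) \<longleftrightarrow> (\<exists>u\<in>S. (u \<otimes> s) \<odot>\<^bsub>M\<^esub> n = (u \<otimes> t) \<odot>\<^bsub>M\<^esub> m)"
    for m s n t by metis
  assume eq: "\<exists>u\<in>S. (u \<otimes> t) \<odot>\<^bsub>M\<^esub> m = (u \<otimes> s) \<odot>\<^bsub>M\<^esub> n"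
  have "(\<exists>u\<in>S. (u \<otimes> s') \<odot>\<^bsub>M\<^esub> m = (u \<otimes> s) \<odot>\<^bsub>M\<^esub> m') \<longleftrightarrow> (\<exists>u\<in>S. (u \<otimes> s') \<odot>\<^bsub>M\<^esub> n = (u \<otimes> t) \<odot>\<^bsub>M\<^esub> m')"
    if "m' \<in> carrier M" "s' \<in> S" for m' s'
    using trans[OF eq[unfolded sym], of s' m'] trans[OF eq, of s' m'] that assms by blast
  then show "frac m s = frac n t"
    unfolding loc_frac_def by auto
qed

lemma frac_eqI:
  assumes "m \<in> carrier M" "s \<in> S" "n \<in> carrier M" "t \<in> S" "t \<odot>\<^bsub>M\<^esub> m = s \<odot>\<^bsub>M\<^esub> n"
  shows "frac m s = frac n t"
  using assms by (subst frac_eq_iff) (auto intro!: bexI[of _ \<one>] simp: S_carrier)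

lemma frac_cancel:
  assumes "m \<in> carrier M" "s \<in> S" "t \<in> S"
  shows "frac (t \<odot>\<^bsub>M\<^esub> m) (t \<otimes> s) = frac m s"
  using assms by (intro frac_eqI) (auto simp: S_mult S_carrier R.m_comm simp flip: smult_assoc1)

lemma frac_self:
  assumes "m \<in> carrier M" "s \<in> S"
  shows "(m, s) \<in> frac m s"
  using assms by (auto simp: loc_frac_def)

lemma frac_repD:
  assumes "(m', s') \<in> frac m s"
  shows "m' \<in> carrier M" "s' \<in> S" "\<exists>u\<in>S. (u \<otimes> s') \<odot>\<^bsub>M\<^esub> m = (u \<otimes> s) \<odot>\<^bsub>M\<^esub> m'"
  using assms by (auto simp: loc_frac_def)

lemma loc_add_frac:
  assumes [simp]: "m \<in> carrier M" "s \<in> S" "n \<in> carrier M" "t \<in> S"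
  shows "loc_add R S M (frac m s) (frac n t) = frac (t \<odot>\<^bsub>M\<^esub> m \<oplus>\<^bsub>M\<^esub> s \<odot>\<^bsub>M\<^esub> n) (s \<otimes> t)"
proof -
  note [simp] = S_carrier S_mult
  have wd: "frac (t' \<odot>\<^bsub>M\<^esub> m' \<oplus>\<^bsub>M\<^esub> s' \<odot>\<^bsub>M\<^esub> n') (s' \<otimes> t') = frac (t \<odot>\<^bsub>M\<^esub> m \<oplus>\<^bsub>M\<^esub> s \<odot>\<^bsub>M\<^esub> n) (s \<otimes> t)"
    if a: "(m', s') \<in> frac m s" "(n', t') \<in> frac n t" for m' s' n' t'
  proof -
    obtain u v where u: "u \<in> S" "(u \<otimes> s') \<odot>\<^bsub>M\<^esub> m = (u \<otimes> s) \<odot>\<^bsub>M\<^esub> m'"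
      and v: "v \<in> S" "(v \<otimes> t') \<odot>\<^bsub>M\<^esub> n = (v \<otimes> t) \<odot>\<^bsub>M\<^esub> n'"
      using frac_repD[OF a(1)] frac_repD[OF a(2)] by auto
    note [simp] = frac_repD(1,2)[OF a(1)] frac_repD(1,2)[OF a(2)] u(1) v(1)
    have "(u \<otimes> v \<otimes> (s' \<otimes> t')) \<odot>\<^bsub>M\<^esub> (t \<odot>\<^bsub>M\<^esub> m \<oplus>\<^bsub>M\<^esub> s \<odot>\<^bsub>M\<^esub> n)
       = (v \<otimes> t' \<otimes> t) \<odot>\<^bsub>M\<^esub> ((u \<otimes> s') \<odot>\<^bsub>M\<^esub> m) \<oplus>\<^bsub>M\<^esub> (u \<otimes> s' \<otimes> s) \<odot>\<^bsub>M\<^esub> ((v \<otimes> t') \<odot>\<^bsub>M\<^esub> n)"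
      by (simp add: R.m_ac smult_r_distr flip: smult_assoc1)
    also have "\<dots> = (u \<otimes> v \<otimes> (s \<otimes> t)) \<odot>\<^bsub>M\<^esub> (t' \<odot>\<^bsub>M\<^esub> m' \<oplus>\<^bsub>M\<^esub> s' \<odot>\<^bsub>M\<^esub> n')"
      unfolding u(2) v(2) by (simp add: R.m_ac smult_r_distr flip: smult_assoc1)
    finally show ?thesis
      by (subst frac_eq_iff) (auto intro!: bexI[of _ "u \<otimes> v"])
  qed
  show ?thesis
    unfolding loc_add_def
    by (rule UN_pairs_const[OF _ _ wd]) (use assms frac_self in blast)+
qed

lemma loc_smult_frac:
  assumes [simp]: "a \<in> carrier R" "s \<in> S" "m \<in> carrier M" "t \<in> S"
  shows "loc_smult R S M (loc_frac R S (self_module R) a s) (frac m t) = frac (a \<odot>\<^bsub>M\<^esub> m) (s \<otimes> t)"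
proof -
  note [simp] = S_carrier S_mult
  interpret A: localization R "self_module R" S
    by (rule localization_self)
  have [simp]: "carrier (self_module R) = carrier R" "smult (self_module R) = mult R"
    by (simp_all add: self_module_def)
  have wd: "frac (a' \<odot>\<^bsub>M\<^esub> m') (s' \<otimes> t') = frac (a \<odot>\<^bsub>M\<^esub> m) (s \<otimes> t)"
    if a: "(a', s') \<in> loc_frac R S (self_module R) a s" "(m', t') \<in> frac m t" for a' s' m' t'
  proof -
    obtain u v where u: "u \<in> S" "(u \<otimes> s') \<otimes> a = (u \<otimes> s) \<otimes> a'"
      and v: "v \<in> S" "(v \<otimes> t') \<odot>\<^bsub>M\<^esub> m = (v \<otimes> t) \<odot>\<^bsub>M\<^esub> m'"
      using A.frac_repD[OF a(1)] frac_repD[OF a(2)] by auto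
    have [simp]: "a' \<in> carrier R" "s' \<in> S" "m' \<in> carrier M" "t' \<in> S"
      using A.frac_repD(1,2)[OF a(1)] frac_repD(1,2)[OF a(2)] by auto
    note [simp] = u(1) v(1)
    have "(u \<otimes> v \<otimes> (s' \<otimes> t')) \<odot>\<^bsub>M\<^esub> (a \<odot>\<^bsub>M\<^esub> m) = ((u \<otimes> s') \<otimes> a) \<odot>\<^bsub>M\<^esub> ((v \<otimes> t') \<odot>\<^bsub>M\<^esub> m)"
      by (simp add: R.m_ac flip: smult_assoc1)
    also have "\<dots> = (u \<otimes> v \<otimes> (s \<otimes> t)) \<odot>\<^bsub>M\<^esub> (a' \<odot>\<^bsub>M\<^esub> m')"
      unfolding u(2) v(2) by (simp add: R.m_ac flip: smult_assoc1)
    finally show ?thesis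
      by (subst frac_eq_iff) (auto intro!: bexI[of _ "u \<otimes> v"])
  qed
  show ?thesis
    unfolding loc_smult_def
    by (rule UN_pairs_const[OF _ _ wd]) (use A.frac_self[of a s] frac_self[of m t] assms in auto)
qed

lemma loc_carrier: "carrier (loc_module R S M) = loc_subset R S M (carrier M)"
  and loc_zero: "\<zero>\<^bsub>loc_module R S M\<^esub> = frac \<zero>\<^bsub>M\<^esub> \<one>"
  by (simp_all add: loc_module_def)

lemma frac_zero: "s \<in> S \<Longrightarrow> frac \<zero>\<^bsub>M\<^esub> s = frac \<zero>\<^bsub>M\<^esub> \<one>"
  by (intro frac_eqI) (auto simp: S_carrier)

lemma loc_elemE:
  assumes "x \<in> carrier (loc_module R S M)"
  obtains m s where "m \<in> carrier M" "s \<in> S" "x = frac m s"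
  using assms by (auto simp: loc_carrier loc_subset_def)

lemma frac_in_loc [simp]: "m \<in> carrier M \<Longrightarrow> s \<in> S \<Longrightarrow> frac m s \<in> carrier (loc_module R S M)"
  by (auto simp: loc_carrier loc_subset_def)

text \<open>Fractions over a common denominator add like their numerators, so that the group laws are
  inherited once all elements involved share a denominator.\<close>

lemma loc_add_same:
  assumes "m \<in> carrier M" "n \<in> carrier M" "s \<in> S"
  shows "frac m s \<oplus>\<^bsub>loc_module R S M\<^esub> frac n s = frac (m \<oplus>\<^bsub>M\<^esub> n) s"
  using assms frac_cancel[of "m \<oplus>\<^bsub>M\<^esub> n" s s]
  by (simp add: loc_module_def loc_add_frac S_carrier smult_r_distr)

lemma common_denominator:
  assumes "x \<in> carrier (loc_module R S M)" "y \<in> carrier (loc_module R S M)"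
    "z \<in> carrier (loc_module R S M)"
  obtains m n k s where "m \<in> carrier M" "n \<in> carrier M" "k \<in> carrier M" "s \<in> S"
    "x = frac m s" "y = frac n s" "z = frac k s"
proof -
  obtain m s n t k r where c: "m \<in> carrier M" "s \<in> S" "x = frac m s"
    "n \<in> carrier M" "t \<in> S" "y = frac n t" "k \<in> carrier M" "r \<in> S" "z = frac k r"
    using assms by (metis loc_elemE)
  have "s \<otimes> t \<otimes> r = (t \<otimes> r) \<otimes> s" "s \<otimes> t \<otimes> r = (s \<otimes> r) \<otimes> t"
    using c by (simp_all add: S_carrier R.m_ac)
  then have "x = frac ((t \<otimes> r) \<odot>\<^bsub>M\<^esub> m) (s \<otimes> t \<otimes> r)" "y = frac ((s \<otimes> r) \<odot>\<^bsub>M\<^esub> n) (s \<otimes> t \<otimes> r)"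
    "z = frac ((s \<otimes> t) \<odot>\<^bsub>M\<^esub> k) (s \<otimes> t \<otimes> r)"
    using c frac_cancel S_mult by metis+
  then show ?thesis
    using c by (intro that[of "(t \<otimes> r) \<odot>\<^bsub>M\<^esub> m" "(s \<otimes> r) \<odot>\<^bsub>M\<^esub> n" "(s \<otimes> t) \<odot>\<^bsub>M\<^esub> k" "s \<otimes> t \<otimes> r"])
      (auto simp: S_carrier S_mult)
qed

lemma abelian_group_loc: "abelian_group (loc_module R S M)"
proof (rule abelian_groupI)
  fix x y z assume xyz: "x \<in> carrier (loc_module R S M)" "y \<in> carrier (loc_module R S M)"
    "z \<in> carrier (loc_module R S M)"
  obtain m n k s where c: "m \<in> carrier M" "n \<in> carrier M" "k \<in> carrier M" "s \<in> S"
    "x = frac m s" "y = frac n s" "z = frac k s"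
    using common_denominator[OF xyz] .
  then show "(x \<oplus>\<^bsub>loc_module R S M\<^esub> y) \<oplus>\<^bsub>loc_module R S M\<^esub> z
      = x \<oplus>\<^bsub>loc_module R S M\<^esub> (y \<oplus>\<^bsub>loc_module R S M\<^esub> z)"
    by (simp add: loc_add_same M.a_assoc)
next
  fix x y assume xy: "x \<in> carrier (loc_module R S M)" "y \<in> carrier (loc_module R S M)"
  obtain m n s where c: "m \<in> carrier M" "n \<in> carrier M" "s \<in> S" "x = frac m s" "y = frac n s"
    using common_denominator[OF xy xy(1)] by metis
  then show "x \<oplus>\<^bsub>loc_module R S M\<^esub> y \<in> carrier (loc_module R S M)"
    "x \<oplus>\<^bsub>loc_module R S M\<^esub> y = y \<oplus>\<^bsub>loc_module R S M\<^esub> x"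
    by (simp_all add: loc_add_same M.a_comm)
next
  show "\<zero>\<^bsub>loc_module R S M\<^esub> \<in> carrier (loc_module R S M)"
    by (simp add: loc_zero)
next
  fix x assume x: "x \<in> carrier (loc_module R S M)"
  then obtain m s where c: "m \<in> carrier M" "s \<in> S" "x = frac m s"
    by (rule loc_elemE)
  have "\<zero>\<^bsub>loc_module R S M\<^esub> = frac \<zero>\<^bsub>M\<^esub> s"
    by (simp only: loc_zero frac_zero[OF c(2)])
  then show "\<zero>\<^bsub>loc_module R S M\<^esub> \<oplus>\<^bsub>loc_module R S M\<^esub> x = x"
    using c by (simp add: loc_add_same)
  have "frac (\<ominus>\<^bsub>M\<^esub> m) s \<oplus>\<^bsub>loc_module R S M\<^esub> x = \<zero>\<^bsub>loc_module R S M\<^esub>"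
    using c \<open>_ = frac \<zero>\<^bsub>M\<^esub> s\<close> by (simp add: loc_add_same M.l_neg)
  then show "\<exists>y\<in>carrier (loc_module R S M). y \<oplus>\<^bsub>loc_module R S M\<^esub> x = \<zero>\<^bsub>loc_module R S M\<^esub>"
    using c frac_in_loc M.a_inv_closed by blast
qed

abbreviation rfrac :: "'a \<Rightarrow> 'a \<Rightarrow> ('a \<times> 'a) set" where
  "rfrac \<equiv> loc_frac R S (self_module R)"

lemma loc_ring_elemE:
  assumes "x \<in> carrier (loc_ring R S)"
  obtains a s where "a \<in> carrier R" "s \<in> S" "x = rfrac a s"
  using assms by (auto simp: loc_ring_def loc_subset_def)

lemma rfrac_in_loc [simp]: "a \<in> carrier R \<Longrightarrow> s \<in> S \<Longrightarrow> rfrac a s \<in> carrier (loc_ring R S)"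
  by (auto simp: loc_ring_def loc_subset_def)

lemma rfrac_mult:
  assumes "a \<in> carrier R" "s \<in> S" "b \<in> carrier R" "t \<in> S"
  shows "rfrac a s \<otimes>\<^bsub>loc_ring R S\<^esub> rfrac b t = rfrac (a \<otimes> b) (s \<otimes> t)"
proof -
  interpret A: localization R "self_module R" S
    by (rule localization_self)
  show ?thesis
    using A.loc_smult_frac[of a s b t] assms by (simp add: loc_ring_def self_module_def)
qed

lemma rfrac_eqI:
  assumes "a \<in> carrier R" "s \<in> S" "b \<in> carrier R" "t \<in> S" "t \<otimes> a = s \<otimes> b"
  shows "rfrac a s = rfrac b t"
  using localization.frac_eqI[OF localization_self, of a s b t] assms
  by (simp add: self_module_def)

lemma rfrac_add_same:
  assumes "a \<in> carrier R" "b \<in> carrier R" "s \<in> S"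
  shows "rfrac a s \<oplus>\<^bsub>loc_ring R S\<^esub> rfrac b s = rfrac (a \<oplus> b) s"
  using localization.loc_add_same[OF localization_self, of a b s] assms
  by (simp add: self_module_def loc_ring_def loc_module_def)

lemma rcommon_denominator:
  assumes "x \<in> carrier (loc_ring R S)" "y \<in> carrier (loc_ring R S)"
  obtains a b s where "a \<in> carrier R" "b \<in> carrier R" "s \<in> S" "x = rfrac a s" "y = rfrac b s"
proof -
  have "carrier (loc_ring R S) = carrier (loc_module R S (self_module R))"
    by (simp add: loc_ring_def loc_module_def self_module_def)
  then show ?thesis
    using localization.common_denominator[OF localization_self, of x y x] assms that
    by (metis (no_types, lifting) self_module_def partial_object.select_convs(1))
qed

lemma rfrac_one: "\<one>\<^bsub>loc_ring R S\<^esub> = rfrac \<one> \<one>"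
  by (simp add: loc_ring_def)

lemma cring_loc_ring: "cring (loc_ring R S)"
proof (rule cringI)
  show "abelian_group (loc_ring R S)"
    by (rule abelian_group_cong[OF localization.abelian_group_loc[OF localization_self]])
      (simp_all add: loc_ring_def loc_module_def self_module_def)
next
  note [simp] = S_carrier S_mult
  show "comm_monoid (loc_ring R S)"
  proof (rule comm_monoidI)
    fix x y z assume "x \<in> carrier (loc_ring R S)" "y \<in> carrier (loc_ring R S)"
      "z \<in> carrier (loc_ring R S)"
    then show "x \<otimes>\<^bsub>loc_ring R S\<^esub> y \<otimes>\<^bsub>loc_ring R S\<^esub> z = x \<otimes>\<^bsub>loc_ring R S\<^esub> (y \<otimes>\<^bsub>loc_ring R S\<^esub> z)"
      by (elim loc_ring_elemE) (simp add: rfrac_mult R.m_assoc)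
  next
    fix x y assume xy: "x \<in> carrier (loc_ring R S)" "y \<in> carrier (loc_ring R S)"
    then show "x \<otimes>\<^bsub>loc_ring R S\<^esub> y \<in> carrier (loc_ring R S)"
      by (elim loc_ring_elemE) (simp add: rfrac_mult)
    show "x \<otimes>\<^bsub>loc_ring R S\<^esub> y = y \<otimes>\<^bsub>loc_ring R S\<^esub> x"
      using xy by (elim loc_ring_elemE) (simp add: rfrac_mult R.m_comm)
  next
    fix x assume "x \<in> carrier (loc_ring R S)"
    then show "\<one>\<^bsub>loc_ring R S\<^esub> \<otimes>\<^bsub>loc_ring R S\<^esub> x = x"
      by (elim loc_ring_elemE) (simp add: rfrac_mult rfrac_one)
  qed (simp add: rfrac_one)
  fix x y z assume xyz: "x \<in> carrier (loc_ring R S)" "y \<in> carrier (loc_ring R S)"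
    "z \<in> carrier (loc_ring R S)"
  obtain a b s where "a \<in> carrier R" "b \<in> carrier R" "s \<in> S" "x = rfrac a s" "y = rfrac b s"
    using rcommon_denominator[OF xyz(1,2)] .
  moreover obtain c t where "c \<in> carrier R" "t \<in> S" "z = rfrac c t"
    using xyz(3) by (rule loc_ring_elemE)
  ultimately show "(x \<oplus>\<^bsub>loc_ring R S\<^esub> y) \<otimes>\<^bsub>loc_ring R S\<^esub> z
      = x \<otimes>\<^bsub>loc_ring R S\<^esub> z \<oplus>\<^bsub>loc_ring R S\<^esub> y \<otimes>\<^bsub>loc_ring R S\<^esub> z"
    by (simp add: rfrac_mult rfrac_add_same R.l_distr)
qed

lemma smult_frac:
  assumes "a \<in> carrier R" "s \<in> S" "m \<in> carrier M" "t \<in> S"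
  shows "rfrac a s \<odot>\<^bsub>loc_module R S M\<^esub> frac m t = frac (a \<odot>\<^bsub>M\<^esub> m) (s \<otimes> t)"
  using loc_smult_frac[OF assms] by (simp add: loc_module_def)

lemma module_loc: "module (loc_ring R S) (loc_module R S M)"
proof (rule moduleI[OF cring_loc_ring abelian_group_loc])
  note [simp] = S_carrier S_mult
  fix a b x y
  assume ab: "a \<in> carrier (loc_ring R S)" "b \<in> carrier (loc_ring R S)"
    and xy: "x \<in> carrier (loc_module R S M)" "y \<in> carrier (loc_module R S M)"
  show "a \<odot>\<^bsub>loc_module R S M\<^esub> x \<in> carrier (loc_module R S M)"
    using ab xy by (elim loc_ring_elemE loc_elemE) (simp add: smult_frac)
  show "(a \<otimes>\<^bsub>loc_ring R S\<^esub> b) \<odot>\<^bsub>loc_module R S M\<^esub> x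
      = a \<odot>\<^bsub>loc_module R S M\<^esub> (b \<odot>\<^bsub>loc_module R S M\<^esub> x)"
    using ab xy by (elim loc_ring_elemE loc_elemE)
      (simp add: smult_frac rfrac_mult smult_assoc1 R.m_assoc)
  obtain c d s where "c \<in> carrier R" "d \<in> carrier R" "s \<in> S" "a = rfrac c s" "b = rfrac d s"
    using rcommon_denominator[OF ab] .
  moreover obtain m n t where "m \<in> carrier M" "n \<in> carrier M" "t \<in> S" "x = frac m t" "y = frac n t"
    using common_denominator[OF xy xy(1)] by metis
  ultimately show "(a \<oplus>\<^bsub>loc_ring R S\<^esub> b) \<odot>\<^bsub>loc_module R S M\<^esub> x
      = a \<odot>\<^bsub>loc_module R S M\<^esub> x \<oplus>\<^bsub>loc_module R S M\<^esub> b \<odot>\<^bsub>loc_module R S M\<^esub> x"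
    and "a \<odot>\<^bsub>loc_module R S M\<^esub> (x \<oplus>\<^bsub>loc_module R S M\<^esub> y)
      = a \<odot>\<^bsub>loc_module R S M\<^esub> x \<oplus>\<^bsub>loc_module R S M\<^esub> a \<odot>\<^bsub>loc_module R S M\<^esub> y"
    by (simp_all add: smult_frac loc_add_same rfrac_add_same smult_l_distr smult_r_distr)
next
  fix x assume "x \<in> carrier (loc_module R S M)"
  then show "\<one>\<^bsub>loc_ring R S\<^esub> \<odot>\<^bsub>loc_module R S M\<^esub> x = x"
    by (elim loc_elemE) (simp add: smult_frac rfrac_one S_carrier)
qed

text \<open>Whether a fraction lies in the localization of a submodule can be read off from any one of its
  representatives. This is how conditions on localized modules become conditions on \<open>M\<close>.\<close>

lemma frac_in_loc_subset_iff:
  assumes N: "submodule N R M" and m: "m \<in> carrier M" and s: "s \<in> S"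
  shows "frac m s \<in> loc_subset R S M N \<longleftrightarrow> (\<exists>t\<in>S. t \<odot>\<^bsub>M\<^esub> m \<in> N)"
proof
  assume "frac m s \<in> loc_subset R S M N"
  then obtain n t where n: "n \<in> N" "t \<in> S" "frac m s = frac n t"
    by (auto simp: loc_subset_def)
  then obtain u where u: "u \<in> S" "(u \<otimes> t) \<odot>\<^bsub>M\<^esub> m = (u \<otimes> s) \<odot>\<^bsub>M\<^esub> n"
    using m s submoduleE(1)[OF N] by (subst (asm) frac_eq_iff) auto
  then show "\<exists>t\<in>S. t \<odot>\<^bsub>M\<^esub> m \<in> N"
    using n s submoduleE(4)[OF N, of "u \<otimes> s" n] by (metis R.m_closed S_carrier S_mult)
next
  assume "\<exists>t\<in>S. t \<odot>\<^bsub>M\<^esub> m \<in> N"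
  then obtain t where t: "t \<in> S" "t \<odot>\<^bsub>M\<^esub> m \<in> N"
    by auto
  moreover have "frac m s = frac (t \<odot>\<^bsub>M\<^esub> m) (t \<otimes> s)"
    using frac_cancel m s t by simp
  ultimately show "frac m s \<in> loc_subset R S M N"
    unfolding loc_subset_def using s S_mult by blast
qed

lemma submodule_loc_subset:
  assumes N: "submodule N R M"
  shows "submodule (loc_subset R S M N) (loc_ring R S) (loc_module R S M)"
proof -
  note [simp] = S_carrier S_mult
  note Nc = submoduleE[OF N]
  have NM [simp]: "n \<in> carrier M" if "n \<in> N" for n
    using Nc(1) that by auto
  interpret L: module "loc_ring R S" "loc_module R S M"
    by (rule module_loc)
  have "\<zero>\<^bsub>M\<^esub> \<in> N"
    using Nc(2,4) by (metis NM R.zero_closed ex_in_conv smult_l_null)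
  show ?thesis
  proof (rule L.submoduleI)
    show "loc_subset R S M N \<subseteq> carrier (loc_module R S M)"
      using Nc(1) by (auto simp: loc_carrier loc_subset_def)
    show "\<zero>\<^bsub>loc_module R S M\<^esub> \<in> loc_subset R S M N"
      using \<open>\<zero>\<^bsub>M\<^esub> \<in> N\<close> S_one unfolding loc_zero loc_subset_def by blast
    show sm: "a \<odot>\<^bsub>loc_module R S M\<^esub> x \<in> loc_subset R S M N"
      if "a \<in> carrier (loc_ring R S)" "x \<in> loc_subset R S M N" for a x
      using that Nc(4) by (elim loc_ring_elemE) (force simp: loc_subset_def smult_frac)
    show "\<ominus>\<^bsub>loc_module R S M\<^esub> x \<in> loc_subset R S M N" if "x \<in> loc_subset R S M N" for x
      using sm[of "\<ominus>\<^bsub>loc_ring R S\<^esub> \<one>\<^bsub>loc_ring R S\<^esub>" x] that \<open>loc_subset R S M N \<subseteq> _\<close>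
      by (auto simp: L.smult_l_minus subset_iff)
    show "x \<oplus>\<^bsub>loc_module R S M\<^esub> y \<in> loc_subset R S M N"
      if xy: "x \<in> loc_subset R S M N" "y \<in> loc_subset R S M N" for x y
    proof -
      obtain m s n t where c: "m \<in> N" "s \<in> S" "x = frac m s" "n \<in> N" "t \<in> S" "y = frac n t"
        using xy by (auto simp: loc_subset_def)
      have "x \<oplus>\<^bsub>loc_module R S M\<^esub> y = frac (t \<odot>\<^bsub>M\<^esub> m \<oplus>\<^bsub>M\<^esub> s \<odot>\<^bsub>M\<^esub> n) (s \<otimes> t)"
        using c by (simp add: loc_module_def loc_add_frac)
      then show ?thesis
        unfolding loc_subset_def using c Nc(4,5) by (auto intro!: exI)
    qed
  qed
qed

end

section \<open>Frobenius-linear maps and nil-isomorphisms\<close>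

lemma (in module) submodule_zero: "submodule N R M \<Longrightarrow> \<zero>\<^bsub>M\<^esub> \<in> N"
  using submoduleE(2,4)[of N] submoduleE(1)[of N] by (metis R.zero_closed ex_in_conv smult_l_null subsetD)

text \<open>Closure under negation follows from closure under multiplication with \<open>- 1\<close>.\<close>

lemma (in module) submoduleI':
  assumes "H \<subseteq> carrier M" "\<zero>\<^bsub>M\<^esub> \<in> H"
    and "\<And>a b. a \<in> H \<Longrightarrow> b \<in> H \<Longrightarrow> a \<oplus>\<^bsub>M\<^esub> b \<in> H"
    and smult: "\<And>a x. a \<in> carrier R \<Longrightarrow> x \<in> H \<Longrightarrow> a \<odot>\<^bsub>M\<^esub> x \<in> H"
  shows "submodule H R M"
proof (rule submoduleI)
  fix x assume x: "x \<in> H"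
  have "\<ominus>\<^bsub>M\<^esub> x = (\<ominus> \<one>) \<odot>\<^bsub>M\<^esub> x"
    using x assms(1) by (subst smult_l_minus) auto
  then show "\<ominus>\<^bsub>M\<^esub> x \<in> H"
    using smult[of "\<ominus> \<one>" x] x by simp
qed (use assms in auto)

text \<open>A Cartier module without a finiteness condition. Every module below that carries a structure map is
  of this kind, in particular each localization over the localized ring.\<close>

locale cartier_map = module R M
  for R :: "'a ring" (structure) and M :: "('a, 'm) module" (structure) +
  fixes p :: nat and \<kappa> :: "'m \<Rightarrow> 'm"
  assumes p_gt_1: "1 < p"
    and kappa_closed: "m \<in> carrier M \<Longrightarrow> \<kappa> m \<in> carrier M"
    and kappa_add: "m \<in> carrier M \<Longrightarrow> n \<in> carrier M \<Longrightarrow> \<kappa> (m \<oplus>\<^bsub>M\<^esub> n) = \<kappa> m \<oplus>\<^bsub>M\<^esub> \<kappa> n"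
    and kappa_smult: "r \<in> carrier R \<Longrightarrow> m \<in> carrier M \<Longrightarrow> \<kappa> ((r [^] p) \<odot>\<^bsub>M\<^esub> m) = r \<odot>\<^bsub>M\<^esub> \<kappa> m"
begin

lemma kpow_closed [simp]: "m \<in> carrier M \<Longrightarrow> (\<kappa> ^^ e) m \<in> carrier M"
  by (induction e) (auto intro: kappa_closed)

lemma kpow_add:
  "m \<in> carrier M \<Longrightarrow> n \<in> carrier M \<Longrightarrow> (\<kappa> ^^ e) (m \<oplus>\<^bsub>M\<^esub> n) = (\<kappa> ^^ e) m \<oplus>\<^bsub>M\<^esub> (\<kappa> ^^ e) n"
  by (induction e) (auto simp: kappa_add)

lemma kpow_smult:
  "r \<in> carrier R \<Longrightarrow> m \<in> carrier M \<Longrightarrow> (\<kappa> ^^ e) ((r [^] (p ^ e)) \<odot>\<^bsub>M\<^esub> m) = r \<odot>\<^bsub>M\<^esub> (\<kappa> ^^ e) m"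
proof (induction e arbitrary: r)
  case (Suc e)
  then have "r [^] (p ^ Suc e) = (r [^] p) [^] (p ^ e)"
    by (simp add: R.nat_pow_pow)
  then show ?case
    using Suc by (simp add: kappa_smult)
qed simp

lemma kpow_zero [simp]: "(\<kappa> ^^ e) \<zero>\<^bsub>M\<^esub> = \<zero>\<^bsub>M\<^esub>"
  using kpow_smult[of \<zero> "\<zero>\<^bsub>M\<^esub>" e] by simp

lemma submodule_kpow_image:
  assumes "submodule B R M"
  shows "submodule ((\<kappa> ^^ e) ` B) R M"
proof (rule submoduleI')
  note Bc = submoduleE[OF assms]
  show "(\<kappa> ^^ e) ` B \<subseteq> carrier M"
    using Bc(1) by auto
  show "\<zero>\<^bsub>M\<^esub> \<in> (\<kappa> ^^ e) ` B"
    using submodule_zero[OF assms] by (metis imageI kpow_zero)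
  show "x \<oplus>\<^bsub>M\<^esub> y \<in> (\<kappa> ^^ e) ` B" if "x \<in> (\<kappa> ^^ e) ` B" "y \<in> (\<kappa> ^^ e) ` B" for x y
    using that Bc(1,5) kpow_add by (smt (verit) image_iff subsetD)
  show "a \<odot>\<^bsub>M\<^esub> x \<in> (\<kappa> ^^ e) ` B" if "a \<in> carrier R" "x \<in> (\<kappa> ^^ e) ` B" for a x
    using that Bc(1,4) kpow_smult by (smt (verit) R.nat_pow_closed image_iff subsetD)
qed

lemma kappa_stable_kpow:
  assumes "\<And>x. x \<in> B \<Longrightarrow> \<kappa> x \<in> B" "x \<in> B"
  shows "(\<kappa> ^^ e) x \<in> B"
  using assms(2) by (induction e) (auto intro: assms(1))

text \<open>A submodule \<open>B\<close> of \<open>M\<close>, considered as a module over a Cartier algebra.\<close>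

abbreviation csub :: "'m set \<Rightarrow> ('a, 'm) cmodule" where
  "csub B \<equiv> (cmodule_of M \<kappa>)\<lparr>carrier := B\<rparr>"

lemma csub_simps [simp]:
  "carrier (cmodule_of M \<kappa>) = carrier M" "add (cmodule_of M \<kappa>) = add M"
  "\<zero>\<^bsub>cmodule_of M \<kappa>\<^esub> = \<zero>\<^bsub>M\<^esub>" "smult (cmodule_of M \<kappa>) = smult M"
  "cact (cmodule_of M \<kappa>) e c x = (\<kappa> ^^ e) (c \<odot>\<^bsub>M\<^esub> x)"
  by (simp_all add: cmodule_of_def module.defs)

lemma csub_carrier: "csub (carrier M) = cmodule_of M \<kappa>"
  by (simp add: cmodule_of_def module.defs)

lemma abelian_group_csub:
  assumes "submodule B R M"
  shows "abelian_group (csub B)"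
proof -
  have "module R (M\<lparr>carrier := B\<rparr>)"
    using submodule.submodule_is_module[OF assms] module_axioms by blast
  then have "abelian_group (M\<lparr>carrier := B\<rparr>)"
    by (simp add: module_def)
  then show ?thesis
    by (rule abelian_group_cong) auto
qed

lemma subgroup_csub:
  assumes B: "submodule B R M" and W: "submodule W R M" and WB: "W \<subseteq> B"
  shows "subgroup W (add_monoid (csub B))"
proof -
  interpret G: abelian_group "csub B"
    by (rule abelian_group_csub[OF B])
  note Wc = submoduleE[OF W]
  show ?thesis
  proof (rule G.add.subgroupI)
    fix x assume x: "x \<in> W"
    have "\<ominus>\<^bsub>csub B\<^esub> x = \<ominus>\<^bsub>M\<^esub> x"
      using x WB Wc(1,3) by (intro G.minus_equality) (auto simp: M.l_neg)
    then show "\<ominus>\<^bsub>csub B\<^esub> x \<in> W"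
      using Wc(3)[OF x] by simp
  qed (use WB Wc(2,5) in auto)
qed

lemma cplus_mult_subset:
  assumes B: "submodule B R M" and W: "submodule W R M" and WB: "W \<subseteq> B"
    and "\<And>e c x. 1 \<le> e \<Longrightarrow> c \<in> C e \<Longrightarrow> x \<in> V \<Longrightarrow> (\<kappa> ^^ e) (c \<odot>\<^bsub>M\<^esub> x) \<in> W"
  shows "cplus_mult C (csub B) V \<subseteq> W"
proof -
  interpret G: abelian_group "csub B"
    by (rule abelian_group_csub[OF B])
  show ?thesis
    unfolding cplus_mult_def
    by (rule G.add.generate_subgroup_incl[OF _ subgroup_csub[OF B W WB]]) (use assms(4) in auto)
qed

lemma cplus_multI:
  assumes "1 \<le> e" "c \<in> C e" "x \<in> V"
  shows "(\<kappa> ^^ e) (c \<odot>\<^bsub>M\<^esub> x) \<in> cplus_mult C (csub B) V"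
  unfolding cplus_mult_def using assms by (intro generate.incl) auto

lemma cplus_power_Suc: "cplus_power C N (Suc h) = cplus_mult C N (cplus_power C N h)"
  by (simp add: cplus_power_def)

lemma cplus_power_zero: "cplus_power C (csub B) 0 = B"
  by (simp add: cplus_power_def)

lemma zero_in_cplus_power:
  assumes "submodule B R M"
  shows "\<zero>\<^bsub>M\<^esub> \<in> cplus_power C (csub B) h"
proof (cases h)
  case 0
  then show ?thesis
    using submodule_zero[OF assms] by (simp add: cplus_power_def)
next
  case (Suc k)
  then show ?thesis
    using generate.one[of "add_monoid (csub B)"] by (simp add: cplus_power_Suc cplus_mult_def)
qed

text \<open>As $\kappa^e c\,\kappa^h = \kappa^{h+1} \kappa^{e-1} c^{p^h}$ for $e \ge 1$, each factor from
  $\mathcal C_+$ contributes one more application of \<open>\<kappa>\<close> on the outside. If moreover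
  $\mathcal C_1$ contains the unit element, then both inclusions below give
  $\mathcal C_+^h B = \kappa^h B$.\<close>

lemma cplus_power_subset_kpow:
  assumes B: "submodule B R M" and stable: "\<And>x. x \<in> B \<Longrightarrow> \<kappa> x \<in> B" and C: "\<And>e. C e \<subseteq> carrier R"
  shows "cplus_power C (csub B) h \<subseteq> (\<kappa> ^^ h) ` B"
proof (induction h)
  case (Suc h)
  note Bc = submoduleE[OF B]
  have st: "(\<kappa> ^^ e) x \<in> B" if "x \<in> B" for e x
    using kappa_stable_kpow[of B] stable that by blast
  show ?case
    unfolding cplus_power_Suc
  proof (rule cplus_mult_subset[OF B submodule_kpow_image[OF B]])
    show "(\<kappa> ^^ Suc h) ` B \<subseteq> B"
      using st by blast
    fix e :: nat and c x assume e: "1 \<le> e" and c: "c \<in> C e" and "x \<in> cplus_power C (csub B) h"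
    then obtain b where b: "b \<in> B" "x = (\<kappa> ^^ h) b"
      using Suc by auto
    define y where "y = (c [^] (p ^ h)) \<odot>\<^bsub>M\<^esub> b"
    have y: "y \<in> B"
      using b c C Bc(4) unfolding y_def by blast
    have "c \<odot>\<^bsub>M\<^esub> x = (\<kappa> ^^ h) y"
      using b c C Bc(1) by (auto simp: y_def kpow_smult subset_iff)
    then have "(\<kappa> ^^ e) (c \<odot>\<^bsub>M\<^esub> x) = (\<kappa> ^^ (e + h)) y"
      by (simp add: funpow_add)
    also have "e + h = Suc h + (e - 1)"
      using e by simp
    also have "(\<kappa> ^^ (Suc h + (e - 1))) y = (\<kappa> ^^ Suc h) ((\<kappa> ^^ (e - 1)) y)"
      by (simp only: funpow_add comp_apply)
    finally show "(\<kappa> ^^ e) (c \<odot>\<^bsub>M\<^esub> x) \<in> (\<kappa> ^^ Suc h) ` B"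
      using st[OF y] by blast
  qed
qed (simp add: cplus_power_def)

lemma kpow_subset_cplus_power:
  assumes B: "submodule B R M" and C: "\<one> \<in> C 1"
  shows "(\<kappa> ^^ h) ` B \<subseteq> cplus_power C (csub B) h"
proof (induction h)
  case (Suc h)
  have "\<kappa> x \<in> cplus_power C (csub B) (Suc h)" if "x \<in> (\<kappa> ^^ h) ` B" for x
    using cplus_multI[of 1 \<one> C x "cplus_power C (csub B) h" B] that Suc C
      submoduleE(1)[OF submodule_kpow_image[OF B, of h]]
    by (auto simp: cplus_power_Suc subset_iff)
  then show ?case
    by auto
qed (simp add: cplus_power_def)

lemma cplus_power_subset:
  assumes B: "submodule B R M" and "\<And>e c x. c \<in> C e \<Longrightarrow> x \<in> B \<Longrightarrow> (\<kappa> ^^ e) (c \<odot>\<^bsub>M\<^esub> x) \<in> B"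
  shows "cplus_power C (csub B) h \<subseteq> B"
proof (induction h)
  case (Suc h)
  then show ?case
    unfolding cplus_power_Suc using assms by (intro cplus_mult_subset) auto
qed (simp add: cplus_power_def)

text \<open>The projection \<open>B \<rightarrow> B/A\<close> is a group homomorphism that commutes with the homogeneous elements of
  the algebra, and forming generated subgroups commutes with homomorphisms. The inverses in the group
  generated on the left are those of the quotient, so it has to be known that this is a group.\<close>

lemma cplus_power_quot:
  assumes A: "submodule A R M" and B: "submodule B R M" and AB: "A \<subseteq> B"
    and CA: "\<And>e c x. c \<in> C e \<Longrightarrow> x \<in> A \<Longrightarrow> (\<kappa> ^^ e) (c \<odot>\<^bsub>M\<^esub> x) \<in> A"
    and CB: "\<And>e c x. c \<in> C e \<Longrightarrow> x \<in> B \<Longrightarrow> (\<kappa> ^^ e) (c \<odot>\<^bsub>M\<^esub> x) \<in> B"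
    and C: "\<And>e. C e \<subseteq> carrier R"
  shows "cplus_power C (quot_cmodule (csub B) A) h = (\<lambda>x. A +>\<^bsub>M\<^esub> x) ` cplus_power C (csub B) h"
proof -
  define Q where "Q = quot_cmodule (csub B) A"
  define \<pi> where "\<pi> = (\<lambda>x. A +>\<^bsub>M\<^esub> x)"
  note Ac = submoduleE[OF A] and Bc = submoduleE[OF B]
  interpret sA: abelian_subgroup A M
  proof (rule abelian_subgroupI3)
    show "additive_subgroup A M"
      using A by (simp add: additive_subgroup_def submodule_def)
  qed (rule M.abelian_group_axioms)
  interpret G: abelian_group "csub B"
    by (rule abelian_group_csub[OF B])
  have coset: "A +>\<^bsub>csub B\<^esub> x = \<pi> x" for x
    by (simp add: \<pi>_def a_r_coset_def r_coset_def)
  have Q_simps: "carrier Q = \<pi> ` B" "add Q = set_add M" "\<zero>\<^bsub>Q\<^esub> = A"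
    "cact Q e c X = (\<Union>x\<in>X. \<pi> ((\<kappa> ^^ e) (c \<odot>\<^bsub>M\<^esub> x)))" for e c X
    by (auto simp: Q_def quot_cmodule_def coset A_RCOSETS_def RCOSETS_def a_r_coset_def r_coset_def
        set_add_def set_mult_def \<pi>_def fun_eq_iff)
  have pi_add: "\<pi> (x \<oplus>\<^bsub>M\<^esub> y) = \<pi> x <+>\<^bsub>M\<^esub> \<pi> y" if "x \<in> B" "y \<in> B" for x y
    using sA.a_rcos_sum[of x y] that Bc(1) by (auto simp: \<pi>_def)
  have pi_A: "\<pi> x = A" if "x \<in> A" for x
    using that Ac(1) M.a_coset_join2[of x A] sA.a_subgroup by (auto simp: \<pi>_def)
  have hom: "\<pi> \<in> hom (add_monoid (csub B)) (add_monoid Q)"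
    by (auto simp: hom_def Q_simps pi_add)
  have "group (add_monoid Q\<lparr>carrier := \<pi> ` carrier (add_monoid (csub B)),
      one := \<pi> \<one>\<^bsub>add_monoid (csub B)\<^esub>\<rparr>)"
    by (rule group.hom_imp_img_group[OF G.a_group hom])
  then have "group (add_monoid Q)"
    using pi_A[OF submodule_zero[OF A]] by (simp add: Q_simps)
  then interpret hom: group_hom "add_monoid (csub B)" "add_monoid Q" \<pi>
    using hom G.a_group by (simp only: group_hom_def group_hom_axioms_def)
  have cact: "cact Q e c (\<pi> x) = \<pi> ((\<kappa> ^^ e) (c \<odot>\<^bsub>M\<^esub> x))" if x: "x \<in> B" and c: "c \<in> C e" for e c x
  proof -
    have xM: "x \<in> carrier M" and cR: "c \<in> carrier R"
      using x Bc(1) c C by auto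
    have "\<pi> ((\<kappa> ^^ e) (c \<odot>\<^bsub>M\<^esub> y)) = \<pi> ((\<kappa> ^^ e) (c \<odot>\<^bsub>M\<^esub> x))" if y: "y \<in> \<pi> x" for y
    proof -
      obtain a where a: "a \<in> A" "y = a \<oplus>\<^bsub>M\<^esub> x"
        using y by (auto simp: \<pi>_def a_r_coset_def r_coset_def)
      have aM: "a \<in> carrier M"
        using a Ac(1) by auto
      have "(\<kappa> ^^ e) (c \<odot>\<^bsub>M\<^esub> y) = (\<kappa> ^^ e) (c \<odot>\<^bsub>M\<^esub> a) \<oplus>\<^bsub>M\<^esub> (\<kappa> ^^ e) (c \<odot>\<^bsub>M\<^esub> x)"
        using a xM cR aM by (simp add: smult_r_distr kpow_add)
      moreover have "(\<kappa> ^^ e) (c \<odot>\<^bsub>M\<^esub> a) \<in> A"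
        using CA c a by blast
      moreover have "A <+>\<^bsub>M\<^esub> \<pi> z = \<pi> z" if "z \<in> B" for z
        using pi_add[of "\<zero>\<^bsub>M\<^esub>" z] pi_A[OF submodule_zero[OF A]] submodule_zero[OF B] that Bc(1)
        by (simp add: subset_iff)
      ultimately show ?thesis
        using pi_add AB pi_A CB[OF c x] by auto
    qed
    moreover have "\<pi> x \<noteq> {}"
      using Ac(2) by (auto simp: \<pi>_def a_r_coset_def r_coset_def)
    ultimately show ?thesis
      unfolding Q_simps by (intro SUP_eq_const) auto
  qed
  have "cplus_power C Q h = \<pi> ` cplus_power C (csub B) h"
  proof (induction h)
    case 0
    then show ?case
      by (simp add: cplus_power_def Q_simps)
  next
    case (Suc h)
    let ?V = "cplus_power C (csub B) h"
    let ?K = "{cact (csub B) e c x | e c x. 1 \<le> e \<and> c \<in> C e \<and> x \<in> ?V}"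
    have V: "?V \<subseteq> B"
      by (rule cplus_power_subset[OF B CB])
    then have "?K \<subseteq> carrier (add_monoid (csub B))"
      using CB by auto
    then have "generate (add_monoid Q) (\<pi> ` ?K) = \<pi> ` generate (add_monoid (csub B)) ?K"
      by (rule hom.generate_img)
    moreover have "{cact Q e c X | e c X. 1 \<le> e \<and> c \<in> C e \<and> X \<in> \<pi> ` ?V} = \<pi> ` ?K"
      using cact V by (auto simp: image_iff) (metis subsetD)+
    ultimately show ?case
      unfolding cplus_power_Suc Suc.IH cplus_mult_def by simp
  qed
  then show ?thesis
    by (simp add: Q_def \<pi>_def)
qed

text \<open>For an algebra with \<open>\<one> \<in> C 1\<close>, nilpotence is nilpotence of \<open>\<kappa>\<close>. The kernel of an inclusion is zero,
  and $\mathcal C_+^h$ kills the cokernel iff $\mathcal C_+^h B = \kappa^h B$ lies in \<open>A\<close>.\<close>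

lemma nil_isomorphism_iff:
  assumes A: "submodule A R M" and B: "submodule B R M" and AB: "A \<subseteq> B"
    and kA: "\<And>x. x \<in> A \<Longrightarrow> \<kappa> x \<in> A" and kB: "\<And>x. x \<in> B \<Longrightarrow> \<kappa> x \<in> B"
    and C: "\<And>e. C e \<subseteq> carrier R" and C1: "\<one> \<in> C 1"
  shows "nil_isomorphism R C (csub A) (csub B) (\<lambda>x. x) \<longleftrightarrow> (\<exists>h. (\<kappa> ^^ h) ` B \<subseteq> A)"
proof -
  note Ac = submoduleE[OF A] and Bc = submoduleE[OF B]
  have CA: "(\<kappa> ^^ e) (c \<odot>\<^bsub>M\<^esub> x) \<in> A" if "c \<in> C e" "x \<in> A" for c e x
    using that C Ac(4) kappa_stable_kpow[of A, OF kA] by blast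
  have CB: "(\<kappa> ^^ e) (c \<odot>\<^bsub>M\<^esub> x) \<in> B" if "c \<in> C e" "x \<in> B" for c e x
    using that C Bc(4) kappa_stable_kpow[of B, OF kB] by blast
  have "cmodule_hom R C (csub A) (csub B) (\<lambda>x. x)"
    using AB by (auto simp: cmodule_hom_def linear_map_def)
  moreover have "nilpotent_cmodule C (csub A\<lparr>carrier := a_kernel (csub A) (csub B) (\<lambda>x. x)\<rparr>)"
  proof -
    have "a_kernel (csub A) (csub B) (\<lambda>x. x) = {\<zero>\<^bsub>M\<^esub>}"
      using submodule_zero[OF A] by (auto simp: a_kernel_def kernel_def)
    then have "cplus_power C (csub A\<lparr>carrier := a_kernel (csub A) (csub B) (\<lambda>x. x)\<rparr>) 0 = {\<zero>\<^bsub>M\<^esub>}"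
      by (simp only: cplus_power_def funpow_0) simp
    then show ?thesis
      unfolding nilpotent_cmodule_def by (intro exI[of _ 0]) simp
  qed
  moreover have "nilpotent_cmodule C (quot_cmodule (csub B) A) \<longleftrightarrow> (\<exists>h. (\<kappa> ^^ h) ` B \<subseteq> A)"
  proof -
    have coset: "A +>\<^bsub>M\<^esub> x = A \<longleftrightarrow> x \<in> A" if "x \<in> B" for x
      using that Bc(1) M.a_coset_join1[of A x] M.a_coset_join2[of x A] A by (auto simp: submodule_def)
    have VB: "cplus_power C (csub B) h \<subseteq> B" for h
      by (rule cplus_power_subset[OF B CB])
    have "cplus_power C (quot_cmodule (csub B) A) h = {\<zero>\<^bsub>quot_cmodule (csub B) A\<^esub>}
        \<longleftrightarrow> cplus_power C (csub B) h \<subseteq> A" for h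
    proof -
      have image: "cplus_power C (quot_cmodule (csub B) A) h = (\<lambda>x. A +>\<^bsub>M\<^esub> x) ` cplus_power C (csub B) h"
        by (rule cplus_power_quot[OF A B AB CA CB C])
      have zero: "\<zero>\<^bsub>quot_cmodule (csub B) A\<^esub> = A"
        by (simp add: quot_cmodule_def)
      have "(\<lambda>x. A +>\<^bsub>M\<^esub> x) ` V = {A} \<longleftrightarrow> V \<subseteq> A" if "V \<subseteq> B" "\<zero>\<^bsub>M\<^esub> \<in> V" for V
      proof -
        have "(\<lambda>x. A +>\<^bsub>M\<^esub> x) ` V = {A} \<longleftrightarrow> (\<forall>x\<in>V. A +>\<^bsub>M\<^esub> x = A)"
          using that(2) by blast
        then show ?thesis
          using that(1) by (auto simp: coset subset_iff)
      qed
      from this[OF VB zero_in_cplus_power[OF B]] show ?thesis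
        unfolding image zero .
    qed
    moreover have "cplus_power C (csub B) h = (\<kappa> ^^ h) ` B" for h
      by (rule subset_antisym[OF cplus_power_subset_kpow[OF B kB C] kpow_subset_cplus_power[of B C h, OF B C1]])
    ultimately show ?thesis
      by (simp add: nilpotent_cmodule_def)
  qed
  ultimately show ?thesis
    by (simp add: nil_isomorphism_def)
qed

end

section \<open>Localization of Frobenius-linear maps\<close>

locale cartier_localization = cartier_map R M p \<kappa> + localization R M S
  for R :: "'a ring" (structure) and M :: "('a, 'm) module" (structure) and p \<kappa> S
begin

abbreviation lkappa :: "('m \<times> 'a) set \<Rightarrow> ('m \<times> 'a) set" where
  "lkappa \<equiv> loc_kappa p R S M \<kappa>"

lemma p_minus_1: "Suc (p - 1) = p"
  using p_gt_1 by simp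

lemma loc_kappa_frac:
  assumes [simp]: "m \<in> carrier M" "s \<in> S"
  shows "lkappa (frac m s) = frac (\<kappa> ((s [^] (p - 1)) \<odot>\<^bsub>M\<^esub> m)) s"
proof -
  note [simp] = S_carrier S_mult S_pow kappa_closed
  have wd: "frac (\<kappa> ((s' [^] (p - 1)) \<odot>\<^bsub>M\<^esub> m')) s' = frac (\<kappa> ((s [^] (p - 1)) \<odot>\<^bsub>M\<^esub> m)) s"
    if a: "(m', s') \<in> frac m s" for m' s'
  proof -
    obtain u where u: "u \<in> S" "(u \<otimes> s') \<odot>\<^bsub>M\<^esub> m = (u \<otimes> s) \<odot>\<^bsub>M\<^esub> m'"
      using frac_repD(3)[OF a] by auto
    note [simp] = frac_repD(1,2)[OF a] u(1)
    \<comment> \<open>Multiplying by \<open>u s'\<close> outside \<open>\<kappa>\<close> multiplies by its \<open>p\<close>-th power inside, which leaves \<open>p - 1\<close> factors to spare.\<close>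
    define w where "w = u [^] (p - 1) \<otimes> s' [^] (p - 1) \<otimes> s [^] (p - 1)"
    have [simp]: "w \<in> carrier R"
      by (simp add: w_def)
    have pow_p: "r [^] p = r [^] (p - 1) \<otimes> r" if "r \<in> carrier R" for r
      using p_minus_1 by (metis nat_pow_Suc)
    have "(u \<otimes> s') \<odot>\<^bsub>M\<^esub> \<kappa> ((s [^] (p - 1)) \<odot>\<^bsub>M\<^esub> m)
        = \<kappa> (((u \<otimes> s') [^] p) \<odot>\<^bsub>M\<^esub> ((s [^] (p - 1)) \<odot>\<^bsub>M\<^esub> m))"
      by (simp add: kappa_smult)
    also have "((u \<otimes> s') [^] p) \<odot>\<^bsub>M\<^esub> ((s [^] (p - 1)) \<odot>\<^bsub>M\<^esub> m) = w \<odot>\<^bsub>M\<^esub> ((u \<otimes> s') \<odot>\<^bsub>M\<^esub> m)"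
      by (simp add: w_def pow_p R.nat_pow_distrib R.m_ac flip: smult_assoc1)
    also have "\<dots> = ((u \<otimes> s) [^] p) \<odot>\<^bsub>M\<^esub> ((s' [^] (p - 1)) \<odot>\<^bsub>M\<^esub> m')"
      unfolding u(2) by (simp add: w_def pow_p R.nat_pow_distrib R.m_ac flip: smult_assoc1)
    also have "\<kappa> \<dots> = (u \<otimes> s) \<odot>\<^bsub>M\<^esub> \<kappa> ((s' [^] (p - 1)) \<odot>\<^bsub>M\<^esub> m')"
      by (simp add: kappa_smult)
    finally show ?thesis
      by (subst frac_eq_iff) (auto intro!: bexI[of _ u])
  qed
  show ?thesis
    unfolding loc_kappa_def
  proof (rule SUP_eq_const)
    show "frac m s \<noteq> {}"
      using frac_self[of m s] by auto
    fix x assume "x \<in> frac m s"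
    then show "(case x of (m, s) \<Rightarrow> frac (\<kappa> ((s [^] (p - 1)) \<odot>\<^bsub>M\<^esub> m)) s)
        = frac (\<kappa> ((s [^] (p - 1)) \<odot>\<^bsub>M\<^esub> m)) s"
      using wd by (cases x) simp
  qed
qed

lemma rfrac_pow:
  assumes "a \<in> carrier R" "s \<in> S"
  shows "rfrac a s [^]\<^bsub>loc_ring R S\<^esub> (n::nat) = rfrac (a [^] n) (s [^] n)"
  by (induction n) (use assms in \<open>simp_all add: rfrac_one nat_pow_def rfrac_mult S_pow
      flip: nat_pow_def\<close>)

lemma cartier_map_loc: "cartier_map (loc_ring R S) (loc_module R S M) p lkappa"
proof -
  note [simp] = S_carrier S_mult S_pow kappa_closed
  interpret L: module "loc_ring R S" "loc_module R S M"
    by (rule module_loc)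
  show ?thesis
  proof
    show "1 < p"
      by (rule p_gt_1)
  next
    fix x assume "x \<in> carrier (loc_module R S M)"
    then show "lkappa x \<in> carrier (loc_module R S M)"
      by (elim loc_elemE) (simp add: loc_kappa_frac)
  next
    fix x y assume xy: "x \<in> carrier (loc_module R S M)" "y \<in> carrier (loc_module R S M)"
    obtain m n s where c: "m \<in> carrier M" "n \<in> carrier M" "s \<in> S" "x = frac m s" "y = frac n s"
      using common_denominator[OF xy xy(1)] by metis
    then show "lkappa (x \<oplus>\<^bsub>loc_module R S M\<^esub> y) = lkappa x \<oplus>\<^bsub>loc_module R S M\<^esub> lkappa y"
      by (simp add: loc_add_same loc_kappa_frac smult_r_distr kappa_add)
  next
    fix r x assume rx: "r \<in> carrier (loc_ring R S)" "x \<in> carrier (loc_module R S M)"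
    obtain a t where [simp]: "a \<in> carrier R" "t \<in> S" and r: "r = rfrac a t"
      using rx(1) by (rule loc_ring_elemE)
    obtain m s where [simp]: "m \<in> carrier M" "s \<in> S" and x: "x = frac m s"
      using rx(2) by (rule loc_elemE)
    define q where "q = p - 1"
    have p: "p = Suc q"
      using p_gt_1 by (simp add: q_def)
    have "((t [^] p \<otimes> s) [^] q) \<odot>\<^bsub>M\<^esub> ((a [^] p) \<odot>\<^bsub>M\<^esub> m)
        = ((t [^] q \<otimes> a) [^] p) \<odot>\<^bsub>M\<^esub> ((s [^] q) \<odot>\<^bsub>M\<^esub> m)"
      by (simp add: R.nat_pow_distrib R.nat_pow_pow mult.commute[of p q] R.m_ac flip: smult_assoc1)
    then have "\<kappa> (((t [^] p \<otimes> s) [^] q) \<odot>\<^bsub>M\<^esub> ((a [^] p) \<odot>\<^bsub>M\<^esub> m))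
        = (t [^] q \<otimes> a) \<odot>\<^bsub>M\<^esub> \<kappa> ((s [^] q) \<odot>\<^bsub>M\<^esub> m)"
      by (simp add: kappa_smult)
    also have "\<dots> = (t [^] q) \<odot>\<^bsub>M\<^esub> (a \<odot>\<^bsub>M\<^esub> \<kappa> ((s [^] q) \<odot>\<^bsub>M\<^esub> m))"
      by (simp add: smult_assoc1)
    finally have k: "\<kappa> (((t [^] p \<otimes> s) [^] q) \<odot>\<^bsub>M\<^esub> ((a [^] p) \<odot>\<^bsub>M\<^esub> m))
        = (t [^] q) \<odot>\<^bsub>M\<^esub> (a \<odot>\<^bsub>M\<^esub> \<kappa> ((s [^] q) \<odot>\<^bsub>M\<^esub> m))" .
    \<comment> \<open>The denominator \<open>t [^] p \<otimes> s\<close> exceeds the expected one, \<open>t \<otimes> s\<close>, by the factor that \<open>\<kappa>\<close> releases.\<close>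
    have "t [^] p \<otimes> s = t [^] q \<otimes> (t \<otimes> s)"
      by (simp add: p R.m_assoc)
    then have "frac (\<kappa> (((t [^] p \<otimes> s) [^] q) \<odot>\<^bsub>M\<^esub> ((a [^] p) \<odot>\<^bsub>M\<^esub> m))) (t [^] p \<otimes> s)
        = frac (a \<odot>\<^bsub>M\<^esub> \<kappa> ((s [^] q) \<odot>\<^bsub>M\<^esub> m)) (t \<otimes> s)"
      unfolding k by (simp only:) (rule frac_cancel, simp_all)
    then show "lkappa ((r [^]\<^bsub>loc_ring R S\<^esub> p) \<odot>\<^bsub>loc_module R S M\<^esub> x) = r \<odot>\<^bsub>loc_module R S M\<^esub> lkappa x"
      unfolding r x by (simp add: rfrac_pow smult_frac loc_kappa_frac flip: q_def[unfolded One_nat_def])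
  qed
qed

lemma loc_kappa_pow_frac:
  assumes "m \<in> carrier M" "s \<in> S"
  shows "(lkappa ^^ e) (frac m s) = frac ((\<kappa> ^^ e) ((s [^] (p ^ e - 1)) \<odot>\<^bsub>M\<^esub> m)) s"
proof (induction e)
  case (Suc e)
  note [simp] = S_carrier S_pow assms
  have "(p - 1) * p ^ e + (p ^ e - 1) = p ^ Suc e - 1"
    using p_gt_1 by (simp add: diff_mult_distrib)
  then have "((s [^] (p - 1)) [^] (p ^ e)) \<otimes> s [^] (p ^ e - 1) = s [^] (p ^ Suc e - 1)"
    by (simp only: R.nat_pow_pow R.nat_pow_mult S_carrier[OF assms(2)])
  then have "(s [^] (p - 1)) \<odot>\<^bsub>M\<^esub> (\<kappa> ^^ e) ((s [^] (p ^ e - 1)) \<odot>\<^bsub>M\<^esub> m)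
      = (\<kappa> ^^ e) ((s [^] (p ^ Suc e - 1)) \<odot>\<^bsub>M\<^esub> m)"
    by (simp flip: kpow_smult smult_assoc1)
  then show ?case
    using Suc by (simp add: loc_kappa_frac)
qed (use assms in \<open>simp add: S_carrier\<close>)

text \<open>It suffices that \<open>\<kappa>\<close> maps \<open>g N\<close> into \<open>N\<close> for one admissible denominator \<open>g\<close>, because
  $g\,\kappa(n) = \kappa(g^p n)$ and \<open>g\<close> is invertible in the localization.\<close>

lemma loc_subset_kappa_stable:
  assumes N: "submodule N R M" and g: "g \<in> S" "\<And>n. n \<in> N \<Longrightarrow> \<kappa> (g \<odot>\<^bsub>M\<^esub> n) \<in> N"
    and x: "x \<in> loc_subset R S M N"
  shows "lkappa x \<in> loc_subset R S M N"
proof -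
  note [simp] = S_carrier S_pow kappa_closed
  obtain n s where n: "n \<in> N" "s \<in> S" "x = frac n s"
    using x by (auto simp: loc_subset_def)
  have nM [simp]: "n \<in> carrier M"
    using n submoduleE(1)[OF N] by auto
  define y where "y = (g [^] (p - 1)) \<odot>\<^bsub>M\<^esub> ((s [^] (p - 1)) \<odot>\<^bsub>M\<^esub> n)"
  have y: "y \<in> N"
    unfolding y_def using n g(1) submoduleE(4)[OF N] by simp
  have "g [^] p = g \<otimes> g [^] (p - 1)"
    using p_minus_1 g(1) R.nat_pow_Suc2[of g "p - 1"] by simp
  then have "g \<odot>\<^bsub>M\<^esub> \<kappa> ((s [^] (p - 1)) \<odot>\<^bsub>M\<^esub> n) = \<kappa> (g \<odot>\<^bsub>M\<^esub> y)"
    using n(2) g(1) kappa_smult[of g "(s [^] (p - 1)) \<odot>\<^bsub>M\<^esub> n"] by (simp add: y_def smult_assoc1)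
  then have "g \<odot>\<^bsub>M\<^esub> \<kappa> ((s [^] (p - 1)) \<odot>\<^bsub>M\<^esub> n) \<in> N"
    using g(2)[OF y] by simp
  then show ?thesis
    using g(1) n(2) unfolding n(3) loc_kappa_frac[OF nM n(2)]
    by (subst frac_in_loc_subset_iff[OF N]) auto
qed

end

section \<open>The generic condition on test modules\<close>

lemma (in cring) ideal_ideal_power:
  assumes "ideal I R"
  shows "ideal (ideal_power R I k) R"
  by (induction k) (auto simp: ideal_power_def intro: ideal_prod_is_ideal assms oneideal)

lemma (in cring) ideal_power_antimono:
  assumes "ideal I R" "j \<le> k"
  shows "ideal_power R I k \<subseteq> ideal_power R I j"
  using assms(2)
proof (induction k rule: dec_induct)
  case (step n)
  have "ideal_power R I (Suc n) \<subseteq> ideal_power R I n"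
    using ideal_prod_inter[OF assms(1) ideal_ideal_power[OF assms(1), of n]]
    by (auto simp: ideal_power_def)
  then show ?case
    using step by auto
qed simp

context module
begin

lemma H0_submodule:
  assumes \<eta>: "ideal \<eta> R" and N: "submodule N R M"
  shows "submodule (H0 R M \<eta> N) R M"
proof (rule submoduleI')
  note Nc = submoduleE[OF N]
  have ideal: "r \<in> carrier R" if "r \<in> ideal_power R \<eta> k" for r k
    using that R.ideal_ideal_power[OF \<eta>, of k] ideal.Icarr by metis
  show "H0 R M \<eta> N \<subseteq> carrier M"
    using Nc(1) by (auto simp: H0_def)
  show "\<zero>\<^bsub>M\<^esub> \<in> H0 R M \<eta> N"
    using submodule_zero[OF N] ideal by (auto simp: H0_def)
  show "a \<oplus>\<^bsub>M\<^esub> b \<in> H0 R M \<eta> N" if ab: "a \<in> H0 R M \<eta> N" "b \<in> H0 R M \<eta> N" for a b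
  proof -
    obtain j k where j: "\<forall>r \<in> ideal_power R \<eta> j. r \<odot>\<^bsub>M\<^esub> a = \<zero>\<^bsub>M\<^esub>"
      and k: "\<forall>r \<in> ideal_power R \<eta> k. r \<odot>\<^bsub>M\<^esub> b = \<zero>\<^bsub>M\<^esub>"
      using ab by (auto simp: H0_def)
    have "r \<odot>\<^bsub>M\<^esub> (a \<oplus>\<^bsub>M\<^esub> b) = \<zero>\<^bsub>M\<^esub>" if r: "r \<in> ideal_power R \<eta> (max j k)" for r
    proof -
      have "r \<in> ideal_power R \<eta> j" "r \<in> ideal_power R \<eta> k"
        using r R.ideal_power_antimono[OF \<eta>] by (meson max.cobounded1 max.cobounded2 subsetD)+
      then show ?thesis
        using j k ab Nc(1) ideal[OF r] by (subst smult_r_distr) (auto simp: H0_def)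
    qed
    then show ?thesis
      using ab Nc(5) unfolding H0_def by blast
  qed
  show "a \<odot>\<^bsub>M\<^esub> x \<in> H0 R M \<eta> N" if a: "a \<in> carrier R" and x: "x \<in> H0 R M \<eta> N" for a x
  proof -
    obtain k where k: "\<forall>r \<in> ideal_power R \<eta> k. r \<odot>\<^bsub>M\<^esub> x = \<zero>\<^bsub>M\<^esub>"
      using x by (auto simp: H0_def)
    have "r \<odot>\<^bsub>M\<^esub> (a \<odot>\<^bsub>M\<^esub> x) = \<zero>\<^bsub>M\<^esub>" if r: "r \<in> ideal_power R \<eta> k" for r
    proof -
      have "x \<in> carrier M"
        using x Nc(1) by (auto simp: H0_def)
      then have "r \<odot>\<^bsub>M\<^esub> (a \<odot>\<^bsub>M\<^esub> x) = a \<odot>\<^bsub>M\<^esub> (r \<odot>\<^bsub>M\<^esub> x)"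
        using a ideal[OF r] by (simp add: R.m_comm flip: smult_assoc1)
      then show ?thesis
        using k r a by simp
    qed
    then show ?thesis
      using x a Nc(4) unfolding H0_def by blast
  qed
qed

lemma regular_notin_associated_prime:
  assumes "regular_on M f" "\<eta> \<in> associated_primes R M"
  shows "f \<notin> \<eta>"
proof
  assume "f \<in> \<eta>"
  obtain m where m: "m \<in> carrier M" "\<eta> = annihilator R M m" and \<eta>: "primeideal \<eta> R"
    using assms(2) by (auto simp: associated_primes_def)
  have "m = \<zero>\<^bsub>M\<^esub>"
    using \<open>f \<in> \<eta>\<close> m assms(1) by (auto simp: annihilator_def regular_on_def)
  then have "\<eta> = carrier R"
    using m by (auto simp: annihilator_def)
  then show False
    using \<eta> primeideal.I_notcarr by blast
qed

end

lemma (in cring) submonoid_compl_prime: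
  assumes "primeideal \<eta> R"
  shows "submonoid (carrier R - \<eta>) R"
proof -
  interpret primeideal \<eta> R by fact
  show ?thesis
    by standard (use I_prime one_imp_carrier I_notcarr in auto)
qed

lemma (in cring) PIdl_unit_pow:
  assumes "f \<in> carrier R" "g \<in> carrier R" "g \<otimes> f = \<one>"
  shows "\<one> \<in> PIdl (f [^] (n::nat))"
proof -
  have "\<one> = g [^] n \<otimes> f [^] n"
    using assms by (simp flip: nat_pow_distrib)
  then show ?thesis
    using assms(2) by (auto simp: cgenideal_def)
qed

context cartier_map
begin

text \<open>If \<open>r\<close> lies in a power of \<open>\<eta>\<close>, then so does \<open>r [^] p\<close>, and $r\,\kappa(gn) = \kappa(g r^p n)$. Hence the
  power of \<open>\<eta>\<close> that kills \<open>n\<close> also kills \<open>\<kappa> (g n)\<close>.\<close>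

lemma H0_kappa_stable:
  assumes \<eta>: "ideal \<eta> R" and N: "submodule N R M"
    and g: "g \<in> carrier R" "\<And>n. n \<in> N \<Longrightarrow> \<kappa> (g \<odot>\<^bsub>M\<^esub> n) \<in> N"
    and n: "n \<in> H0 R M \<eta> N"
  shows "\<kappa> (g \<odot>\<^bsub>M\<^esub> n) \<in> H0 R M \<eta> N"
proof -
  have nN: "n \<in> N" and nM: "n \<in> carrier M"
    using n submoduleE(1)[OF N] by (auto simp: H0_def)
  obtain k where k: "\<And>r. r \<in> ideal_power R \<eta> k \<Longrightarrow> r \<odot>\<^bsub>M\<^esub> n = \<zero>\<^bsub>M\<^esub>"
    using n by (auto simp: H0_def)
  interpret I: ideal "ideal_power R \<eta> k" R
    by (rule R.ideal_ideal_power[OF \<eta>])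
  have "r \<odot>\<^bsub>M\<^esub> \<kappa> (g \<odot>\<^bsub>M\<^esub> n) = \<zero>\<^bsub>M\<^esub>" if r: "r \<in> ideal_power R \<eta> k" for r
  proof -
    have rR: "r \<in> carrier R"
      using r by (rule I.Icarr)
    have "r [^] p = r [^] (p - 1) \<otimes> r"
      using p_gt_1 by (metis Suc_diff_1 less_trans nat_pow_Suc zero_less_one)
    then have "r \<odot>\<^bsub>M\<^esub> \<kappa> (g \<odot>\<^bsub>M\<^esub> n) = \<kappa> ((r [^] (p - 1) \<otimes> g \<otimes> r) \<odot>\<^bsub>M\<^esub> n)"
      using rR g nM by (simp add: R.m_ac flip: kappa_smult smult_assoc1)
    also have "(r [^] (p - 1) \<otimes> g \<otimes> r) \<odot>\<^bsub>M\<^esub> n = \<zero>\<^bsub>M\<^esub>"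
      using rR g nM k[OF r] by (simp add: smult_assoc1)
    finally show ?thesis
      using kpow_zero[of 1] by simp
  qed
  then show ?thesis
    using g nN unfolding H0_def by blast
qed

text \<open>At an associated prime that does not contain \<open>f\<close>, the image of \<open>f\<close> is a unit. The localized algebra is
  then the full algebra generated by \<open>\<kappa>\<close>, whatever the exponent \<open>l\<close> is, and the generic condition
  says that a power of \<open>\<kappa>\<close> maps $H^0_\eta(M)_\eta$ into $H^0_\eta(N)_\eta$. Clearing denominators
  gives a condition on elements of \<open>M\<close>, which no longer mentions \<open>l\<close>.\<close>

lemma test_condition_iff:
  assumes f: "f \<in> carrier R" "\<And>\<eta>. \<eta> \<in> associated_primes R M \<Longrightarrow> f \<notin> \<eta>"
    and N: "submodule N R M" and j: "\<And>n. n \<in> N \<Longrightarrow> \<kappa> ((f [^] (j::nat)) \<odot>\<^bsub>M\<^esub> n) \<in> N"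
  shows "test_condition p R M \<kappa> f l N \<longleftrightarrow>
    (\<forall>\<eta> \<in> associated_primes R M. \<exists>h. \<forall>m \<in> H0 R M \<eta> (carrier M).
       \<exists>t \<in> carrier R - \<eta>. t \<odot>\<^bsub>M\<^esub> (\<kappa> ^^ h) m \<in> N)"
proof -
  have iff: "nil_isomorphism (loc_ring R S) (tau_algebra p (loc_ring R S) (loc_frac R S (self_module R) f \<one>) l)
             ((cmodule_of (loc_module R S M) (loc_kappa p R S M \<kappa>))\<lparr>carrier := loc_subset R S M (H0 R M \<eta> N)\<rparr>)
             ((cmodule_of (loc_module R S M) (loc_kappa p R S M \<kappa>))\<lparr>carrier := loc_subset R S M (H0 R M \<eta> (carrier M))\<rparr>)
             (\<lambda>x. x) \<longleftrightarrow> (\<exists>h. \<forall>m \<in> H0 R M \<eta> (carrier M). \<exists>t \<in> S. t \<odot>\<^bsub>M\<^esub> (\<kappa> ^^ h) m \<in> N)"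
    if \<eta>: "\<eta> \<in> associated_primes R M" and S: "S = carrier R - \<eta>" for \<eta> S
  proof -
    interpret \<eta>: primeideal \<eta> R
      using \<eta> by (simp add: associated_primes_def)
    interpret cartier_localization R M p \<kappa> S
      using R.submonoid_compl_prime[OF \<eta>.primeideal_axioms]
      by (simp add: S cartier_localization_def localization_def localization_axioms_def
          cartier_map_axioms module_axioms)
    interpret L: cartier_map "loc_ring R S" "loc_module R S M" p lkappa
      by (rule cartier_map_loc)
    define A where "A = loc_subset R S M (H0 R M \<eta> N)"
    define B where "B = loc_subset R S M (H0 R M \<eta> (carrier M))"
    define C where "C = tau_algebra p (loc_ring R S) (rfrac f \<one>) l"
    have fS: "f \<in> S"
      using f \<eta> by (auto simp: S)
    note H0N = H0_submodule[OF \<eta>.is_ideal N]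
    note H0M = H0_submodule[OF \<eta>.is_ideal carrier_is_submodule]
    have H0_stable: "(\<kappa> ^^ h) m \<in> H0 R M \<eta> (carrier M)" if "m \<in> H0 R M \<eta> (carrier M)" for h m
    proof (rule kappa_stable_kpow[OF _ that])
      fix x assume x: "x \<in> H0 R M \<eta> (carrier M)"
      then show "\<kappa> x \<in> H0 R M \<eta> (carrier M)"
        using H0_kappa_stable[OF \<eta>.is_ideal carrier_is_submodule, of \<one> x] kappa_closed
          submoduleE(1)[OF H0M] by auto
    qed
    have "nil_isomorphism (loc_ring R S) C (L.csub A) (L.csub B) (\<lambda>x. x) \<longleftrightarrow> (\<exists>h. (lkappa ^^ h) ` B \<subseteq> A)"
    proof (rule L.nil_isomorphism_iff)
      show "submodule A (loc_ring R S) (loc_module R S M)" "submodule B (loc_ring R S) (loc_module R S M)"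
        unfolding A_def B_def by (rule submodule_loc_subset H0N H0M)+
      show "A \<subseteq> B"
        using submoduleE(1)[OF N] by (auto simp: A_def B_def loc_subset_def H0_def)
      show "lkappa x \<in> A" if "x \<in> A" for x
        using that unfolding A_def
        by (intro loc_subset_kappa_stable[OF H0N, of "f [^] j"] H0_kappa_stable[OF \<eta>.is_ideal N] j)
          (auto simp: S_pow fS f(1))
      show "lkappa x \<in> B" if "x \<in> B" for x
        using that H0_stable[of _ 1] submoduleE(1)[OF H0M] unfolding B_def
        by (intro loc_subset_kappa_stable[OF H0M, of \<one>]) auto
      show "C e \<subseteq> carrier (loc_ring R S)" for e
        using L.cgenideal_ideal[of "rfrac f \<one> [^]\<^bsub>loc_ring R S\<^esub> nat \<lceil>l * of_nat (p ^ e)\<rceil>"] f(1)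
          additive_subgroup.a_subset ideal.axioms(1)
        by (auto simp: C_def tau_algebra_def)
      have "rfrac f f = rfrac \<one> \<one>"
        using fS by (intro rfrac_eqI) (auto simp: S_carrier)
      then have "rfrac \<one> f \<otimes>\<^bsub>loc_ring R S\<^esub> rfrac f \<one> = \<one>\<^bsub>loc_ring R S\<^esub>"
        using fS by (simp add: rfrac_mult rfrac_one S_carrier)
      then show "\<one>\<^bsub>loc_ring R S\<^esub> \<in> C 1"
        using L.PIdl_unit_pow[of "rfrac f \<one>" "rfrac \<one> f"] fS f(1) by (simp add: C_def tau_algebra_def)
    qed
    moreover have "(lkappa ^^ h) ` B \<subseteq> A \<longleftrightarrow> (\<forall>m \<in> H0 R M \<eta> (carrier M). \<exists>t \<in> S. t \<odot>\<^bsub>M\<^esub> (\<kappa> ^^ h) m \<in> N)" for h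
    proof
      assume sub: "(lkappa ^^ h) ` B \<subseteq> A"
      show "\<forall>m \<in> H0 R M \<eta> (carrier M). \<exists>t \<in> S. t \<odot>\<^bsub>M\<^esub> (\<kappa> ^^ h) m \<in> N"
      proof
        fix m assume m: "m \<in> H0 R M \<eta> (carrier M)"
        then have mM: "m \<in> carrier M"
          by (simp add: H0_def)
        have "frac m \<one> \<in> B"
          using m S_one unfolding B_def loc_subset_def by blast
        then have "frac ((\<kappa> ^^ h) m) \<one> \<in> A"
          using sub mM loc_kappa_pow_frac[of m \<one> h] by auto
        then show "\<exists>t \<in> S. t \<odot>\<^bsub>M\<^esub> (\<kappa> ^^ h) m \<in> N"
          using mM unfolding A_def by (subst (asm) frac_in_loc_subset_iff[OF H0N]) (auto simp: H0_def)
      qed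
    next
      assume sub: "\<forall>m \<in> H0 R M \<eta> (carrier M). \<exists>t \<in> S. t \<odot>\<^bsub>M\<^esub> (\<kappa> ^^ h) m \<in> N"
      show "(lkappa ^^ h) ` B \<subseteq> A"
      proof
        fix x assume "x \<in> (lkappa ^^ h) ` B"
        then obtain m s where m: "m \<in> H0 R M \<eta> (carrier M)" "s \<in> S" "x = (lkappa ^^ h) (frac m s)"
          by (auto simp: B_def loc_subset_def)
        define y where "y = (s [^] (p ^ h - 1)) \<odot>\<^bsub>M\<^esub> m"
        have y: "y \<in> H0 R M \<eta> (carrier M)"
          using m submoduleE(4)[OF H0M] unfolding y_def by (simp add: S_carrier)
        then obtain t where t: "t \<in> S" "t \<odot>\<^bsub>M\<^esub> (\<kappa> ^^ h) y \<in> N"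
          using sub by blast
        have "t \<odot>\<^bsub>M\<^esub> (\<kappa> ^^ h) y \<in> H0 R M \<eta> (carrier M)"
          using submoduleE(4)[OF H0M] H0_stable[OF y] t(1) S_carrier by blast
        then have "t \<odot>\<^bsub>M\<^esub> (\<kappa> ^^ h) y \<in> H0 R M \<eta> N"
          using t(2) by (simp add: H0_def)
        moreover have "x = frac ((\<kappa> ^^ h) y) s"
          using m by (simp add: y_def loc_kappa_pow_frac H0_def)
        moreover have "(\<kappa> ^^ h) y \<in> carrier M"
          using y by (simp add: H0_def)
        ultimately show "x \<in> A"
          using t(1) m(2) by (auto simp: A_def frac_in_loc_subset_iff[OF H0N])
      qed
    qed
    ultimately show ?thesis
      unfolding A_def B_def C_def by simp
  qed
  show ?thesis
    unfolding test_condition_def Let_def using iff[OF _ refl] by auto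
qed

end

section \<open>F-regularity away from $f$\<close>

lemma (in cring) idealI':
  assumes "I \<subseteq> carrier R" "\<zero> \<in> I"
    and "\<And>a b. a \<in> I \<Longrightarrow> b \<in> I \<Longrightarrow> a \<oplus> b \<in> I"
    and mult: "\<And>a x. a \<in> I \<Longrightarrow> x \<in> carrier R \<Longrightarrow> x \<otimes> a \<in> I"
  shows "ideal I R"
proof (rule idealI)
  show "subgroup I (add_monoid R)"
  proof (rule add.subgroupI)
    fix a assume a: "a \<in> I"
    then have "\<ominus> a = (\<ominus> \<one>) \<otimes> a"
      using assms(1) by (auto simp: l_minus)
    then show "\<ominus> a \<in> I"
      using mult[OF a, of "\<ominus> \<one>"] by simp
  qed (use assms in auto)
  show "a \<otimes> x \<in> I" if "a \<in> I" "x \<in> carrier R" for a x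
    using that mult[OF that] assms(1) m_comm[of a x] by auto
qed (use assms ring_axioms in auto)

lemma (in module) ideal_annihilator:
  assumes "m \<in> carrier M"
  shows "ideal (annihilator R M m) R"
  using assms by (intro R.idealI') (auto simp: annihilator_def smult_l_distr smult_assoc1)

lemma (in cartier_map) csubmodule_iff:
  "csubmodule R C (cmodule_of M \<kappa>) N \<longleftrightarrow> submodule N R M \<and>
    (\<forall>e. \<forall>c \<in> C e. \<forall>x \<in> N. (\<kappa> ^^ e) (c \<odot>\<^bsub>M\<^esub> x) \<in> N)"
proof -
  have "submodule N R (cmodule_of M \<kappa>) \<longleftrightarrow> submodule N R M"
    by (simp add: submodule_def subgroup_def submodule_axioms_def m_inv_def)
  then show ?thesis
    by (simp add: csubmodule_def)
qed

lemma (in cring) submonoid_powers_of: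
  assumes "f \<in> carrier R"
  shows "submonoid (powers_of R f) R"
proof
  show "\<one> \<in> powers_of R f"
    unfolding powers_of_def by (metis nat_pow_0 rangeI)
  show "x \<otimes> y \<in> powers_of R f" if "x \<in> powers_of R f" "y \<in> powers_of R f" for x y
    using that assms unfolding powers_of_def by (auto simp: nat_pow_mult)
qed (use assms in \<open>auto simp: powers_of_def\<close>)

lemma (in module) regular_on_pow:
  assumes "regular_on M f" "f \<in> carrier R" "m \<in> carrier M" "(f [^] (n::nat)) \<odot>\<^bsub>M\<^esub> m = \<zero>\<^bsub>M\<^esub>"
  shows "m = \<zero>\<^bsub>M\<^esub>"
  using assms(4)
proof (induction n)
  case (Suc n)
  have "f \<odot>\<^bsub>M\<^esub> ((f [^] n) \<odot>\<^bsub>M\<^esub> m) = (f [^] Suc n) \<odot>\<^bsub>M\<^esub> m"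
    using assms(2,3) by (simp add: R.m_comm flip: smult_assoc1)
  then have "(f [^] n) \<odot>\<^bsub>M\<^esub> m = \<zero>\<^bsub>M\<^esub>"
    using Suc.prems assms(1-3) unfolding regular_on_def by simp
  then show ?case
    by (rule Suc.IH)
qed (use assms in simp)

text \<open>If the denominators act injectively on \<open>M\<close>, then the annihilator of a fraction contracts to the
  annihilator of its numerator. So associated primes contract to associated primes, with the
  numerator of any representative as a witness.\<close>

locale regular_localization = cartier_localization R M p \<kappa> S
  for R :: "'a ring" (structure) and M :: "('a, 'm) module" (structure) and p \<kappa> S +
  assumes S_regular: "s \<in> S \<Longrightarrow> m \<in> carrier M \<Longrightarrow> s \<odot>\<^bsub>M\<^esub> m = \<zero>\<^bsub>M\<^esub> \<Longrightarrow> m = \<zero>\<^bsub>M\<^esub>"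
begin

lemma frac_eq_zero_iff:
  assumes "m \<in> carrier M" "s \<in> S"
  shows "frac m s = \<zero>\<^bsub>loc_module R S M\<^esub> \<longleftrightarrow> m = \<zero>\<^bsub>M\<^esub>"
  unfolding loc_zero using assms S_regular[OF _ assms(1)]
  by (subst frac_eq_iff) (auto simp: S_carrier)

definition contraction :: "('a \<times> 'a) set set \<Rightarrow> 'a set" where
  "contraction P = {r \<in> carrier R. rfrac r \<one> \<in> P}"

lemma contraction_power:
  assumes P: "ideal P (loc_ring R S)" and r: "r \<in> ideal_power R (contraction P) k"
    and I: "ideal (contraction P) R"
  shows "rfrac r \<one> \<in> ideal_power (loc_ring R S) P k"
  using r
proof (induction k arbitrary: r)
  case 0
  then show ?case
    by (auto simp: ideal_power_def)
next
  case (Suc k)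
  have "r \<in> ideal_prod R (contraction P) (ideal_power R (contraction P) k)"
    using Suc.prems by (simp add: ideal_power_def)
  moreover have "rfrac r \<one> \<in> ideal_prod (loc_ring R S) P (ideal_power (loc_ring R S) P k) \<and> r \<in> carrier R"
    using calculation
  proof induction
    case (prod i j)
    have ij: "i \<in> carrier R" "rfrac i \<one> \<in> P" "j \<in> carrier R"
      using prod ideal.Icarr[OF R.ideal_ideal_power[OF I]] by (auto simp: contraction_def)
    then have "rfrac (i \<otimes> j) \<one> = rfrac i \<one> \<otimes>\<^bsub>loc_ring R S\<^esub> rfrac j \<one>"
      by (simp add: rfrac_mult)
    then show ?case
      using ij Suc.IH[OF prod(2)] ideal_prod.prod[of "rfrac i \<one>" P] by simp
  next
    case (sum s1 s2)
    then have "rfrac (s1 \<oplus> s2) \<one> = rfrac s1 \<one> \<oplus>\<^bsub>loc_ring R S\<^esub> rfrac s2 \<one>"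
      by (simp add: rfrac_add_same)
    then show ?case
      using sum ideal_prod.sum[of "rfrac s1 \<one>" "loc_ring R S" P] by simp
  qed
  ultimately show ?case
    by (simp add: ideal_power_def)
qed

lemma contraction_associated_prime:
  assumes P: "P \<in> associated_primes (loc_ring R S) (loc_module R S M)"
  shows "contraction P \<in> associated_primes R M"
proof -
  interpret P: primeideal P "loc_ring R S"
    using P by (simp add: associated_primes_def)
  obtain x where x: "x \<in> carrier (loc_module R S M)" "P = annihilator (loc_ring R S) (loc_module R S M) x"
    using P by (auto simp: associated_primes_def)
  obtain m s where m: "m \<in> carrier M" "s \<in> S" "x = frac m s"
    using x(1) by (rule loc_elemE)
  have "rfrac r \<one> \<odot>\<^bsub>loc_module R S M\<^esub> x = \<zero>\<^bsub>loc_module R S M\<^esub> \<longleftrightarrow> r \<odot>\<^bsub>M\<^esub> m = \<zero>\<^bsub>M\<^esub>"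
    if "r \<in> carrier R" for r
    using that m smult_frac[of r \<one> m s] frac_eq_zero_iff[of "r \<odot>\<^bsub>M\<^esub> m" s] by (simp add: S_carrier)
  then have ann: "contraction P = annihilator R M m"
    unfolding contraction_def annihilator_def x(2) by auto
  have "primeideal (contraction P) R"
  proof (rule primeidealI)
    show "ideal (contraction P) R"
      unfolding ann by (rule ideal_annihilator[OF m(1)])
    show "carrier R \<noteq> contraction P"
    proof
      assume "carrier R = contraction P"
      then have "\<one>\<^bsub>loc_ring R S\<^esub> \<in> P"
        unfolding rfrac_one by (auto simp: contraction_def)
      then show False
        using P.I_notcarr P.one_imp_carrier by blast
    qed
    fix a b assume ab: "a \<in> carrier R" "b \<in> carrier R" "a \<otimes> b \<in> contraction P"
    then have "rfrac a \<one> \<otimes>\<^bsub>loc_ring R S\<^esub> rfrac b \<one> \<in> P"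
      by (simp add: contraction_def rfrac_mult)
    then show "a \<in> contraction P \<or> b \<in> contraction P"
      using P.I_prime[of "rfrac a \<one>" "rfrac b \<one>"] ab by (auto simp: contraction_def)
  qed (rule R.is_cring)
  then show ?thesis
    using m(1) ann by (auto simp: associated_primes_def)
qed

lemma H0_contraction:
  assumes P: "P \<in> associated_primes (loc_ring R S) (loc_module R S M)"
    and m: "m \<in> carrier M" "s \<in> S" "frac m s \<in> H0 (loc_ring R S) (loc_module R S M) P X"
  shows "m \<in> H0 R M (contraction P) (carrier M)"
proof -
  have I: "ideal P (loc_ring R S)" "ideal (contraction P) R"
    using P contraction_associated_prime[OF P]
    by (auto simp: associated_primes_def primeideal_def)
  obtain k where k: "\<And>a. a \<in> ideal_power (loc_ring R S) P k \<Longrightarrow>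
      a \<odot>\<^bsub>loc_module R S M\<^esub> frac m s = \<zero>\<^bsub>loc_module R S M\<^esub>"
    using m(3) by (auto simp: H0_def)
  have "r \<odot>\<^bsub>M\<^esub> m = \<zero>\<^bsub>M\<^esub>" if r: "r \<in> ideal_power R (contraction P) k" for r
  proof -
    have "r \<in> carrier R"
      using r ideal.Icarr[OF R.ideal_ideal_power[OF I(2)]] by blast
    then show ?thesis
      using k[OF contraction_power[OF I(1) r I(2)]] m(1,2) 
      by (simp add: smult_frac S_carrier frac_eq_zero_iff)
  qed
  then show ?thesis
    using m(1) by (auto simp: H0_def)
qed

text \<open>The localization of \<open>N\<close> satisfies the conditions that define the test module of the localized module.
  By F-regularity it contains everything. The generic condition at a prime of the
  localized ring is obtained from the one at its contraction.\<close>

lemma F_regular_loc_subset: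
  assumes F: "F_regular p (loc_ring R S) (loc_module R S M) lkappa"
    and N: "submodule N R M" and g: "g \<in> S" "\<And>n. n \<in> N \<Longrightarrow> \<kappa> (g \<odot>\<^bsub>M\<^esub> n) \<in> N"
    and gen: "\<And>\<eta>. \<eta> \<in> associated_primes R M \<Longrightarrow>
      \<exists>h. \<forall>m \<in> H0 R M \<eta> (carrier M). \<exists>t \<in> carrier R - \<eta>. t \<odot>\<^bsub>M\<^esub> (\<kappa> ^^ h) m \<in> N"
    and m: "m \<in> carrier M"
  shows "\<exists>s\<in>S. s \<odot>\<^bsub>M\<^esub> m \<in> N"
proof -
  interpret L: cartier_map "loc_ring R S" "loc_module R S M" p lkappa
    by (rule cartier_map_loc)
  define A where "A = loc_subset R S M N"
  have A: "submodule A (loc_ring R S) (loc_module R S M)"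
    unfolding A_def by (rule submodule_loc_subset[OF N])
  have kA: "lkappa x \<in> A" if "x \<in> A" for x
    using that loc_subset_kappa_stable[OF N g] by (simp add: A_def)
  have "tau_algebra p (loc_ring R S) \<one>\<^bsub>loc_ring R S\<^esub> 0 e \<subseteq> carrier (loc_ring R S)" for e
    by (auto simp: tau_algebra_def cgenideal_def)
  then have "csubmodule (loc_ring R S) (tau_algebra p (loc_ring R S) \<one>\<^bsub>loc_ring R S\<^esub> 0)
      (cmodule_of (loc_module R S M) lkappa) A"
    unfolding L.csubmodule_iff
    using A L.submoduleE(4)[OF A] L.kappa_stable_kpow[of A, OF kA] by blast
  moreover have "test_condition p (loc_ring R S) (loc_module R S M) lkappa \<one>\<^bsub>loc_ring R S\<^esub> 0 A"
  proof (subst L.test_condition_iff[OF _ _ A, of _ 0])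
    show "\<one>\<^bsub>loc_ring R S\<^esub> \<notin> P" if "P \<in> associated_primes (loc_ring R S) (loc_module R S M)" for P
      using that ideal.one_imp_carrier[of P "loc_ring R S"] primeideal.I_notcarr[of P "loc_ring R S"]
      by (auto simp: associated_primes_def primeideal_def)
    show "lkappa (\<one>\<^bsub>loc_ring R S\<^esub> [^]\<^bsub>loc_ring R S\<^esub> (0::nat) \<odot>\<^bsub>loc_module R S M\<^esub> x) \<in> A" if "x \<in> A" for x
      using kA[OF that] that L.submoduleE(1)[OF A] by auto
    show "\<forall>P\<in>associated_primes (loc_ring R S) (loc_module R S M).
       \<exists>h. \<forall>x\<in>H0 (loc_ring R S) (loc_module R S M) P (carrier (loc_module R S M)).
         \<exists>t\<in>carrier (loc_ring R S) - P. t \<odot>\<^bsub>loc_module R S M\<^esub> (lkappa ^^ h) x \<in> A"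
    proof
      fix P assume P: "P \<in> associated_primes (loc_ring R S) (loc_module R S M)"
      define \<eta> where "\<eta> = contraction P"
      have \<eta>: "\<eta> \<in> associated_primes R M"
        unfolding \<eta>_def by (rule contraction_associated_prime[OF P])
      have \<eta>_ideal: "ideal \<eta> R"
        using \<eta> by (simp add: associated_primes_def primeideal_def)
      obtain h where h: "\<forall>m \<in> H0 R M \<eta> (carrier M). \<exists>t \<in> carrier R - \<eta>. t \<odot>\<^bsub>M\<^esub> (\<kappa> ^^ h) m \<in> N"
        using gen[OF \<eta>] by blast
      have "\<exists>t\<in>carrier (loc_ring R S) - P. t \<odot>\<^bsub>loc_module R S M\<^esub> (lkappa ^^ h) x \<in> A"
        if x: "x \<in> H0 (loc_ring R S) (loc_module R S M) P (carrier (loc_module R S M))" for x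
      proof -
        obtain m s where m: "m \<in> carrier M" "s \<in> S" "x = frac m s"
          using x by (auto simp: H0_def elim: loc_elemE)
        define y where "y = (s [^] (p ^ h - 1)) \<odot>\<^bsub>M\<^esub> m"
        have yM: "y \<in> carrier M"
          using m by (simp add: y_def S_carrier)
        have "y \<in> H0 R M \<eta> (carrier M)"
          using H0_contraction[OF P m(1,2)] x m H0_submodule[OF \<eta>_ideal carrier_is_submodule] submoduleE(4)
          unfolding y_def \<eta>_def by (simp add: S_carrier)
        then obtain t where t: "t \<in> carrier R - \<eta>" "t \<odot>\<^bsub>M\<^esub> (\<kappa> ^^ h) y \<in> N"
          using h by blast
        have "rfrac t \<one> \<odot>\<^bsub>loc_module R S M\<^esub> (lkappa ^^ h) x = frac (t \<odot>\<^bsub>M\<^esub> (\<kappa> ^^ h) y) s"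
          using m t(1) yM by (simp add: loc_kappa_pow_frac smult_frac S_carrier flip: y_def[unfolded One_nat_def])
        then have "rfrac t \<one> \<odot>\<^bsub>loc_module R S M\<^esub> (lkappa ^^ h) x \<in> A"
          using t(2) m(2) unfolding A_def loc_subset_def by auto
        moreover have "rfrac t \<one> \<in> carrier (loc_ring R S) - P"
          using t(1) by (auto simp: \<eta>_def contraction_def)
        ultimately show ?thesis
          by blast
      qed
      then show "\<exists>h. \<forall>x\<in>H0 (loc_ring R S) (loc_module R S M) P (carrier (loc_module R S M)).
         \<exists>t\<in>carrier (loc_ring R S) - P. t \<odot>\<^bsub>loc_module R S M\<^esub> (lkappa ^^ h) x \<in> A"
        by blast
    qed
  qed simp
  ultimately have "carrier (loc_module R S M) \<subseteq> A"
    using F by (simp add: F_regular_def is_tau_def)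
  then have "frac m \<one> \<in> A"
    using m by auto
  then show ?thesis
    using m by (simp add: A_def frac_in_loc_subset_iff[OF N])
qed

end

lemma (in module) finsum_in_submodule:
  assumes W: "submodule W R M" and X: "finite X" "X \<subseteq> W" "c \<in> X \<rightarrow> carrier R"
  shows "(\<Oplus>\<^bsub>M\<^esub>x\<in>X. c x \<odot>\<^bsub>M\<^esub> x) \<in> W"
  using X
proof (induction X)
  case empty
  then show ?case
    using submodule_zero[OF W] by simp
next
  case (insert x X)
  note Wc = submoduleE[OF W]
  have "(\<lambda>x. c x \<odot>\<^bsub>M\<^esub> x) \<in> X \<rightarrow> carrier M"
    using insert.prems Wc(1) by (auto simp: Pi_iff)
  moreover have "c x \<odot>\<^bsub>M\<^esub> x \<in> carrier M"
    using insert.prems Wc(1) by auto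
  ultimately have "(\<Oplus>\<^bsub>M\<^esub>x\<in>insert x X. c x \<odot>\<^bsub>M\<^esub> x) = c x \<odot>\<^bsub>M\<^esub> x \<oplus>\<^bsub>M\<^esub> (\<Oplus>\<^bsub>M\<^esub>x\<in>X. c x \<odot>\<^bsub>M\<^esub> x)"
    using insert.hyps by (intro M.finsum_insert) auto
  then show ?case
    using insert Wc(4,5) by simp
qed

lemma (in module) fin_gen_power_subset:
  assumes fg: "fin_gen_module R M" and f: "f \<in> carrier R" and N: "submodule N R M"
    and ex: "\<And>m. m \<in> carrier M \<Longrightarrow> \<exists>a::nat. (f [^] a) \<odot>\<^bsub>M\<^esub> m \<in> N"
  shows "\<exists>a::nat. \<forall>m \<in> carrier M. (f [^] a) \<odot>\<^bsub>M\<^esub> m \<in> N"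
proof -
  note Nc = submoduleE[OF N]
  obtain X where X: "finite X" "X \<subseteq> carrier M"
      "\<And>m. m \<in> carrier M \<Longrightarrow> \<exists>c \<in> X \<rightarrow> carrier R. m = (\<Oplus>\<^bsub>M\<^esub>x\<in>X. c x \<odot>\<^bsub>M\<^esub> x)"
    using fg unfolding fin_gen_module_def by blast
  obtain a :: "'c \<Rightarrow> nat" where a: "\<And>x. x \<in> X \<Longrightarrow> (f [^] a x) \<odot>\<^bsub>M\<^esub> x \<in> N"
    using ex X(2) by (metis subsetD)
  define b where "b = sum a X"
  define W where "W = {m \<in> carrier M. (f [^] b) \<odot>\<^bsub>M\<^esub> m \<in> N}"
  have "submodule W R M"
  proof (rule submoduleI')
    show "\<zero>\<^bsub>M\<^esub> \<in> W"
      using submodule_zero[OF N] f by (simp add: W_def)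
    show "x \<oplus>\<^bsub>M\<^esub> y \<in> W" if "x \<in> W" "y \<in> W" for x y
      using that f Nc(5) by (simp add: W_def smult_r_distr)
    show "r \<odot>\<^bsub>M\<^esub> x \<in> W" if r: "r \<in> carrier R" and x: "x \<in> W" for r x
    proof -
      have "(f [^] b) \<odot>\<^bsub>M\<^esub> (r \<odot>\<^bsub>M\<^esub> x) = r \<odot>\<^bsub>M\<^esub> ((f [^] b) \<odot>\<^bsub>M\<^esub> x)"
        using r x f by (simp add: W_def R.m_comm flip: smult_assoc1)
      then show ?thesis
        using r x Nc(4) by (simp add: W_def)
    qed
  qed (auto simp: W_def)
  moreover have "X \<subseteq> W"
  proof
    fix x assume x: "x \<in> X"
    have "a x \<le> b"
      unfolding b_def using X(1) x by (intro member_le_sum) auto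
    then have "f [^] b = f [^] (b - a x) \<otimes> f [^] a x"
      using f by (simp add: R.nat_pow_mult)
    then have "(f [^] b) \<odot>\<^bsub>M\<^esub> x = (f [^] (b - a x)) \<odot>\<^bsub>M\<^esub> ((f [^] a x) \<odot>\<^bsub>M\<^esub> x)"
      using f x X(2) by (auto simp: smult_assoc1)
    then show "x \<in> W"
      using Nc(4)[OF _ a[OF x]] f x X(2) by (auto simp: W_def)
  qed
  ultimately have "m \<in> W" if "m \<in> carrier M" for m
    using finsum_in_submodule[of W X] X(1) X(3)[OF that] by auto
  then show ?thesis
    by (auto simp: W_def)
qed

section \<open>Ascending chains of submodules\<close>

text \<open>A chain of ideals contains its own union as a member.\<close>

lemma (in noetherian_ring) ascending_ideals_stabilize:
  assumes I: "\<And>i::nat. ideal (I i) R" and mono: "\<And>i. I i \<subseteq> I (Suc i)"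
  shows "\<exists>k. \<forall>i\<ge>k. I i = I k"
proof -
  have le: "I i \<subseteq> I j" if "i \<le> j" for i j
    using lift_Suc_mono_le[of I, OF mono that] .
  have "subset.chain {I. ideal I R} (range I)"
    unfolding subset_chain_def
  proof (intro conjI ballI)
    fix X Y assume "X \<in> range I" "Y \<in> range I"
    then show "X \<subseteq> Y \<or> Y \<subseteq> X"
      using le nat_le_linear by (metis rangeE)
  qed (use I in auto)
  then have "\<Union> (range I) \<in> range I"
    by (intro ideal_chain_is_trivial) auto
  then obtain k where "\<Union> (range I) = I k"
    by auto
  then show ?thesis
    using le by (intro exI[of _ k]) blast
qed

context module
begin

definition noetherian_submodule :: "'c set \<Rightarrow> bool" where
  "noetherian_submodule W \<longleftrightarrow> submodule W R M \<and>
    (\<forall>N. (\<forall>i::nat. submodule (N i) R M \<and> N i \<subseteq> N (Suc i) \<and> N i \<subseteq> W) \<longrightarrow> (\<exists>k. \<forall>i\<ge>k. N i = N k))"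

lemma submodule_minus: "submodule N R M \<Longrightarrow> a \<in> N \<Longrightarrow> b \<in> N \<Longrightarrow> a \<ominus>\<^bsub>M\<^esub> b \<in> N"
  using submoduleE(3,5)[of N] by (simp add: a_minus_def)

lemma submodule_Int:
  assumes "submodule N R M" "submodule W R M"
  shows "submodule (N \<inter> W) R M"
  using submoduleE[OF assms(1)] submoduleE[OF assms(2)] submodule_zero[OF assms(1)] submodule_zero[OF assms(2)]
  by (intro submoduleI') auto

text \<open>A chain is controlled by two others: its intersections with \<open>W\<close>, and the ideals of the coefficients of
  \<open>x\<close> in its members. If both are constant from some point on, then so is the chain, since two elements
  with the same coefficient of \<open>x\<close> differ by an element of \<open>W\<close>.\<close>

lemma noetherian_submodule_insert:
  assumes R: "noetherian_ring R" and W: "noetherian_submodule W" and x: "x \<in> carrier M"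
  shows "noetherian_submodule {r \<odot>\<^bsub>M\<^esub> x \<oplus>\<^bsub>M\<^esub> w | r w. r \<in> carrier R \<and> w \<in> W}" (is "noetherian_submodule ?W'")
proof -
  have sW: "submodule W R M"
    using W by (simp add: noetherian_submodule_def)
  note Wc = submoduleE[OF sW] and W0 = submodule_zero[OF sW]
  have WM [simp]: "w \<in> carrier M" if "w \<in> W" for w
    using that Wc(1) by auto
  have "submodule ?W' R M"
  proof (rule submoduleI')
    show "?W' \<subseteq> carrier M"
      using x by auto
    have "\<zero>\<^bsub>M\<^esub> = \<zero> \<odot>\<^bsub>M\<^esub> x \<oplus>\<^bsub>M\<^esub> \<zero>\<^bsub>M\<^esub>"
      using x by simp
    then show "\<zero>\<^bsub>M\<^esub> \<in> ?W'"
      using W0 by blast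
    show "a \<oplus>\<^bsub>M\<^esub> b \<in> ?W'" if ab: "a \<in> ?W'" "b \<in> ?W'" for a b
    proof -
      obtain r v s w where c: "r \<in> carrier R" "v \<in> W" "a = r \<odot>\<^bsub>M\<^esub> x \<oplus>\<^bsub>M\<^esub> v"
        "s \<in> carrier R" "w \<in> W" "b = s \<odot>\<^bsub>M\<^esub> x \<oplus>\<^bsub>M\<^esub> w"
        using ab by auto
      then have "a \<oplus>\<^bsub>M\<^esub> b = (r \<oplus> s) \<odot>\<^bsub>M\<^esub> x \<oplus>\<^bsub>M\<^esub> (v \<oplus>\<^bsub>M\<^esub> w)"
        using x by (simp add: smult_l_distr M.a_ac)
      then show ?thesis
        using c Wc(5) by blast
    qed
    show "a \<odot>\<^bsub>M\<^esub> y \<in> ?W'" if a: "a \<in> carrier R" and y: "y \<in> ?W'" for a y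
    proof -
      obtain r v where c: "r \<in> carrier R" "v \<in> W" "y = r \<odot>\<^bsub>M\<^esub> x \<oplus>\<^bsub>M\<^esub> v"
        using y by auto
      then have "a \<odot>\<^bsub>M\<^esub> y = (a \<otimes> r) \<odot>\<^bsub>M\<^esub> x \<oplus>\<^bsub>M\<^esub> a \<odot>\<^bsub>M\<^esub> v"
        using x a by (simp add: smult_r_distr smult_assoc1)
      then show ?thesis
        using c a Wc(4) by blast
    qed
  qed
  moreover have "\<exists>k. \<forall>i\<ge>k. N i = N k"
    if N: "\<forall>i. submodule (N i) R M \<and> N i \<subseteq> N (Suc i) \<and> N i \<subseteq> ?W'" for N :: "nat \<Rightarrow> 'c set"
  proof -
    have sN: "submodule (N i) R M" for i
      using N by auto
    have NM [simp]: "y \<in> carrier M" if "y \<in> N i" for y i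
      using that submoduleE(1)[OF sN] by auto
    have le: "N i \<subseteq> N j" if "i \<le> j" for i j
      using lift_Suc_mono_le[of N, OF _ that] N by blast
    define I where "I i = {r \<in> carrier R. \<exists>w\<in>W. r \<odot>\<^bsub>M\<^esub> x \<oplus>\<^bsub>M\<^esub> w \<in> N i}" for i
    have I_I: "r \<in> I i" if "r \<in> carrier R" "w \<in> W" "r \<odot>\<^bsub>M\<^esub> x \<oplus>\<^bsub>M\<^esub> w \<in> N i" for r w i
      using that unfolding I_def by blast
    have "ideal (I i) R" for i
    proof (rule R.idealI')
      have "\<zero> \<odot>\<^bsub>M\<^esub> x \<oplus>\<^bsub>M\<^esub> \<zero>\<^bsub>M\<^esub> \<in> N i"
        using x submodule_zero[OF sN] by simp
      then show "\<zero> \<in> I i"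
        using W0 R.zero_closed unfolding I_def by blast
      show "a \<oplus> b \<in> I i" if ab: "a \<in> I i" "b \<in> I i" for a b
      proof -
        obtain v w where c: "v \<in> W" "a \<odot>\<^bsub>M\<^esub> x \<oplus>\<^bsub>M\<^esub> v \<in> N i" "w \<in> W" "b \<odot>\<^bsub>M\<^esub> x \<oplus>\<^bsub>M\<^esub> w \<in> N i"
          and R: "a \<in> carrier R" "b \<in> carrier R"
          using ab by (auto simp: I_def)
        have "(a \<oplus> b) \<odot>\<^bsub>M\<^esub> x \<oplus>\<^bsub>M\<^esub> (v \<oplus>\<^bsub>M\<^esub> w)
            = (a \<odot>\<^bsub>M\<^esub> x \<oplus>\<^bsub>M\<^esub> v) \<oplus>\<^bsub>M\<^esub> (b \<odot>\<^bsub>M\<^esub> x \<oplus>\<^bsub>M\<^esub> w)"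
          using x c(1,3) R by (simp add: smult_l_distr M.a_ac)
        then show ?thesis
          using R submoduleE(5)[OF sN c(2,4)] by (intro I_I[OF _ Wc(5)[OF c(1,3)]]) auto
      qed
      show "b \<otimes> a \<in> I i" if ab: "a \<in> I i" "b \<in> carrier R" for a b
      proof -
        obtain v where c: "v \<in> W" "a \<odot>\<^bsub>M\<^esub> x \<oplus>\<^bsub>M\<^esub> v \<in> N i" and R: "a \<in> carrier R"
          using ab by (auto simp: I_def)
        have "(b \<otimes> a) \<odot>\<^bsub>M\<^esub> x \<oplus>\<^bsub>M\<^esub> b \<odot>\<^bsub>M\<^esub> v = b \<odot>\<^bsub>M\<^esub> (a \<odot>\<^bsub>M\<^esub> x \<oplus>\<^bsub>M\<^esub> v)"
          using x c(1) R ab(2) by (simp add: smult_r_distr smult_assoc1)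
        then show ?thesis
          using R ab(2) submoduleE(4)[OF sN ab(2) c(2)] by (intro I_I[OF _ Wc(4)[OF ab(2) c(1)]]) auto
      qed
    qed (auto simp: I_def)
    moreover have "I i \<subseteq> I (Suc i)" for i
      using N by (auto simp: I_def)
    ultimately obtain k1 where k1: "\<And>i. i \<ge> k1 \<Longrightarrow> I i = I k1"
      using noetherian_ring.ascending_ideals_stabilize[OF R] by metis
    have "\<exists>k. \<forall>i\<ge>k. N i \<inter> W = N k \<inter> W"
    proof -
      have "\<forall>i. submodule (N i \<inter> W) R M \<and> N i \<inter> W \<subseteq> N (Suc i) \<inter> W \<and> N i \<inter> W \<subseteq> W"
        using N sW by (auto intro: submodule_Int)
      then show ?thesis
        using W unfolding noetherian_submodule_def by meson
    qed
    then obtain k2 where k2: "\<And>i. i \<ge> k2 \<Longrightarrow> N i \<inter> W = N k2 \<inter> W"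
      by blast
    define k where "k = max k1 k2"
    have "N i \<subseteq> N k" if i: "i \<ge> k" for i
    proof
      fix n assume n: "n \<in> N i"
      then obtain r w where c: "r \<in> carrier R" "w \<in> W" "n = r \<odot>\<^bsub>M\<^esub> x \<oplus>\<^bsub>M\<^esub> w"
        using N by blast
      then have "r \<in> I i"
        using n by (auto simp: I_def)
      then have "r \<in> I k"
        using k1[of i] k1[of k] i by (simp add: k_def)
      then obtain w' where w': "w' \<in> W" "r \<odot>\<^bsub>M\<^esub> x \<oplus>\<^bsub>M\<^esub> w' \<in> N k"
        by (auto simp: I_def)
      define n' where "n' = r \<odot>\<^bsub>M\<^esub> x \<oplus>\<^bsub>M\<^esub> w'"
      have "n \<ominus>\<^bsub>M\<^esub> n' = w \<ominus>\<^bsub>M\<^esub> w'"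
      proof -
        define y where "y = r \<odot>\<^bsub>M\<^esub> x"
        have y: "y \<in> carrier M" "w \<in> carrier M" "w' \<in> carrier M"
          using c w' x by (auto simp: y_def)
        have "(y \<oplus>\<^bsub>M\<^esub> w) \<ominus>\<^bsub>M\<^esub> (y \<oplus>\<^bsub>M\<^esub> w') = (y \<oplus>\<^bsub>M\<^esub> (\<ominus>\<^bsub>M\<^esub> y)) \<oplus>\<^bsub>M\<^esub> (w \<oplus>\<^bsub>M\<^esub> (\<ominus>\<^bsub>M\<^esub> w'))"
          using y by (simp add: a_minus_def M.minus_add M.a_ac del: M.r_neg)
        then show ?thesis
          using y by (simp add: c n'_def y_def[symmetric] a_minus_def M.r_neg)
      qed
      moreover have "n \<ominus>\<^bsub>M\<^esub> n' \<in> N i"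
        using n w'(2) le[OF i] by (intro submodule_minus[OF sN]) (auto simp: n'_def)
      ultimately have "n \<ominus>\<^bsub>M\<^esub> n' \<in> N i \<inter> W"
        using submodule_minus[OF sW c(2) w'(1)] by simp
      then have "n \<ominus>\<^bsub>M\<^esub> n' \<in> N k"
        using k2[of i] k2[of k] i by (auto simp: k_def)
      then have "(n \<ominus>\<^bsub>M\<^esub> n') \<oplus>\<^bsub>M\<^esub> n' \<in> N k"
        using w'(2) by (intro submoduleE(5)[OF sN]) (auto simp: n'_def)
      moreover have "n \<in> carrier M" "n' \<in> carrier M"
        using n w'(2) by (auto simp: n'_def)
      then have "(n \<ominus>\<^bsub>M\<^esub> n') \<oplus>\<^bsub>M\<^esub> n' = n"
        by (simp add: a_minus_def M.a_assoc M.l_neg)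
      ultimately show "n \<in> N k"
        by simp
    qed
    then show ?thesis
      using le by (intro exI[of _ k]) blast
  qed
  ultimately show ?thesis
    unfolding noetherian_submodule_def by blast
qed

lemma ascending_submodules_stabilize:
  assumes R: "noetherian_ring R" and fg: "fin_gen_module R M"
    and N: "\<And>i::nat. submodule (N i) R M" "\<And>i. N i \<subseteq> N (Suc i)"
  shows "\<exists>k. \<forall>i\<ge>k. N i = N k"
proof -
  obtain X where X: "finite X" "X \<subseteq> carrier M"
      "\<And>m. m \<in> carrier M \<Longrightarrow> \<exists>c \<in> X \<rightarrow> carrier R. m = (\<Oplus>\<^bsub>M\<^esub>x\<in>X. c x \<odot>\<^bsub>M\<^esub> x)"
    using fg unfolding fin_gen_module_def by blast
  have "\<exists>W. noetherian_submodule W \<and> X \<subseteq> W"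
    using X(1,2)
  proof induction
    case empty
    have "submodule {\<zero>\<^bsub>M\<^esub>} R M"
      by (rule submoduleI') auto
    moreover have "\<exists>k. \<forall>i\<ge>k. N i = N k"
      if N: "\<forall>i. submodule (N i) R M \<and> N i \<subseteq> N (Suc i) \<and> N i \<subseteq> {\<zero>\<^bsub>M\<^esub>}" for N :: "nat \<Rightarrow> 'c set"
    proof -
      have "N i = {\<zero>\<^bsub>M\<^esub>}" for i
        using N submoduleE(2)[of "N i"] by blast
      then show ?thesis
        by simp
    qed
    ultimately have "noetherian_submodule {\<zero>\<^bsub>M\<^esub>}"
      unfolding noetherian_submodule_def by blast
    then show ?case
      by blast
  next
    case (insert x X)
    then obtain W where W: "noetherian_submodule W" "X \<subseteq> W"
      by auto
    have x: "x \<in> carrier M"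
      using insert by auto
    have sW: "submodule W R M"
      using W by (simp add: noetherian_submodule_def)
    have "x = \<one> \<odot>\<^bsub>M\<^esub> x \<oplus>\<^bsub>M\<^esub> \<zero>\<^bsub>M\<^esub>"
      using x by simp
    moreover have "w = \<zero> \<odot>\<^bsub>M\<^esub> x \<oplus>\<^bsub>M\<^esub> w" if "w \<in> W" for w
      using x that submoduleE(1)[OF sW] by auto
    ultimately have "insert x X \<subseteq> {r \<odot>\<^bsub>M\<^esub> x \<oplus>\<^bsub>M\<^esub> w | r w. r \<in> carrier R \<and> w \<in> W}"
      using submodule_zero[OF sW] W(2) R.one_closed R.zero_closed by blast
    then show ?case
      using noetherian_submodule_insert[OF R W(1) x] by blast
  qed
  then obtain W where W: "noetherian_submodule W" "X \<subseteq> W"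
    by blast
  have "carrier M \<subseteq> W"
    using X(3) finsum_in_submodule[OF _ X(1) W(2)] W(1) by (metis noetherian_submodule_def subsetI)
  then have "\<forall>i. submodule (N i) R M \<and> N i \<subseteq> N (Suc i) \<and> N i \<subseteq> W"
    using N submoduleE(1)[OF N(1)] by blast
  then show ?thesis
    using W(1) unfolding noetherian_submodule_def by blast
qed

end

section \<open>Images of powers of $f$\<close>

locale F_regular_away = cartier_map R M p \<kappa>
  for R :: "'a ring" (structure) and M :: "('a, 'm) module" (structure) and p \<kappa> +
  fixes f :: 'a
  assumes f_closed [simp]: "f \<in> carrier R"
    and f_regular: "regular_on M f"
    and fin_gen: "fin_gen_module R M"
    and F_reg: "F_regular p (loc_ring R (powers_of R f)) (loc_module R (powers_of R f) M)
           (loc_kappa p R (powers_of R f) M \<kappa>)"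
begin

lemma f_pow_notin_prime:
  assumes "\<eta> \<in> associated_primes R M"
  shows "f [^] (n::nat) \<in> carrier R - \<eta>"
proof -
  have "submonoid (carrier R - \<eta>) R"
    using assms by (intro R.submonoid_compl_prime) (simp add: associated_primes_def)
  moreover have "f \<in> carrier R - \<eta>"
    using regular_notin_associated_prime[OF f_regular assms] by simp
  ultimately show ?thesis
    using submonoid.one_closed submonoid.m_closed by (induction n) fastforce+
qed

text \<open>By F-regularity of \<open>M\<^sub>f\<close>, every element of \<open>M\<close> is moved into \<open>N\<close> by a power of \<open>f\<close>; one exponent
  works for all elements because \<open>M\<close> is finitely generated.\<close>

lemma generic_submodule_contains_power:
  assumes N: "submodule N R M" and j: "\<And>n. n \<in> N \<Longrightarrow> \<kappa> ((f [^] (j::nat)) \<odot>\<^bsub>M\<^esub> n) \<in> N"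
    and gen: "\<And>\<eta>. \<eta> \<in> associated_primes R M \<Longrightarrow>
      \<exists>h. \<forall>m \<in> H0 R M \<eta> (carrier M). \<exists>t \<in> carrier R - \<eta>. t \<odot>\<^bsub>M\<^esub> (\<kappa> ^^ h) m \<in> N"
  shows "\<exists>a::nat. \<forall>m \<in> carrier M. (f [^] a) \<odot>\<^bsub>M\<^esub> m \<in> N"
proof -
  interpret regular_localization R M p \<kappa> "powers_of R f"
  proof (intro regular_localization.intro regular_localization_axioms.intro)
    show "cartier_localization R M p \<kappa> (powers_of R f)"
      using R.submonoid_powers_of[OF f_closed]
      by (simp add: cartier_localization_def localization_def localization_axioms_def
          cartier_map_axioms module_axioms)
    fix s m assume "s \<in> powers_of R f" "m \<in> carrier M" "s \<odot>\<^bsub>M\<^esub> m = \<zero>\<^bsub>M\<^esub>"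
    then show "m = \<zero>\<^bsub>M\<^esub>"
      using regular_on_pow[OF f_regular f_closed] by (auto simp: powers_of_def)
  qed
  show ?thesis
  proof (rule fin_gen_power_subset[OF fin_gen f_closed N])
    fix m assume "m \<in> carrier M"
    have "f [^] j \<in> powers_of R f"
      by (auto simp: powers_of_def)
    from F_regular_loc_subset[OF F_reg N this j gen \<open>m \<in> carrier M\<close>]
    have "\<exists>s\<in>powers_of R f. s \<odot>\<^bsub>M\<^esub> m \<in> N"
      by blast
    then show "\<exists>a::nat. (f [^] a) \<odot>\<^bsub>M\<^esub> m \<in> N"
      by (auto simp: powers_of_def)
  qed
qed

lemma f_pow_add: "m \<in> carrier M \<Longrightarrow> (f [^] (i + j :: nat)) \<odot>\<^bsub>M\<^esub> m = (f [^] i) \<odot>\<^bsub>M\<^esub> ((f [^] j) \<odot>\<^bsub>M\<^esub> m)"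
  by (simp add: smult_assoc1 flip: R.nat_pow_mult)

lemma f_pow_kpow:
  "m \<in> carrier M \<Longrightarrow> (f [^] (k::nat)) \<odot>\<^bsub>M\<^esub> (\<kappa> ^^ e) m = (\<kappa> ^^ e) ((f [^] (k * p ^ e)) \<odot>\<^bsub>M\<^esub> m)"
  by (simp add: R.nat_pow_pow flip: kpow_smult)

text \<open>$\kappa^e(f^k M)$, the building block of all modules below.\<close>

definition cpart :: "nat \<Rightarrow> nat \<Rightarrow> 'm set" where
  "cpart e k = (\<lambda>m. (\<kappa> ^^ e) ((f [^] k) \<odot>\<^bsub>M\<^esub> m)) ` carrier M"

lemma cpartI: "m \<in> carrier M \<Longrightarrow> (\<kappa> ^^ e) ((f [^] k) \<odot>\<^bsub>M\<^esub> m) \<in> cpart e k"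
  by (simp add: cpart_def)

lemma cpartE:
  assumes "x \<in> cpart e k"
  obtains m where "m \<in> carrier M" "x = (\<kappa> ^^ e) ((f [^] k) \<odot>\<^bsub>M\<^esub> m)"
  using assms by (auto simp: cpart_def)

lemma submodule_cpart: "submodule (cpart e k) R M"
proof -
  have "submodule ((\<lambda>m. (f [^] k) \<odot>\<^bsub>M\<^esub> m) ` carrier M) R M"
  proof (rule submoduleI')
    show "\<zero>\<^bsub>M\<^esub> \<in> (\<lambda>m. (f [^] k) \<odot>\<^bsub>M\<^esub> m) ` carrier M"
      by (rule image_eqI[of _ _ "\<zero>\<^bsub>M\<^esub>"]) auto
    show "a \<oplus>\<^bsub>M\<^esub> b \<in> (\<lambda>m. (f [^] k) \<odot>\<^bsub>M\<^esub> m) ` carrier M"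
      if "a \<in> (\<lambda>m. (f [^] k) \<odot>\<^bsub>M\<^esub> m) ` carrier M" "b \<in> (\<lambda>m. (f [^] k) \<odot>\<^bsub>M\<^esub> m) ` carrier M" for a b
      using that by (auto simp flip: smult_r_distr)
    show "a \<odot>\<^bsub>M\<^esub> x \<in> (\<lambda>m. (f [^] k) \<odot>\<^bsub>M\<^esub> m) ` carrier M"
      if a: "a \<in> carrier R" and x: "x \<in> (\<lambda>m. (f [^] k) \<odot>\<^bsub>M\<^esub> m) ` carrier M" for a x
    proof -
      obtain m where "m \<in> carrier M" "x = (f [^] k) \<odot>\<^bsub>M\<^esub> m"
        using x by auto
      then have "a \<odot>\<^bsub>M\<^esub> x = (f [^] k) \<odot>\<^bsub>M\<^esub> (a \<odot>\<^bsub>M\<^esub> m)"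
        using a by (simp add: R.m_comm flip: smult_assoc1)
      then show ?thesis
        using \<open>m \<in> carrier M\<close> a by blast
    qed
  qed auto
  then have "submodule ((\<kappa> ^^ e) ` ((\<lambda>m. (f [^] k) \<odot>\<^bsub>M\<^esub> m) ` carrier M)) R M"
    by (rule submodule_kpow_image)
  then show ?thesis
    by (simp only: cpart_def image_image)
qed

lemma cpart_antimono:
  assumes "k \<le> k'"
  shows "cpart e k' \<subseteq> cpart e k"
proof
  fix x assume "x \<in> cpart e k'"
  then obtain m where m: "m \<in> carrier M" "x = (\<kappa> ^^ e) ((f [^] k') \<odot>\<^bsub>M\<^esub> m)"
    by (rule cpartE)
  have "x = (\<kappa> ^^ e) ((f [^] k) \<odot>\<^bsub>M\<^esub> ((f [^] (k' - k)) \<odot>\<^bsub>M\<^esub> m))"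
    using m assms f_pow_add[of m k "k' - k"] by simp
  then show "x \<in> cpart e k"
    using m by (auto intro: cpartI)
qed

text \<open>$\kappa^d f^j \kappa^e f^k = \kappa^{d+e} f^{j p^e + k}$.\<close>

lemma cpart_mult:
  assumes x: "x \<in> cpart e k" and c: "c \<in> PIdl (f [^] (j::nat))"
  shows "(\<kappa> ^^ d) (c \<odot>\<^bsub>M\<^esub> x) \<in> cpart (d + e) (j * p ^ e + k)"
proof -
  obtain s where s: "s \<in> carrier R" "c = s \<otimes> f [^] j"
    using c by (auto simp: cgenideal_def)
  have xM: "x \<in> carrier M"
    using x submoduleE(1)[OF submodule_cpart] by blast
  have "s \<odot>\<^bsub>M\<^esub> x \<in> cpart e k"
    using submoduleE(4)[OF submodule_cpart] s(1) x by blast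
  then obtain m where m: "m \<in> carrier M" "s \<odot>\<^bsub>M\<^esub> x = (\<kappa> ^^ e) ((f [^] k) \<odot>\<^bsub>M\<^esub> m)"
    by (rule cpartE)
  have "c \<odot>\<^bsub>M\<^esub> x = (f [^] j) \<odot>\<^bsub>M\<^esub> (s \<odot>\<^bsub>M\<^esub> x)"
    using s xM by (simp add: R.m_comm flip: smult_assoc1)
  also have "\<dots> = (\<kappa> ^^ e) ((f [^] (j * p ^ e + k)) \<odot>\<^bsub>M\<^esub> m)"
    using m by (simp add: f_pow_kpow f_pow_add)
  finally show ?thesis
    using cpartI[OF m(1), of "d + e"] by (simp add: funpow_add)
qed

text \<open>The submodule \<open>\<kappa> M\<close> satisfies the generic condition, so that $f^b M \subseteq \kappa M$ for some \<open>b\<close>.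
  As $\kappa f^{kp} = f^k \kappa$, it follows that $f^{k+b} M \subseteq \kappa(f^{kp} M)$. Once
  \<open>k + b\<close> exceeds \<open>2 b\<close>, the exponent \<open>k p\<close> is strictly larger than \<open>k + b\<close>, so that applying
  \<open>\<kappa>\<close> more often allows ever larger exponents on the right-hand side.\<close>

lemma ex_test_exponent: "\<exists>c. \<forall>i. cpart 0 c \<subseteq> cpart i (c + i)"
proof -
  have "submodule ((\<kappa> ^^ 1) ` carrier M) R M"
    by (rule submodule_kpow_image[OF carrier_is_submodule])
  then have im: "submodule (\<kappa> ` carrier M) R M"
    by simp
  have "\<exists>b::nat. \<forall>m \<in> carrier M. (f [^] b) \<odot>\<^bsub>M\<^esub> m \<in> \<kappa> ` carrier M"
  proof (rule generic_submodule_contains_power[OF im, of 0])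
    show "\<kappa> ((f [^] (0::nat)) \<odot>\<^bsub>M\<^esub> n) \<in> \<kappa> ` carrier M" if "n \<in> \<kappa> ` carrier M" for n
      using that kappa_closed by auto
    fix \<eta> assume "\<eta> \<in> associated_primes R M"
    then have "\<one> \<in> carrier R - \<eta>"
      using f_pow_notin_prime[of \<eta> 0] by simp
    moreover have "\<one> \<odot>\<^bsub>M\<^esub> (\<kappa> ^^ 1) m \<in> \<kappa> ` carrier M" if "m \<in> H0 R M \<eta> (carrier M)" for m
      using that by (auto simp: H0_def kappa_closed)
    ultimately show "\<exists>h. \<forall>m \<in> H0 R M \<eta> (carrier M). \<exists>t \<in> carrier R - \<eta>. t \<odot>\<^bsub>M\<^esub> (\<kappa> ^^ h) m \<in> \<kappa> ` carrier M"
      by blast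
  qed
  then obtain b :: nat where b: "\<And>m. m \<in> carrier M \<Longrightarrow> (f [^] b) \<odot>\<^bsub>M\<^esub> m \<in> \<kappa> ` carrier M"
    by blast
  \<comment> \<open>The least \<open>c\<close> with \<open>2 * (c + i - b) \<ge> c + i + 1\<close> for all \<open>i\<close>.\<close>
  define c where "c = 2 * b + 1"
  have "cpart i (c + i) \<subseteq> cpart (Suc i) (c + Suc i)" for i
  proof
    fix x assume "x \<in> cpart i (c + i)"
    then obtain m where m: "m \<in> carrier M" "x = (\<kappa> ^^ i) ((f [^] (c + i)) \<odot>\<^bsub>M\<^esub> m)"
      by (rule cpartE)
    obtain n where n: "n \<in> carrier M" "(f [^] b) \<odot>\<^bsub>M\<^esub> m = \<kappa> n"
      using b[OF m(1)] by auto
    define k where "k = c + i - b"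
    have "c + i = k + b"
      by (simp add: k_def c_def)
    then have "(f [^] (c + i)) \<odot>\<^bsub>M\<^esub> m = (f [^] k) \<odot>\<^bsub>M\<^esub> (\<kappa> ^^ 1) n"
      using m n by (simp add: f_pow_add)
    also have "\<dots> = (\<kappa> ^^ 1) ((f [^] (k * p ^ 1)) \<odot>\<^bsub>M\<^esub> n)"
      by (rule f_pow_kpow[OF n(1)])
    finally have "x = (\<kappa> ^^ (i + 1)) ((f [^] (k * p)) \<odot>\<^bsub>M\<^esub> n)"
      unfolding funpow_add m(2) by simp
    then have "x \<in> cpart (Suc i) (k * p)"
      using cpartI[OF n(1), of "Suc i" "k * p"] by simp
    moreover have "c + Suc i \<le> k * 2"
      by (simp add: k_def c_def)
    then have "c + Suc i \<le> k * p"
      using p_gt_1 mult_le_mono2[of 2 p k] by linarith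
    ultimately show "x \<in> cpart (Suc i) (c + Suc i)"
      using cpart_antimono by blast
  qed
  then have "cpart 0 (c + 0) \<subseteq> cpart i (c + i)" for i
    using lift_Suc_mono_le[of "\<lambda>i. cpart i (c + i)" 0 i] by simp
  then show ?thesis
    by auto
qed

end

section \<open>Rounded exponents\<close>

definition tau_exponent :: "nat \<Rightarrow> rat \<Rightarrow> nat \<Rightarrow> nat" where
  "tau_exponent p l e = nat \<lceil>l * of_nat (p ^ e)\<rceil>"

definition sigma_exponent :: "nat \<Rightarrow> rat \<Rightarrow> nat \<Rightarrow> nat" where
  "sigma_exponent p l e = nat \<lceil>l * (of_nat (p ^ e) - 1)\<rceil>"

lemma of_nat_nat_ceiling:
  assumes "0 \<le> (x::rat)"
  shows "x \<le> of_nat (nat \<lceil>x\<rceil>)" "of_nat (nat \<lceil>x\<rceil>) < x + 1"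
proof -
  have "of_nat (nat \<lceil>x\<rceil>) = (of_int \<lceil>x\<rceil> :: rat)"
    using assms by (simp add: of_nat_nat)
  then show "x \<le> of_nat (nat \<lceil>x\<rceil>)" "of_nat (nat \<lceil>x\<rceil>) < x + 1"
    using ceiling_correct[of x] by linarith+
qed

lemma nat_le_of_rat_less: "of_nat m < (of_nat n + 1 :: rat) \<Longrightarrow> m \<le> n"
  by (metis less_Suc_eq_le of_nat_Suc of_nat_less_iff add.commute)

lemma tau_exponent_bounds:
  assumes "0 \<le> l"
  shows "l * of_nat (p ^ e) \<le> of_nat (tau_exponent p l e)"
    and "of_nat (tau_exponent p l e) < l * of_nat (p ^ e) + 1"
proof -
  have "0 \<le> l * of_nat (p ^ e)"
    using assms by (rule mult_nonneg_nonneg) simp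
  then show "l * of_nat (p ^ e) \<le> of_nat (tau_exponent p l e)"
    and "of_nat (tau_exponent p l e) < l * of_nat (p ^ e) + 1"
    using of_nat_nat_ceiling by (simp_all only: tau_exponent_def)
qed

lemma tau_exponent_add:
  assumes "0 \<le> l"
  shows "tau_exponent p l (e + n) \<le> tau_exponent p l e * p ^ n"
proof (rule nat_le_of_rat_less)
  have "l * of_nat (p ^ e) * of_nat (p ^ n) \<le> of_nat (tau_exponent p l e) * of_nat (p ^ n)"
    by (rule mult_right_mono[OF tau_exponent_bounds(1)[OF assms]]) simp
  then show "(of_nat (tau_exponent p l (e + n)) :: rat) < of_nat (tau_exponent p l e * p ^ n) + 1"
    using tau_exponent_bounds(2)[OF assms, of p "e + n"] by (simp add: power_add mult.assoc)
qed

lemma tau_exponent_mono: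
  assumes "l \<le> l'"
  shows "tau_exponent p l e \<le> tau_exponent p l' e"
  unfolding tau_exponent_def using assms by (intro nat_mono ceiling_mono mult_right_mono) auto

lemma tau_exponent_right:
  assumes "0 \<le> l" "0 \<le> \<epsilon>" "\<epsilon> * of_nat (p ^ e) < 1"
  shows "tau_exponent p (l + \<epsilon>) e \<le> tau_exponent p l e + 1"
proof (rule nat_le_of_rat_less)
  show "(of_nat (tau_exponent p (l + \<epsilon>) e) :: rat) < of_nat (tau_exponent p l e + 1) + 1"
    using tau_exponent_bounds(2)[of "l + \<epsilon>" p e] tau_exponent_bounds(1)[of l p e] assms
    by (simp add: distrib_right)
qed

lemma sigma_exponent_bounds:
  assumes "0 \<le> l" "1 < p"
  shows "l * (of_nat (p ^ e) - 1) \<le> of_nat (sigma_exponent p l e)"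
    and "of_nat (sigma_exponent p l e) < l * (of_nat (p ^ e) - 1) + 1"
proof -
  have "(1::rat) \<le> of_nat (p ^ e)"
    using assms(2) by (simp add: one_le_power)
  then have "0 \<le> l * (of_nat (p ^ e) - 1)"
    using assms(1) by (intro mult_nonneg_nonneg) auto
  then show "l * (of_nat (p ^ e) - 1) \<le> of_nat (sigma_exponent p l e)"
    and "of_nat (sigma_exponent p l e) < l * (of_nat (p ^ e) - 1) + 1"
    using of_nat_nat_ceiling by (simp_all only: sigma_exponent_def)
qed

text \<open>Here the hypothesis on the denominator enters: \<open>p\<close> divides \<open>D\<close> but neither \<open>a\<close> nor $p^e - 1$, so
  that $l(p^e-1) = a(p^e-1)/D$ is not an integer and rounding it up gains at least \<open>1/D\<close>.\<close>

lemma sigma_exponent_gain: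
  assumes p: "Factorial_Ring.prime p" and l: "0 \<le> l" and D: "quotient_of l = (a, D)" "int p dvd D"
    and e: "1 \<le> e"
  shows "l * (of_nat (p ^ e) - 1) + 1 / of_int D \<le> of_nat (sigma_exponent p l e)"
proof -
  have D0: "D > 0" and cop: "coprime a D" and la: "l = of_int a / of_int D"
    using D(1) quotient_of_denom_pos quotient_of_coprime quotient_of_div by auto
  define s where "s = int (sigma_exponent p l e)"
  define q where "q = int (p ^ e) - 1"
  have p1: "1 < p"
    using p prime_gt_1_nat by blast
  have "l * of_int q \<le> of_int s"
    using sigma_exponent_bounds(1)[OF l p1, of e] by (simp add: q_def s_def)
  then have "of_int (a * q) \<le> (of_int (s * D) :: rat)"
    using D0 by (simp add: la field_simps)
  then have le: "a * q \<le> s * D"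
    by (simp only: of_int_le_iff)
  have "a * q \<noteq> s * D"
  proof
    assume "a * q = s * D"
    then have "int p dvd a * q"
      using D(2) by simp
    moreover have "\<not> int p dvd a"
      using cop D(2) p by (meson coprime_common_divisor not_prime_unit prime_nat_int_transfer)
    moreover have "int p dvd int (p ^ e)"
      using e by (simp add: dvd_power)
    then have "\<not> int p dvd q"
      using p1 dvd_diff[of "int p" "int (p ^ e)" q] by (auto simp: q_def)
    ultimately show False
      using p prime_dvd_mult_iff[of "int p" a q] by auto
  qed
  then have "a * q + 1 \<le> s * D"
    using le by simp
  then have "(of_int (a * q + 1) :: rat) \<le> of_int (s * D)"
    by (simp only: of_int_le_iff)
  then have "l * of_int q + 1 / of_int D \<le> of_int s"
    using D0 by (simp add: la field_simps)
  then show ?thesis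
    by (simp add: q_def s_def)
qed

section \<open>The test module as an increasing union\<close>

text \<open>The inclusion $f^c M \subseteq \kappa^i(f^{c+i} M)$ makes \<open>f [^] c\<close> a test element: it is uniform in
  \<open>i\<close>, whereas the power of \<open>f\<close> that maps \<open>M\<close> into a given submodule depends on the submodule.\<close>

locale test_exponent = F_regular_away R M p \<kappa> f
  for R :: "'a ring" (structure) and M :: "('a, 'm) module" (structure) and p \<kappa> f +
  fixes c :: nat
  assumes test: "cpart 0 c \<subseteq> cpart i (c + i)"
begin

lemma cpart_step: "cpart e (k + c) \<subseteq> cpart (e + n) (k * p ^ n + c + n)"
proof
  fix x assume "x \<in> cpart e (k + c)"
  then obtain m where m: "m \<in> carrier M" "x = (\<kappa> ^^ e) ((f [^] (k + c)) \<odot>\<^bsub>M\<^esub> m)"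
    by (rule cpartE)
  have "(f [^] c) \<odot>\<^bsub>M\<^esub> m \<in> cpart n (c + n)"
    using cpartI[OF m(1), of 0 c] test[of n] by auto
  then obtain m' where m': "m' \<in> carrier M" "(f [^] c) \<odot>\<^bsub>M\<^esub> m = (\<kappa> ^^ n) ((f [^] (c + n)) \<odot>\<^bsub>M\<^esub> m')"
    by (rule cpartE)
  have "(f [^] (k + c)) \<odot>\<^bsub>M\<^esub> m = (f [^] k) \<odot>\<^bsub>M\<^esub> (\<kappa> ^^ n) ((f [^] (c + n)) \<odot>\<^bsub>M\<^esub> m')"
    using f_pow_add[OF m(1)] m'(2) by simp
  also have "\<dots> = (\<kappa> ^^ n) ((f [^] (k * p ^ n + (c + n))) \<odot>\<^bsub>M\<^esub> m')"
    using m'(1) by (simp add: f_pow_kpow f_pow_add)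
  finally have "x = (\<kappa> ^^ (e + n)) ((f [^] (k * p ^ n + c + n)) \<odot>\<^bsub>M\<^esub> m')"
    using m(2) by (simp add: funpow_add add.assoc)
  then show "x \<in> cpart (e + n) (k * p ^ n + c + n)"
    using m'(1) by (auto intro: cpartI)
qed

definition tpart :: "rat \<Rightarrow> nat \<Rightarrow> 'm set" where
  "tpart l e = cpart e (tau_exponent p l e + c)"

definition test_module :: "rat \<Rightarrow> 'm set" where
  "test_module l = (\<Union>e. tpart l e)"

text \<open>Going from \<open>e\<close> to \<open>e + n\<close> leaves room for \<open>n\<close> additional factors \<open>f\<close>. Therefore
  the modules \<open>tpart l e\<close> increase with \<open>e\<close>, and their union does not change if \<open>c\<close> is replaced by a larger
  constant.\<close>

lemma tpart_step:
  assumes "0 \<le> l"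
  shows "tpart l e \<subseteq> cpart (e + n) (tau_exponent p l (e + n) + c + n)"
proof -
  have "tau_exponent p l (e + n) + c + n \<le> tau_exponent p l e * p ^ n + c + n"
    using tau_exponent_add[OF assms] by simp
  then show ?thesis
    using cpart_step[of e "tau_exponent p l e" n] cpart_antimono unfolding tpart_def by blast
qed

lemma tpart_mono:
  assumes "0 \<le> l" "e \<le> e'"
  shows "tpart l e \<subseteq> tpart l e'"
proof -
  obtain n where "e' = e + n"
    using assms(2) le_iff_add by blast
  then show ?thesis
    using tpart_step[OF assms(1), of e n] cpart_antimono[of "tau_exponent p l e' + c" "tau_exponent p l e' + c + n" e']
    by (auto simp: tpart_def)
qed

lemma submodule_test_module:
  assumes "0 \<le> l"
  shows "submodule (test_module l) R M"
proof (rule submoduleI')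
  have tp: "submodule (tpart l e) R M" for e
    unfolding tpart_def by (rule submodule_cpart)
  show "test_module l \<subseteq> carrier M"
    using submoduleE(1)[OF tp] by (auto simp: test_module_def)
  show "\<zero>\<^bsub>M\<^esub> \<in> test_module l"
    using submodule_zero[OF tp] by (auto simp: test_module_def)
  show "a \<oplus>\<^bsub>M\<^esub> b \<in> test_module l" if ab: "a \<in> test_module l" "b \<in> test_module l" for a b
  proof -
    obtain d e where "a \<in> tpart l d" "b \<in> tpart l e"
      using ab by (auto simp: test_module_def)
    then have "a \<in> tpart l (max d e)" "b \<in> tpart l (max d e)"
      using tpart_mono[OF assms] by (meson max.cobounded1 max.cobounded2 subsetD)+
    then show ?thesis
      using submoduleE(5)[OF tp] by (auto simp: test_module_def)
  qed
  show "a \<odot>\<^bsub>M\<^esub> x \<in> test_module l" if "a \<in> carrier R" "x \<in> test_module l" for a x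
    using that submoduleE(4)[OF tp] by (auto simp: test_module_def)
qed

lemma test_module_stable:
  assumes l: "0 \<le> l" and x: "x \<in> test_module l" and a: "a \<in> PIdl (f [^] tau_exponent p l d)"
  shows "(\<kappa> ^^ d) (a \<odot>\<^bsub>M\<^esub> x) \<in> test_module l"
proof -
  obtain e where "x \<in> tpart l e"
    using x by (auto simp: test_module_def)
  then have "(\<kappa> ^^ d) (a \<odot>\<^bsub>M\<^esub> x) \<in> cpart (d + e) (tau_exponent p l d * p ^ e + (tau_exponent p l e + c))"
    unfolding tpart_def using a by (rule cpart_mult)
  moreover have "tau_exponent p l (d + e) + c \<le> tau_exponent p l d * p ^ e + (tau_exponent p l e + c)"
    using tau_exponent_add[OF l, of p d e] by simp
  ultimately have "(\<kappa> ^^ d) (a \<odot>\<^bsub>M\<^esub> x) \<in> tpart l (d + e)"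
    using cpart_antimono unfolding tpart_def by blast
  then show ?thesis
    by (auto simp: test_module_def)
qed

lemma power_in_tau_algebra: "f [^] tau_exponent p l d \<in> tau_algebra p R f l d"
proof -
  have "f [^] k \<in> PIdl (f [^] k)" for k :: nat
    by (simp add: R.cgenideal_self)
  then show ?thesis
    by (simp add: tau_algebra_def tau_exponent_def)
qed

text \<open>The module contains a power of \<open>f\<close> times \<open>M\<close>, and \<open>f\<close> lies in no associated prime.\<close>

lemma generic_condition_test_module:
  assumes "\<eta> \<in> associated_primes R M"
  shows "\<exists>h. \<forall>m \<in> H0 R M \<eta> (carrier M). \<exists>t \<in> carrier R - \<eta>. t \<odot>\<^bsub>M\<^esub> (\<kappa> ^^ h) m \<in> test_module l"
proof (intro exI ballI bexI)
  fix m assume "m \<in> H0 R M \<eta> (carrier M)"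
  then have "m \<in> carrier M"
    by (simp add: H0_def)
  then have "(f [^] (tau_exponent p l 0 + c)) \<odot>\<^bsub>M\<^esub> m \<in> tpart l 0"
    using cpartI[of m 0 "tau_exponent p l 0 + c"] by (simp add: tpart_def)
  then show "(f [^] (tau_exponent p l 0 + c)) \<odot>\<^bsub>M\<^esub> (\<kappa> ^^ 0) m \<in> test_module l"
    by (auto simp: test_module_def)
qed (rule f_pow_notin_prime[OF assms])

text \<open>For minimality let \<open>f [^] a\<close> map \<open>M\<close> into a competitor \<open>N\<close>. The \<open>a\<close> additional factors \<open>f\<close> gained by
  passing from \<open>e\<close> to \<open>e + a\<close> move the elements to which \<open>\<kappa> ^^ (e + a)\<close> is applied into
  $f^{\lceil l p^{e+a}\rceil} N$, and \<open>N\<close> is stable.\<close>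

lemma is_tau_test_module:
  assumes l: "0 \<le> l"
  shows "is_tau p R M \<kappa> f l (test_module l)"
  unfolding is_tau_def
proof (intro conjI allI impI)
  have f\<eta>: "f \<notin> \<eta>" if "\<eta> \<in> associated_primes R M" for \<eta>
    using regular_notin_associated_prime[OF f_regular that] .
  have "(\<kappa> ^^ e) (a \<odot>\<^bsub>M\<^esub> x) \<in> test_module l" if "a \<in> tau_algebra p R f l e" "x \<in> test_module l" for e a x
  proof (cases "e = 0")
    case True
    then show ?thesis
      using that submoduleE(4)[OF submodule_test_module[OF l]] by (simp add: tau_algebra_def)
  next
    case False
    then show ?thesis
      using that test_module_stable[OF l] by (simp add: tau_algebra_def tau_exponent_def)
  qed
  then show "csubmodule R (tau_algebra p R f l) (cmodule_of M \<kappa>) (test_module l)"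
    using submodule_test_module[OF l] unfolding csubmodule_iff by blast
  show "test_condition p R M \<kappa> f l (test_module l)"
  proof (subst test_condition_iff[OF f_closed f\<eta> submodule_test_module[OF l]])
    show "\<kappa> ((f [^] tau_exponent p l 1) \<odot>\<^bsub>M\<^esub> n) \<in> test_module l" if "n \<in> test_module l" for n
      using test_module_stable[OF l that, of "f [^] tau_exponent p l 1" 1] by (simp add: R.cgenideal_self)
  qed (use generic_condition_test_module in auto)
  fix N assume N: "csubmodule R (tau_algebra p R f l) (cmodule_of M \<kappa>) N \<and> test_condition p R M \<kappa> f l N"
  then have sN: "submodule N R M"
    by (simp add: csubmodule_iff)
  have stable: "(\<kappa> ^^ d) ((f [^] tau_exponent p l d) \<odot>\<^bsub>M\<^esub> x) \<in> N" if "x \<in> N" for d x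
    using N that power_in_tau_algebra unfolding csubmodule_iff by blast
  have k: "\<kappa> ((f [^] tau_exponent p l 1) \<odot>\<^bsub>M\<^esub> n) \<in> N" if "n \<in> N" for n
    using stable[OF that, of 1] by simp
  have "\<forall>\<eta> \<in> associated_primes R M. \<exists>h. \<forall>m \<in> H0 R M \<eta> (carrier M).
       \<exists>t \<in> carrier R - \<eta>. t \<odot>\<^bsub>M\<^esub> (\<kappa> ^^ h) m \<in> N"
    using N by (simp add: test_condition_iff[OF f_closed f\<eta> sN k])
  then obtain a :: nat where a: "\<And>m. m \<in> carrier M \<Longrightarrow> (f [^] a) \<odot>\<^bsub>M\<^esub> m \<in> N"
    using generic_submodule_contains_power[OF sN k] by blast
  have "tpart l e \<subseteq> N" for e
  proof
    fix x assume "x \<in> tpart l e"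
    then have "x \<in> cpart (e + a) (tau_exponent p l (e + a) + c + a)"
      using tpart_step[OF l] by blast
    then obtain m where m: "m \<in> carrier M"
        "x = (\<kappa> ^^ (e + a)) ((f [^] (tau_exponent p l (e + a) + c + a)) \<odot>\<^bsub>M\<^esub> m)"
      by (rule cpartE)
    have "(f [^] c) \<odot>\<^bsub>M\<^esub> ((f [^] a) \<odot>\<^bsub>M\<^esub> m) \<in> N"
      using a[OF m(1)] submoduleE(4)[OF sN] by simp
    moreover have "x = (\<kappa> ^^ (e + a)) ((f [^] tau_exponent p l (e + a)) \<odot>\<^bsub>M\<^esub> ((f [^] c) \<odot>\<^bsub>M\<^esub> ((f [^] a) \<odot>\<^bsub>M\<^esub> m)))"
      using m by (simp add: f_pow_add add.assoc)
    ultimately show "x \<in> N"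
      using stable by simp
  qed
  then show "test_module l \<subseteq> N"
    by (auto simp: test_module_def)
qed

text \<open>By the ascending chain condition the union is \<open>tpart l E\<close> for some \<open>E\<close>. This single stage is contained in
  the next one with one factor \<open>f\<close> to spare, which absorbs the increase of the rounded
  exponent at the stage \<open>E + 1\<close> caused by a small increase of \<open>l\<close>.\<close>

lemma test_module_right_constant:
  assumes R: "noetherian_ring R" and l: "0 \<le> l"
  shows "\<exists>\<delta> > 0. \<forall>\<epsilon>. 0 < \<epsilon> \<and> \<epsilon> < \<delta> \<longrightarrow> test_module (l + \<epsilon>) = test_module l"
proof -
  have "\<exists>E. \<forall>e\<ge>E. tpart l e = tpart l E"
    using ascending_submodules_stabilize[OF R fin_gen, of "tpart l"] tpart_mono[OF l] submodule_cpart
    by (simp add: tpart_def)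
  then obtain E where E: "\<And>e. E \<le> e \<Longrightarrow> tpart l e = tpart l E"
    by blast
  have T: "test_module l = tpart l E"
  proof -
    have "tpart l e \<subseteq> tpart l E" for e
      using tpart_mono[OF l, of e "max e E"] E[of "max e E"] by simp
    then show ?thesis
      by (auto simp: test_module_def)
  qed
  define \<delta> :: rat where "\<delta> = 1 / of_nat (p ^ (E + 1))"
  have pos: "(0::rat) < of_nat (p ^ (E + 1))"
    using p_gt_1 by simp
  have "test_module (l + \<epsilon>) = test_module l" if \<epsilon>: "0 < \<epsilon>" "\<epsilon> < \<delta>" for \<epsilon>
  proof
    have "tpart (l + \<epsilon>) e \<subseteq> tpart l e" for e
      unfolding tpart_def using tau_exponent_mono[of l "l + \<epsilon>" p e] \<epsilon> by (intro cpart_antimono) simp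
    then show "test_module (l + \<epsilon>) \<subseteq> test_module l"
      by (auto simp: test_module_def)
    have "\<epsilon> * of_nat (p ^ (E + 1)) < 1"
      using \<epsilon>(2) pos unfolding \<delta>_def by (simp only: pos_less_divide_eq)
    then have "tau_exponent p (l + \<epsilon>) (E + 1) + c \<le> tau_exponent p l (E + 1) + c + 1"
      using tau_exponent_right[OF l, of \<epsilon> p "E + 1"] \<epsilon>(1) by simp
    then have "test_module l \<subseteq> tpart (l + \<epsilon>) (E + 1)"
      using tpart_step[OF l, of E 1] cpart_antimono unfolding T unfolding tpart_def by blast
    then show "test_module l \<subseteq> test_module (l + \<epsilon>)"
      by (auto simp: test_module_def)
  qed
  then show ?thesis
    using pos by (intro exI[of _ \<delta>]) (simp add: \<delta>_def)
qed

section \<open>Non-F-pure modules\<close>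

lemma sigma_algebra_eq: "sigma_algebra p R f l e = PIdl (f [^] sigma_exponent p l e)"
  by (simp add: sigma_algebra_def sigma_exponent_def)

text \<open>An exponent $\lceil l p^d\rceil + c + 1$ suffices to split off $f^{\lceil l(p^d-1)\rceil}$ and still leave
  $f^{\lceil l\rceil + c}$, because $\lceil l(p^d-1)\rceil + \lceil l\rceil < l p^d + 2$. So
  every stage lies in $\mathcal C_+$ applied to the stage \<open>0\<close>.\<close>

lemma test_module_subset_cplus_power:
  assumes l: "0 \<le> l"
  shows "test_module l \<subseteq> cplus_power (sigma_algebra p R f l) (csub (carrier M)) h"
proof (induction h)
  case 0
  then show ?case
    using submoduleE(1)[OF submodule_test_module[OF l]] by (simp add: cplus_power_zero)
next
  case (Suc h)
  let ?C = "sigma_algebra p R f l" and ?V = "cplus_power (sigma_algebra p R f l) (csub (carrier M)) h"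
  have "tpart l e \<subseteq> cplus_mult ?C (csub (carrier M)) ?V" for e
  proof
    fix x assume x: "x \<in> tpart l e"
    define d where "d = e + 1"
    define t where "t = tau_exponent p l 0"
    have "x \<in> cpart d (tau_exponent p l d + c + 1)"
      using x tpart_step[OF l, of e 1] by (auto simp: d_def)
    moreover have "sigma_exponent p l d + (t + c) \<le> tau_exponent p l d + c + 1"
    proof -
      have "of_nat (sigma_exponent p l d) < l * (of_nat (p ^ d) - 1) + 1"
        by (rule sigma_exponent_bounds(2)[OF l p_gt_1])
      moreover have "of_nat t < l + 1"
        using tau_exponent_bounds(2)[OF l, of p 0] by (simp add: t_def)
      moreover have "l * of_nat (p ^ d) \<le> of_nat (tau_exponent p l d)"
        by (rule tau_exponent_bounds(1)[OF l])
      ultimately have "(of_nat (sigma_exponent p l d + t) :: rat) < of_nat (tau_exponent p l d + 1) + 1"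
        by (simp add: right_diff_distrib)
      then show ?thesis
        using nat_le_of_rat_less by fastforce
    qed
    ultimately have "x \<in> cpart d (sigma_exponent p l d + (t + c))"
      using cpart_antimono by blast
    then obtain m where m: "m \<in> carrier M" "x = (\<kappa> ^^ d) ((f [^] (sigma_exponent p l d + (t + c))) \<odot>\<^bsub>M\<^esub> m)"
      by (rule cpartE)
    have "(f [^] (t + c)) \<odot>\<^bsub>M\<^esub> m \<in> tpart l 0"
      using cpartI[OF m(1), of 0 "t + c"] by (simp add: tpart_def t_def)
    then have "(f [^] (t + c)) \<odot>\<^bsub>M\<^esub> m \<in> ?V"
      using Suc by (auto simp: test_module_def)
    moreover have "f [^] sigma_exponent p l d \<in> ?C d"
      by (simp add: sigma_algebra_eq R.cgenideal_self)
    moreover have "x = (\<kappa> ^^ d) ((f [^] sigma_exponent p l d) \<odot>\<^bsub>M\<^esub> ((f [^] (t + c)) \<odot>\<^bsub>M\<^esub> m))"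
      using m f_pow_add[OF m(1), of "sigma_exponent p l d" "t + c"] by simp
    ultimately show "x \<in> cplus_mult ?C (csub (carrier M)) ?V"
      using cplus_multI[of d _ ?C _ ?V] by (simp add: d_def)
  qed
  then show ?case
    by (auto simp: cplus_power_Suc test_module_def)
qed

text \<open>A product of \<open>h\<close> elements of positive degree is $\kappa^E f^X$ with $X - l p^E \ge -l + h/D$, since every
  factor gains \<open>1/D\<close> by rounding. For large \<open>h\<close> the bound is at least \<open>c + 1\<close>, so the product maps
  \<open>M\<close> into the test module.\<close>

lemma cplus_power_subset_test_module:
  assumes l: "0 \<le> l" and D: "0 < D"
    and gain: "\<And>e. 1 \<le> e \<Longrightarrow> l * (of_nat (p ^ e) - 1) + 1 / D \<le> of_nat (sigma_exponent p l e)"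
    and h: "l + of_nat c + 1 \<le> of_nat h / D"
  shows "cplus_power (sigma_algebra p R f l) (csub (carrier M)) h \<subseteq> test_module l"
proof -
  define u :: "nat \<Rightarrow> rat" where "u i = of_nat (h - i) / D" for i
  \<comment> \<open>Elements that the remaining \<open>h - i\<close> factors, whatever they are, move into the test module. As a condition on elements it is preserved by sums, which takes care of the sums of products in the definition of $\mathcal C_+^i M$.\<close>
  define A where "A i = {x \<in> carrier M. \<forall>E X r. r \<in> carrier R \<longrightarrow> l * of_nat (p ^ E) - l + u i \<le> of_nat X
      \<longrightarrow> (\<kappa> ^^ E) ((f [^] X) \<odot>\<^bsub>M\<^esub> (r \<odot>\<^bsub>M\<^esub> x)) \<in> test_module l}" for i
  note T = submodule_test_module[OF l]
  have sA: "submodule (A i) R M" for i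
  proof (rule submoduleI')
    show "\<zero>\<^bsub>M\<^esub> \<in> A i"
      using submodule_zero[OF T] by (simp add: A_def)
    show "a \<oplus>\<^bsub>M\<^esub> b \<in> A i" if "a \<in> A i" "b \<in> A i" for a b
      using that submoduleE(5)[OF T] by (simp add: A_def smult_r_distr kpow_add)
    show "a \<odot>\<^bsub>M\<^esub> x \<in> A i" if a: "a \<in> carrier R" and x: "x \<in> A i" for a x
    proof -
      have "r \<odot>\<^bsub>M\<^esub> (a \<odot>\<^bsub>M\<^esub> x) = (r \<otimes> a) \<odot>\<^bsub>M\<^esub> x" if "r \<in> carrier R" for r
        using that a x by (simp add: A_def smult_assoc1)
      then show ?thesis
        using a x by (simp add: A_def)
    qed
  qed (auto simp: A_def)
  have "cplus_power (sigma_algebra p R f l) (csub (carrier M)) i \<subseteq> A i" if "i \<le> h" for i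
    using that
  proof (induction i)
    case 0
    have "(\<kappa> ^^ E) ((f [^] X) \<odot>\<^bsub>M\<^esub> (r \<odot>\<^bsub>M\<^esub> m)) \<in> test_module l"
      if "m \<in> carrier M" "r \<in> carrier R" and X: "l * of_nat (p ^ E) - l + u 0 \<le> of_nat X" for m r E X
    proof -
      have "of_nat (tau_exponent p l E + c) < (of_nat X + 1 :: rat)"
        using X h tau_exponent_bounds(2)[OF l, of p E] by (simp add: u_def)
      then have "cpart E X \<subseteq> tpart l E"
        unfolding tpart_def by (intro cpart_antimono nat_le_of_rat_less)
      then show ?thesis
        using cpartI[of "r \<odot>\<^bsub>M\<^esub> m" E X] that by (auto simp: test_module_def)
    qed
    then show ?case
      by (auto simp: cplus_power_zero A_def)
  next
    case (Suc i)
    have u: "u i = u (Suc i) + 1 / D" "0 \<le> u (Suc i)"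
      using Suc.prems D by (simp_all add: u_def field_simps of_nat_diff)
    show ?case
      unfolding cplus_power_Suc
    proof (rule cplus_mult_subset[OF carrier_is_submodule sA])
      show "A (Suc i) \<subseteq> carrier M"
        by (auto simp: A_def)
      fix e :: nat and b x
      assume e: "1 \<le> e" and b: "b \<in> sigma_algebra p R f l e"
        and "x \<in> cplus_power (sigma_algebra p R f l) (csub (carrier M)) i"
      then have x: "x \<in> A i"
        using Suc by auto
      then have xM: "x \<in> carrier M"
        by (simp add: A_def)
      define s where "s = sigma_exponent p l e"
      obtain a where a: "a \<in> carrier R" "b = a \<otimes> f [^] s"
        using b by (auto simp: sigma_algebra_eq cgenideal_def s_def)
      have "(\<kappa> ^^ E) ((f [^] X) \<odot>\<^bsub>M\<^esub> (r \<odot>\<^bsub>M\<^esub> (\<kappa> ^^ e) (b \<odot>\<^bsub>M\<^esub> x))) \<in> test_module l"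
        if r: "r \<in> carrier R" and X: "l * of_nat (p ^ E) - l + u (Suc i) \<le> of_nat X" for E X r
      proof -
        have "(f [^] X) \<odot>\<^bsub>M\<^esub> (r \<odot>\<^bsub>M\<^esub> (\<kappa> ^^ e) (b \<odot>\<^bsub>M\<^esub> x))
            = (\<kappa> ^^ e) (((f [^] X \<otimes> r) [^] (p ^ e)) \<odot>\<^bsub>M\<^esub> (b \<odot>\<^bsub>M\<^esub> x))"
          using r a xM by (simp add: kpow_smult smult_assoc1)
        also have "((f [^] X \<otimes> r) [^] (p ^ e)) \<odot>\<^bsub>M\<^esub> (b \<odot>\<^bsub>M\<^esub> x)
            = (f [^] (X * p ^ e + s)) \<odot>\<^bsub>M\<^esub> ((r [^] (p ^ e) \<otimes> a) \<odot>\<^bsub>M\<^esub> x)"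
          using r a xM
          by (simp add: R.nat_pow_distrib R.nat_pow_pow R.m_ac flip: smult_assoc1 R.nat_pow_mult)
        finally have "(\<kappa> ^^ E) ((f [^] X) \<odot>\<^bsub>M\<^esub> (r \<odot>\<^bsub>M\<^esub> (\<kappa> ^^ e) (b \<odot>\<^bsub>M\<^esub> x)))
            = (\<kappa> ^^ (E + e)) ((f [^] (X * p ^ e + s)) \<odot>\<^bsub>M\<^esub> ((r [^] (p ^ e) \<otimes> a) \<odot>\<^bsub>M\<^esub> x))"
          by (simp add: funpow_add)
        moreover have "l * of_nat (p ^ (E + e)) - l + u i \<le> of_nat (X * p ^ e + s)"
        proof -
          define q :: rat where "q = of_nat (p ^ e)"
          have q: "1 \<le> q"
            using p_gt_1 by (simp add: q_def one_le_power)
          have "u (Suc i) \<le> u (Suc i) * q"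
            using mult_left_mono[OF q u(2)] by simp
          moreover have "(l * of_nat (p ^ E) - l + u (Suc i)) * q \<le> of_nat X * q"
            using X q by (intro mult_right_mono) auto
          moreover have "l * (q - 1) + 1 / D \<le> of_nat s"
            using gain[OF e] by (simp add: q_def s_def)
          ultimately have "l * (of_nat (p ^ E) * q) - l + u i \<le> of_nat X * q + of_nat s"
            unfolding u(1) by (simp add: algebra_simps)
          then show ?thesis
            by (simp add: q_def power_add)
        qed
        ultimately show ?thesis
          using x r a(1) by (simp add: A_def)
      qed
      then show "(\<kappa> ^^ e) (b \<odot>\<^bsub>M\<^esub> x) \<in> A (Suc i)"
        using a xM by (simp add: A_def)
    qed
  qed
  moreover have "A h \<subseteq> test_module l"
  proof
    fix x assume x: "x \<in> A h"
    then have "l * of_nat (p ^ 0) - l + u h \<le> of_nat 0 \<Longrightarrow>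
        (\<kappa> ^^ 0) ((f [^] (0::nat)) \<odot>\<^bsub>M\<^esub> (\<one> \<odot>\<^bsub>M\<^esub> x)) \<in> test_module l"
      unfolding A_def using R.one_closed by blast
    then have "(\<kappa> ^^ 0) ((f [^] (0::nat)) \<odot>\<^bsub>M\<^esub> (\<one> \<odot>\<^bsub>M\<^esub> x)) \<in> test_module l"
      by (simp add: u_def)
    then show "x \<in> test_module l"
      using x by (simp add: A_def)
  qed
  ultimately show ?thesis
    by blast
qed

lemma is_sigma_test_module:
  assumes p: "Factorial_Ring.prime p" and l: "0 \<le> l" and dvd: "int p dvd snd (quotient_of l)"
  shows "is_sigma p R M \<kappa> f l (test_module l)"
proof -
  obtain a D where D: "quotient_of l = (a, D)"
    by fastforce
  have D0: "D > 0"
    using quotient_of_denom_pos[OF D] .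
  obtain h\<^sub>0 where h0: "(l + of_nat c + 1) * of_int D \<le> of_nat h\<^sub>0"
    using real_arch_simple by blast
  have "cplus_power (sigma_algebra p R f l) (cmodule_of M \<kappa>) h = test_module l" if h: "h\<^sub>0 \<le> h" for h
  proof
    have "(l + of_nat c + 1) * of_int D \<le> of_nat h"
      using h0 h by (meson of_nat_mono order_trans)
    then have "l + of_nat c + 1 \<le> of_nat h / of_int D"
      using D0 by (simp add: field_simps)
    then show "cplus_power (sigma_algebra p R f l) (cmodule_of M \<kappa>) h \<subseteq> test_module l"
      using cplus_power_subset_test_module[OF l, of "of_int D"] sigma_exponent_gain[OF p l D] dvd D D0
      by (simp add: csub_carrier)
    show "test_module l \<subseteq> cplus_power (sigma_algebra p R f l) (cmodule_of M \<kappa>) h"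
      using test_module_subset_cplus_power[OF l] by (simp add: csub_carrier)
  qed
  then show ?thesis
    unfolding is_sigma_def by blast
qed

end

theorem corollary4p16:
  fixes p :: nat
    and K :: "'k ring"
    and R :: "'a ring"
    and M :: "('a, 'm) module"
    and \<kappa> :: "'m \<Rightarrow> 'm"
    and f :: 'a
    and l :: rat
  assumes "field K" and "prime_char p K" and "F_finite p K"
    and "cring R" and "noetherian_ring R" and "prime_char p R" and "ess_finite_type K R"
    and "cartier_module p R M \<kappa>"
    and "f \<in> carrier R" and "regular_on M f"
    and "F_regular p (loc_ring R (powers_of R f)) (loc_module R (powers_of R f) M)
           (loc_kappa p R (powers_of R f) M \<kappa>)"
    and "0 < l" and "int p dvd snd (quotient_of l)"
  shows "\<exists>\<delta> > 0. \<forall>\<epsilon>::rat. 0 < \<epsilon> \<and> \<epsilon> < \<delta> \<longrightarrow>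
           (\<exists>N. is_sigma p R M \<kappa> f l N \<and> is_tau p R M \<kappa> f (l + \<epsilon>) N)"
proof -
  have p: "Factorial_Ring.prime p"
    using assms(6) by (simp add: prime_char_def)
  have M: "module R M" and fg: "fin_gen_module R M" and \<kappa>: "linear_map R (frob_push p 1 R M) M \<kappa>"
    using assms(8) by (auto simp: cartier_module_def)
  interpret F_regular_away R M p \<kappa> f
  proof (intro F_regular_away.intro cartier_map.intro cartier_map_axioms.intro F_regular_away_axioms.intro)
    show "1 < p"
      using p by (rule prime_gt_1_nat)
  qed (use M fg \<kappa> assms in \<open>auto simp: linear_map_def frob_push_def\<close>)
  obtain c where "\<And>i. cpart 0 c \<subseteq> cpart i (c + i)"
    using ex_test_exponent by blast
  then interpret test_exponent R M p \<kappa> f c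
    by unfold_locales
  have l: "0 \<le> l"
    using assms(12) by simp
  obtain \<delta> where \<delta>: "\<delta> > 0" "\<And>\<epsilon>. 0 < \<epsilon> \<Longrightarrow> \<epsilon> < \<delta> \<Longrightarrow> test_module (l + \<epsilon>) = test_module l"
    using test_module_right_constant[OF assms(5) l] by blast
  have "is_sigma p R M \<kappa> f l (test_module l)"
    by (rule is_sigma_test_module[OF p l assms(13)])
  moreover have "is_tau p R M \<kappa> f (l + \<epsilon>) (test_module l)" if "0 < \<epsilon>" "\<epsilon> < \<delta>" for \<epsilon>
    using is_tau_test_module[of "l + \<epsilon>"] \<delta>(2)[OF that] that l by simp
  ultimately show ?thesis
    using \<delta>(1) by blast
qed

end
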